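(* Let $B\in E_K$, $s\in\mathbb{R}$, and $B_s(t)=B(s+t)$. Then $\mathcal{I}_U(B)=\mathcal{I}_U(B_s)$ and $\mathcal{I}_L(B)=\mathcal{I}_L(B_s)$.
   Context: Let $d\ge 1$, $I$ the identity matrix, $J=\begin{pmatrix}0&-I\\ I&0\end{pmatrix}$ the standard $2d\times 2d$ symplectic matrix, $\mathrm{Sp}(2d)=\{M\in GL(\mathbb{R}^{2d}): M^TJM=J\}$, $\mathbb{U}$ the unit circle in $\mathbb{C}$, and $\mathrm{Sym}(2d,\mathbb{R})$ the real symmetric $2d\times 2d$ matrices. For $K>0$, $E_K=\{B\in C^0(\mathbb{R},\mathrm{Sym}(2d,\mathbb{R})): \|B\|=\sup_t\|B(t)\|\le K\}$ (operator norm). For $B\in E_K$, $\gamma=\gamma_B$ is the fundamental solution: $\dot\gamma(t)=JB(t)\gamma(t)$, $\gamma(0)=I$. Maslov-type index: for $\omega\in\mathbb{U}$ let $\mathrm{Sp}(2d)^0_\omega=\{M\in\mathrm{Sp}(2d):\det(M-\omega I)=0\}$, a codimension-one hypersurface co-oriented at $M$ by the direction $\frac{d}{dt}Me^{tJ}|_{t=0}$. For a continuous path $\gamma:[a,b]\to\mathrm{Sp}(2d)$ and $M\in\mathrm{Sp}(2d)$, $\iota(\omega M,\gamma,[a,b])\in\mathbb{Z}$ is the intersection number of the path $t\mapsto e^{-\epsilon J}\gamma(t)M^{-1}$, $t\in[a,b]$, with the co-oriented hypersurface $\mathrm{Sp}(2d)^0_\omega$, for $\epsilon>0$ sufficiently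 small. For a path on $[0,T]$ with $\gamma(0)=I$, $i_\omega(\gamma,[0,T])=\iota(\omega I,\gamma,[0,T])-\frac12\dim_{\mathbb{C}}\ker(I-\omega I)$; thus $i_1(\gamma,[0,T])=\iota(I,\gamma,[0,T])-d$. Mean indices: $\mathcal{I}_U(B)=\limsup_{l\to+\infty}\frac{i_1(\gamma,[0,l])}{l}$, $\mathcal{I}_L(B)=\liminf_{l\to+\infty}\frac{i_1(\gamma,[0,l])}{l}$. *)

theory Defs
  imports "HOL-Analysis.Analysis"
begin

text \<open>
  The space \<open>\<real>\<^sup>2\<^sup>d\<close> is rendered as \<open>real ^ ('n + 'n)\<close> with \<open>d = CARD('n) \<ge> 1\<close>; the summands \<open>Inl\<close>
  and \<open>Inr\<close> index the first and the last \<open>d\<close> coordinates.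
\<close>

type_synonym 'n sqmat = "real ^ ('n + 'n) ^ ('n + 'n)"

definition J :: "'n::finite sqmat" where
  "J = (\<chi> i j. case (i, j) of
          (Inl k, Inr l) \<Rightarrow> if k = l then -1 else 0
        | (Inr k, Inl l) \<Rightarrow> if k = l then 1 else 0
        | _ \<Rightarrow> 0)"

text \<open>The matrix exponential of \<open>\<theta>J\<close>, in closed form, which is available because \<open>J ** J = - mat 1\<close>.\<close>

definition exp_J :: "real \<Rightarrow> 'n::finite sqmat" where
  "exp_J \<theta> = cos \<theta> *\<^sub>R mat 1 + sin \<theta> *\<^sub>R J"

definition Sp :: "'n::finite sqmat set" where
  "Sp = {M. invertible M \<and> transpose M ** J ** M = J}"

definition det_shift :: "complex \<Rightarrow> 'n::finite sqmat \<Rightarrow> complex" where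
  "det_shift \<omega> M = det (map_matrix complex_of_real M - mat \<omega>)"

definition Sp0 :: "complex \<Rightarrow> 'n::finite sqmat set" where
  "Sp0 \<omega> = {M \<in> Sp. det_shift \<omega> M = 0}"


subsection \<open>Intersection number with the co-oriented hypersurface\<close>

text \<open>
  Let \<open>M = \<tau> t\<close> lie in \<open>Sp0 \<omega>\<close> and let \<open>f'\<close> be the derivative of \<open>det_shift \<omega>\<close> at \<open>M\<close>. The vector
  \<open>M ** J\<close> is the derivative of \<open>M ** exp_J \<theta>\<close> at \<open>\<theta> = 0\<close>, i.e. the co-orienting direction. For
  \<open>\<omega>\<close> on the unit circle, \<open>f' (M ** J) \<noteq> 0\<close> holds exactly when the kernel of \<open>M - \<omega>I\<close> has complex
  dimension one, i.e. when \<open>M\<close> lies on the smooth part of the hypersurface, and the tangent space of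
  the hypersurface is then the kernel of \<open>f'\<close> on the tangent space of \<open>Sp\<close>. So the predicate says
  that \<open>M\<close> is a smooth point of the hypersurface and that the velocity of \<open>\<tau>\<close> at time \<open>t\<close> is
  \<open>c *\<^sub>R (M ** J)\<close> up to a vector tangent to the hypersurface. The coefficient is real because
  \<open>det_shift \<omega>\<close> is a real function on \<open>Sp\<close> up to the constant phase \<open>\<omega>\<^sup>d\<close>.
\<close>

definition crossing_speed :: "complex \<Rightarrow> (real \<Rightarrow> 'n::finite sqmat) \<Rightarrow> real \<Rightarrow> real \<Rightarrow> bool" where
  "crossing_speed \<omega> \<tau> t c \<longleftrightarrow>
     (\<exists>V f'. (\<tau> has_vector_derivative V) (at t) \<and>
             (det_shift \<omega> has_derivative f') (at (\<tau> t)) \<and>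
             f' (\<tau> t ** J) \<noteq> 0 \<and>
             f' V = c *\<^sub>R f' (\<tau> t ** J))"

definition transversal_path :: "complex \<Rightarrow> (real \<Rightarrow> 'n::finite sqmat) \<Rightarrow> real \<Rightarrow> real \<Rightarrow> bool" where
  "transversal_path \<omega> \<tau> a b \<longleftrightarrow>
     continuous_on {a..b} \<tau> \<and> \<tau> ` {a..b} \<subseteq> Sp \<and>
     \<tau> a \<notin> Sp0 \<omega> \<and> \<tau> b \<notin> Sp0 \<omega> \<and>
     finite {t \<in> {a..b}. \<tau> t \<in> Sp0 \<omega>} \<and>
     (\<forall>t\<in>{a..b}. \<tau> t \<in> Sp0 \<omega> \<longrightarrow> (\<exists>c. c \<noteq> 0 \<and> crossing_speed \<omega> \<tau> t c))"

definition crossing_count :: "complex \<Rightarrow> (real \<Rightarrow> 'n::finite sqmat) \<Rightarrow> real \<Rightarrow> real \<Rightarrow> int" where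
  "crossing_count \<omega> \<tau> a b =
     int (card {t \<in> {a..b}. \<tau> t \<in> Sp0 \<omega> \<and> (\<exists>c>0. crossing_speed \<omega> \<tau> t c)})
   - int (card {t \<in> {a..b}. \<tau> t \<in> Sp0 \<omega> \<and> (\<exists>c<0. crossing_speed \<omega> \<tau> t c)})"

text \<open>
  The intersection number of a continuous path in \<open>Sp\<close> with endpoints off \<open>Sp0 \<omega>\<close>: the signed count
  of crossings of any transversal path homotopic to it in \<open>Sp\<close> with fixed endpoints. (The points of
  \<open>Sp0 \<omega>\<close> that are not smooth have codimension at least three in \<open>Sp\<close>, so such paths exist and
  the count does not depend on the choice.)
\<close>

definition intersection_number ::
    "complex \<Rightarrow> (real \<Rightarrow> 'n::finite sqmat) \<Rightarrow> real \<Rightarrow> real \<Rightarrow> int" where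
  "intersection_number \<omega> \<sigma> a b =
     (THE k. \<exists>\<tau>. homotopic_with_canon (\<lambda>\<rho>. \<rho> a = \<sigma> a \<and> \<rho> b = \<sigma> b) {a..b} Sp \<sigma> \<tau> \<and>
                 transversal_path \<omega> \<tau> a b \<and> k = crossing_count \<omega> \<tau> a b)"


subsection \<open>Maslov-type indices\<close>

text \<open>
  \<open>maslov_iota \<omega> M \<gamma> a b\<close> is \<open>\<iota>(\<omega>M, \<gamma>, [a,b])\<close>: the common value of the intersection numbers for all
  sufficiently small \<open>\<epsilon> > 0\<close>.
\<close>

definition maslov_iota ::
    "complex \<Rightarrow> 'n::finite sqmat \<Rightarrow> (real \<Rightarrow> 'n sqmat) \<Rightarrow> real \<Rightarrow> real \<Rightarrow> int" where
  "maslov_iota \<omega> M \<gamma> a b =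
     (THE k. \<forall>\<^sub>F \<epsilon> in at_right 0.
        intersection_number \<omega> (\<lambda>t. exp_J (- \<epsilon>) ** \<gamma> t ** matrix_inv M) a b = k)"

definition maslov_index :: "complex \<Rightarrow> (real \<Rightarrow> 'n::finite sqmat) \<Rightarrow> real \<Rightarrow> real" where
  "maslov_index \<omega> \<gamma> T =
     real_of_int (maslov_iota \<omega> (mat 1) \<gamma> 0 T)
     - 1 / 2 * real (vec.dim {x :: complex ^ ('n + 'n). (mat 1 - mat \<omega>) *v x = 0})"


subsection \<open>Linear Hamiltonian systems and mean indices\<close>

text \<open>The supremum is taken in \<open>ereal\<close>, so that it makes sense before \<open>B\<close> is known to be bounded.\<close>

definition E :: "real \<Rightarrow> (real \<Rightarrow> 'n::finite sqmat) set" where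
  "E K = {B. continuous_on UNIV B \<and> (\<forall>t. transpose (B t) = B t) \<and>
             (SUP t. ereal (onorm ((*v) (B t)))) \<le> ereal K}"

definition fundamental_solution :: "(real \<Rightarrow> 'n::finite sqmat) \<Rightarrow> real \<Rightarrow> 'n sqmat" where
  "fundamental_solution B =
     (THE \<gamma>. \<gamma> 0 = mat 1 \<and> (\<forall>t. (\<gamma> has_vector_derivative J ** B t ** \<gamma> t) (at t)))"

definition mean_index_U :: "(real \<Rightarrow> 'n::finite sqmat) \<Rightarrow> ereal" where
  "mean_index_U B =
     Limsup at_top (\<lambda>l::real. ereal (maslov_index 1 (fundamental_solution B) l / l))"

definition mean_index_L :: "(real \<Rightarrow> 'n::finite sqmat) \<Rightarrow> ereal" where
  "mean_index_L B =
     Liminf at_top (\<lambda>l::real. ereal (maslov_index 1 (fundamental_solution B) l / l))"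

end

(* For symplectic M and real z > 0 the complex matrix M - I - i z J (M + I) is invertible, because M
   preserves the Hermitian form x^* i J x; let G z M be its determinant, so that G 0 M = det (M - I) is
   real. When a path crosses the hypersurface transversally, the argument of G z along the path, for
   small z > 0, changes by plus or minus pi according to the sign of the crossing. Hence the signed
   count of crossings is the change of arg (G 1) along the path, corrected by the changes of
   arg (G z M), z in [0,1], at the two endpoints M. This is homotopy invariant and, as G is a
   polynomial of bounded degree in z, agrees up to a constant with the change of arg (G 1) alone.
   A transversal path exists in each homotopy class: a Cayley-type chart turns Sp locally into the
   symmetric matrices and the hypersurface into the singular ones, where lines S + u A with A near I
   diagonal in a generic way in an eigenbasis of S cross simply.
   The flows of the shifts B_{us}, u in [0,1], form a homotopy between the flow of B and that of B_s.
   The inverse of M - I - i J (M + I) is bounded uniformly on Sp, so arg (G 1) at time l changes by a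
   bounded amount along the homotopy, independently of l. The two indices thus differ by O(1). *)

theory Submission
  imports Defs "HOL-Computational_Algebra.Fundamental_Theorem_Algebra"
begin

subsection \<open>The change of argument of a nonvanishing path\<close>

text \<open>With a real number \<open>z\<close> in place of \<open>- \<i> z\<close>, the matrix
  \<open>M - I + z J (M + I)\<close> is for \<open>z = - tan (\<theta> / 2)\<close> an invertible
  multiple of \<open>exp_J (- \<theta>) ** M - mat 1\<close>. So \<open>G\<close> continues the
  rotations in the definition of the index to imaginary parameters, and the tangent makes it
  polynomial. A count of real zeros can become a change of argument because nothing vanishes on the
  negative imaginary axis. Two obstacles shape the proof. The index, the intersection number and the
  flow are definite descriptions, so existence of a transversal representative and of a global flow
  must be proved before anything is known about their values; most of the linear algebra serves that
  purpose. And the flow may be unbounded as time grows, so compactness yields no estimate for the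
  homotopy between shifted flows. Instead, the flows of nearby shifts are intertwined by two
  short-time flows, one on each side, and these change the determinant by a factor close to 1 at
  every time simultaneously.\<close>

definition darg :: "(real \<Rightarrow> complex) \<Rightarrow> real \<Rightarrow> real \<Rightarrow> real" where
  "darg g a b = (SOME d. \<exists>\<phi>. continuous_on {a..b} \<phi> \<and> (\<forall>t\<in>{a..b}. g t = exp (\<phi> t)) \<and> d = Im (\<phi> b) - Im (\<phi> a))"

text \<open>Two logarithms of the same function differ by a continuous function whose values are
  integer multiples of 2 pi i; the gaps between these values force it to be constant.\<close>

lemma Im_log_increment_unique:
  fixes \<phi> \<psi> :: "real \<Rightarrow> complex"
  assumes "a \<le> b" "continuous_on {a..b} \<phi>" "continuous_on {a..b} \<psi>"
    and "\<And>t. t \<in> {a..b} \<Longrightarrow> exp (\<phi> t) = exp (\<psi> t)"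
  shows "Im (\<phi> b) - Im (\<phi> a) = Im (\<psi> b) - Im (\<psi> a)"
proof -
  have "(\<lambda>t. \<phi> t - \<psi> t) constant_on {a..b}"
  proof (rule continuous_discrete_range_constant)
    show "continuous_on {a..b} (\<lambda>t. \<phi> t - \<psi> t)" using assms by (intro continuous_intros)
    fix x assume x: "x \<in> {a..b}"
    show "\<exists>e>0. \<forall>y. y \<in> {a..b} \<and> \<phi> y - \<psi> y \<noteq> \<phi> x - \<psi> x \<longrightarrow> e \<le> cmod (\<phi> y - \<psi> y - (\<phi> x - \<psi> x))"
    proof (intro exI[of _ "2*pi"] conjI allI impI)
      fix y assume y: "y \<in> {a..b} \<and> \<phi> y - \<psi> y \<noteq> \<phi> x - \<psi> x"
      have "exp (\<phi> y - \<psi> y) = exp (\<phi> x - \<psi> x)"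
        using assms(4) x y by (simp add: exp_diff)
      then obtain n :: int where n: "\<phi> y - \<psi> y = \<phi> x - \<psi> x + (of_int (2 * n) * pi) * \<i>"
        unfolding exp_eq by auto
      with y have "n \<noteq> 0" by auto
      then have "\<bar>real_of_int n\<bar> \<ge> 1" by linarith
      then have "2 * pi \<le> 2 * \<bar>real_of_int n\<bar> * pi" by simp
      moreover have "cmod (\<phi> y - \<psi> y - (\<phi> x - \<psi> x)) = 2 * \<bar>real_of_int n\<bar> * pi"
        unfolding n by (simp add: norm_mult)
      ultimately show "2 * pi \<le> cmod (\<phi> y - \<psi> y - (\<phi> x - \<psi> x))" by simp
    qed simp
  qed simp
  then have "\<phi> b - \<psi> b = \<phi> a - \<psi> a" using assms(1) unfolding constant_on_def by (metis atLeastAtMost_iff order_refl)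
  then have "Im (\<phi> b - \<psi> b) = Im (\<phi> a - \<psi> a)" by simp
  then show ?thesis by simp
qed

text \<open>Uniqueness of the increment makes the choice in \<open>darg\<close> harmless: any
  continuous logarithm computes it.\<close>

lemma darg_eq:
  assumes "a \<le> b" "continuous_on {a..b} \<phi>" "\<And>t. t \<in> {a..b} \<Longrightarrow> g t = exp (\<phi> t)"
  shows "darg g a b = Im (\<phi> b) - Im (\<phi> a)"
  unfolding darg_def
proof (rule some_equality)
  show "\<exists>\<psi>. continuous_on {a..b} \<psi> \<and> (\<forall>t\<in>{a..b}. g t = exp (\<psi> t)) \<and> Im (\<phi> b) - Im (\<phi> a) = Im (\<psi> b) - Im (\<psi> a)"
    using assms by blast
  fix d assume "\<exists>\<psi>. continuous_on {a..b} \<psi> \<and> (\<forall>t\<in>{a..b}. g t = exp (\<psi> t)) \<and> d = Im (\<psi> b) - Im (\<psi> a)"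
  then show "d = Im (\<phi> b) - Im (\<phi> a)"
    using Im_log_increment_unique[OF assms(1,2)] assms(3) by metis
qed

lemma darg_cong:
  assumes "a \<le> b" "\<And>t. t \<in> {a..b} \<Longrightarrow> f t = g t"
  shows "darg f a b = darg g a b"
proof -
  have "(\<forall>t\<in>{a..b}. f t = exp (\<phi> t)) = (\<forall>t\<in>{a..b}. g t = exp (\<phi> t))" for \<phi> :: "real \<Rightarrow> complex"
    using assms(2) by auto
  then show ?thesis unfolding darg_def by simp
qed

lemma continuous_log_convex:
  fixes f :: "'a::real_normed_vector \<Rightarrow> complex"
  assumes "continuous_on S f" "convex S" "\<And>z. z \<in> S \<Longrightarrow> f z \<noteq> 0"
  obtains \<phi> where "continuous_on S \<phi>" "\<And>x. x \<in> S \<Longrightarrow> f x = exp (\<phi> x)"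
  using continuous_logarithm_on_contractible[OF assms(1) convex_imp_contractible[OF assms(2)] assms(3)] by blast

lemma darg_combine:
  assumes "a \<le> b" "b \<le> c" "continuous_on {a..c} g" "\<And>t. t \<in> {a..c} \<Longrightarrow> g t \<noteq> 0"
  shows "darg g a c = darg g a b + darg g b c"
proof -
  obtain \<phi> where \<phi>: "continuous_on {a..c} \<phi>" "\<And>x. x \<in> {a..c} \<Longrightarrow> g x = exp (\<phi> x)"
    using continuous_log_convex[OF assms(3) _ assms(4)] by blast
  have "darg g a c = Im (\<phi> c) - Im (\<phi> a)" using \<phi> assms by (intro darg_eq) auto
  moreover have "darg g a b = Im (\<phi> b) - Im (\<phi> a)" using \<phi> assms 
    by (intro darg_eq) (auto intro: continuous_on_subset)
  moreover have "darg g b c = Im (\<phi> c) - Im (\<phi> b)" using \<phi> assms 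
    by (intro darg_eq) (auto intro: continuous_on_subset)
  ultimately show ?thesis by simp
qed

text \<open>A rectangle is contractible, so one logarithm serves on all of it and the increments
  along the four sides cancel. The homotopy arguments below are all reduced to this
  identity.\<close>

lemma darg_rectangle:
  fixes h :: "real \<times> real \<Rightarrow> complex"
  assumes "a \<le> b" "c \<le> d" "continuous_on ({a..b} \<times> {c..d}) h"
    and "\<And>x y. x \<in> {a..b} \<Longrightarrow> y \<in> {c..d} \<Longrightarrow> h (x, y) \<noteq> 0"
  shows "darg (\<lambda>x. h (x, c)) a b + darg (\<lambda>y. h (b, y)) c d = darg (\<lambda>y. h (a, y)) c d + darg (\<lambda>x. h (x, d)) a b"
proof -
  obtain \<phi> where \<phi>: "continuous_on ({a..b} \<times> {c..d}) \<phi>" "\<And>x. x \<in> {a..b} \<times> {c..d} \<Longrightarrow> h x = exp (\<phi> x)"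
  proof (rule continuous_log_convex[OF assms(3)])
    show "convex ({a..b} \<times> {c..d})" by (intro convex_Times) auto
  qed (use assms(4) in auto)
  have 1: "darg (\<lambda>x. h (x, y)) a b = Im (\<phi> (b, y)) - Im (\<phi> (a, y))" if "y \<in> {c..d}" for y
    using assms(1) that \<phi>(2)
    by (intro darg_eq[where \<phi> = "\<lambda>x. \<phi> (x, y)"] continuous_on_compose2[OF \<phi>(1)] continuous_intros) auto
  have 2: "darg (\<lambda>y. h (x, y)) c d = Im (\<phi> (x, d)) - Im (\<phi> (x, c))" if "x \<in> {a..b}" for x
    using assms(2) that \<phi>(2)
    by (intro darg_eq[where \<phi> = "\<lambda>y. \<phi> (x, y)"] continuous_on_compose2[OF \<phi>(1)] continuous_intros) auto
  show ?thesis using assms 1 2 by simp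
qed

lemma darg_mult:
  assumes "a \<le> b" "continuous_on {a..b} f" "continuous_on {a..b} g"
    "\<And>t. t \<in> {a..b} \<Longrightarrow> f t \<noteq> 0" "\<And>t. t \<in> {a..b} \<Longrightarrow> g t \<noteq> 0"
  shows "darg (\<lambda>t. f t * g t) a b = darg f a b + darg g a b"
proof -
  obtain \<phi> where \<phi>: "continuous_on {a..b} \<phi>" "\<And>x. x \<in> {a..b} \<Longrightarrow> f x = exp (\<phi> x)"
    using continuous_log_convex[OF assms(2) _ assms(4)] by blast
  obtain \<psi> where \<psi>: "continuous_on {a..b} \<psi>" "\<And>x. x \<in> {a..b} \<Longrightarrow> g x = exp (\<psi> x)"
    using continuous_log_convex[OF assms(3) _ assms(5)] by blast
  have "darg f a b = Im (\<phi> b) - Im (\<phi> a)" using \<phi> assms by (intro darg_eq) auto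
  moreover have "darg g a b = Im (\<psi> b) - Im (\<psi> a)" using \<psi> assms by (intro darg_eq) auto
  moreover have "darg (\<lambda>t. f t * g t) a b = Im (\<phi> b + \<psi> b) - Im (\<phi> a + \<psi> a)" using \<phi> \<psi> assms
    by (intro darg_eq[where \<phi> = "\<lambda>t. \<phi> t + \<psi> t"]) (auto intro!: continuous_intros simp: exp_add)
  ultimately show ?thesis by simp
qed

text \<open>The factor \<open>c\<close> turns the image away from the branch cut of
  \<open>Ln\<close>; its own logarithm cancels in the difference.\<close>

lemma darg_Ln:
  assumes "a \<le> b" "continuous_on {a..b} g" "c \<noteq> 0" "\<And>t. t \<in> {a..b} \<Longrightarrow> c * g t \<notin> \<real>\<^sub>\<le>\<^sub>0"
  shows "darg g a b = Im (Ln (c * g b)) - Im (Ln (c * g a))"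
proof -
  have nz: "g t \<noteq> 0" if "t \<in> {a..b}" for t using assms(4)[OF that] by auto
  have "darg g a b = Im (Ln (c * g b) - Ln c) - Im (Ln (c * g a) - Ln c)"
    using assms nz
    by (intro darg_eq[where \<phi> = "\<lambda>t. Ln (c * g t) - Ln c"] continuous_intros) (auto simp: exp_diff)
  then show ?thesis by simp
qed

text \<open>Staying within distance one of \<open>1\<close>, the ratio keeps a positive real part,
  so the principal logarithm follows it; \<open>pi\<close> is just the crude range of
  \<open>Im (Ln _)\<close>.\<close>

lemma darg_near:
  assumes "a \<le> b" "continuous_on {a..b} g" "\<And>t. t \<in> {a..b} \<Longrightarrow> cmod (g t / g a - 1) < 1"
  shows "\<bar>darg g a b\<bar> \<le> pi"
proof -
  have ga: "g a \<noteq> 0" using assms(3)[of a] assms(1) by auto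
  have *: "inverse (g a) * g t \<notin> \<real>\<^sub>\<le>\<^sub>0" if "t \<in> {a..b}" for t
  proof
    assume n: "inverse (g a) * g t \<in> \<real>\<^sub>\<le>\<^sub>0"
    then have "Re (g t / g a) \<le> 0" by (simp add: complex_nonpos_Reals_iff field_simps)
    then have "1 \<le> \<bar>Re (g t / g a - 1)\<bar>" by simp
    also have "\<dots> \<le> cmod (g t / g a - 1)" by (rule abs_Re_le_cmod)
    finally show False using assms(3)[OF that] by simp
  qed
  have "darg g a b = Im (Ln (inverse (g a) * g b)) - Im (Ln (inverse (g a) * g a))"
    by (rule darg_Ln) (use assms ga * in auto)
  also have "\<dots> = Im (Ln (inverse (g a) * g b))" using ga by simp
  finally show ?thesis using *[of b] assms(1) Im_Ln_le_pi mpi_less_Im_Ln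
    by (smt (verit) atLeastAtMost_iff nonpos_Reals_zero_I)
qed

text \<open>The interval is cut into pieces of length at most \<delta>, each costing at most
  \<open>pi\<close>. The extra unit in \<open>Suc n\<close> covers the base case, where the interval
  is a point and \<open>darg_near\<close> still charges \<open>pi\<close>.\<close>

lemma darg_steps:
  assumes "a \<le> b" "continuous_on {a..b} g" "\<And>t. t \<in> {a..b} \<Longrightarrow> g t \<noteq> 0" "\<delta> > 0"
    "\<And>t u. t \<in> {a..b} \<Longrightarrow> u \<in> {a..b} \<Longrightarrow> \<bar>t - u\<bar> \<le> \<delta> \<Longrightarrow> cmod (g t / g u - 1) < 1"
    "b - a \<le> real n * \<delta>"
  shows "\<bar>darg g a b\<bar> \<le> real (Suc n) * pi"
  using assms
proof (induction n arbitrary: a)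
  case 0
  then have "b = a" by simp
  then show ?case using 0 by (auto intro!: order_trans[OF darg_near])
next
  case (Suc n)
  define c where "c = min b (a + \<delta>)"
  have c: "a \<le> c" "c \<le> b" "c - a \<le> \<delta>" "b - c \<le> real n * \<delta>"
    using Suc.prems by (auto simp: c_def min_def algebra_simps split: if_splits)
  have "\<bar>darg g c b\<bar> \<le> real (Suc n) * pi"
    using c Suc.prems by (intro Suc.IH) (auto intro: continuous_on_subset)
  moreover have "\<bar>darg g a c\<bar> \<le> pi"
    using c Suc.prems by (intro darg_near) (auto intro: continuous_on_subset)
  moreover have "darg g a b = darg g a c + darg g c b"
    using c Suc.prems by (intro darg_combine) auto
  ultimately show ?case by (simp add: algebra_simps)
qed

text \<open>By connectedness such a function keeps its sign, so after multiplication by the constant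
  sign \<open>s\<close> it has a real logarithm.\<close>

lemma darg_real:
  assumes "a \<le> b" "continuous_on {a..b} g" "\<And>t. t \<in> {a..b} \<Longrightarrow> g t \<noteq> 0" "\<And>t. t \<in> {a..b} \<Longrightarrow> g t \<in> \<real>"
  shows "darg g a b = 0"
proof -
  have c: "connected (Re ` g ` {a..b})"
    by (intro connected_continuous_image assms continuous_intros) auto
  have nz: "Re (g t) \<noteq> 0" if "t \<in> {a..b}" for t
    using assms(3,4)[OF that] by (auto elim!: Reals_cases)
  define s where "s = complex_of_real (if Re (g a) > 0 then 1 else -1)"
  have same: "(Re (g t) > 0) = (Re (g a) > 0)" if "t \<in> {a..b}" for t
  proof -
    have "0 \<notin> Re ` g ` {a..b}" using nz by force
    then show ?thesis using connectedD_interval[OF c, of "Re (g t)" "Re (g a)" 0] connectedD_interval[OF c, of "Re (g a)" "Re (g t)" 0] that assms(1) nz[OF that] nz[of a]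
      by (smt (verit, best) atLeastAtMost_iff imageI)
  qed
  have pos: "s * g t = complex_of_real \<bar>Re (g t)\<bar>" if "t \<in> {a..b}" for t
    using same[OF that] nz[OF that] assms(4)[OF that] by (auto simp: s_def elim!: Reals_cases)
  have "darg g a b = Im (Ln (s * g b)) - Im (Ln (s * g a))"
    using assms pos nz by (intro darg_Ln) (auto simp: s_def)
  also have "\<dots> = 0" using pos nz assms(1) by (simp add: Ln_of_real)
  finally show ?thesis .
qed

text \<open>Unless \<open>r\<close> is real, the segment keeps the nonzero imaginary part
  \<open>- Im r\<close> and never meets the cut of \<open>Ln\<close>.\<close>

lemma darg_linear:
  assumes "a \<le> b" "\<And>t. t \<in> {a..b} \<Longrightarrow> complex_of_real t - r \<noteq> 0"
  shows "\<bar>darg (\<lambda>t. complex_of_real t - r) a b\<bar> \<le> 2 * pi"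
proof (cases "Im r = 0")
  case True
  then have "r \<in> \<real>" by (simp add: complex_is_Real_iff)
  then have "darg (\<lambda>t. complex_of_real t - r) a b = 0"
    using assms by (intro darg_real) (auto intro!: continuous_intros)
  then show ?thesis by simp
next
  case False
  then have "darg (\<lambda>t. complex_of_real t - r) a b = Im (Ln (1 * (of_real b - r))) - Im (Ln (1 * (of_real a - r)))"
    using assms by (intro darg_Ln) (auto intro!: continuous_intros simp: complex_nonpos_Reals_iff)
  then show ?thesis using assms(1) assms(2)[of a] assms(2)[of b] Im_Ln_le_pi[of "of_real b - r"] mpi_less_Im_Ln[of "of_real b - r"]
     Im_Ln_le_pi[of "of_real a - r"] mpi_less_Im_Ln[of "of_real a - r"] by simp
qed

text \<open>Each linear factor over the complex numbers contributes at most \<open>2 * pi\<close>.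
  The bound sees the degree alone, so it is uniform over all matrices of a fixed size.\<close>

lemma darg_poly:
  assumes "a \<le> b" "\<And>t. t \<in> {a..b} \<Longrightarrow> poly p (complex_of_real t) \<noteq> 0"
  shows "\<bar>darg (\<lambda>t. poly p (complex_of_real t)) a b\<bar> \<le> 2 * pi * degree p"
  using assms
proof (induction "degree p" arbitrary: p)
  case 0
  then obtain c where "p = [:c:]" using degree_eq_zeroE by metis
  with 0 have "darg (\<lambda>t. poly p (complex_of_real t)) a b = Im (Ln c) - Im (Ln c)"
    by (intro darg_eq[where \<phi> = "\<lambda>t. Ln c"]) auto
  then show ?case by simp
next
  case (Suc n)
  then have "\<not> constant (poly p)" by (simp add: constant_degree)
  then obtain r where "poly p r = 0" using fundamental_theorem_of_algebra by blast
  then obtain q where q: "p = [:- r, 1:] * q" using poly_eq_0_iff_dvd by (metis dvdE)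
  have nz: "poly q (complex_of_real t) \<noteq> 0" "complex_of_real t - r \<noteq> 0" if "t \<in> {a..b}" for t
    using Suc.prems(2)[OF that] unfolding q by auto
  have "q \<noteq> 0" using nz Suc.prems(1) by force
  then have dq: "n = degree q" using Suc.hyps(2) unfolding q by (subst (asm) degree_mult_eq) auto
  have "(\<lambda>t. poly p (complex_of_real t)) = (\<lambda>t. (complex_of_real t - r) * poly q (complex_of_real t))"
    unfolding q by (auto simp: algebra_simps)
  then have "darg (\<lambda>t. poly p (complex_of_real t)) a b = darg (\<lambda>t. complex_of_real t - r) a b + darg (\<lambda>t. poly q (complex_of_real t)) a b"
    using nz Suc.prems(1) by (auto intro!: darg_mult continuous_intros)
  moreover have "\<bar>darg (\<lambda>t. poly q (complex_of_real t)) a b\<bar> \<le> 2 * pi * degree q"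
    using Suc.hyps(1)[OF dq] nz Suc.prems(1) by auto
  moreover have "\<bar>darg (\<lambda>t. complex_of_real t - r) a b\<bar> \<le> 2 * pi"
    using nz Suc.prems(1) by (intro darg_linear) auto
  ultimately show ?case unfolding Suc.hyps(2)[symmetric] dq[symmetric] by (simp add: algebra_simps)
qed

subsection \<open>Symplectic matrices and the Cayley determinant\<close>

lemma matrix_mult_add_left: "(A + B) ** C = A ** C + B ** (C :: 'a::ring_1^'n^'m)"
  by (vector matrix_matrix_mult_def sum.distrib[symmetric] distrib_right)

lemma matrix_mult_diff_left: "(A - B) ** C = A ** C - B ** (C :: 'a::ring_1^'n^'m)"
  by (vector matrix_matrix_mult_def sum_subtractf[symmetric] left_diff_distrib)

lemma matrix_mult_diff_right: "A ** (B - C) = A ** B - A ** (C :: 'a::ring_1^'n^'m)"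
  by (vector matrix_matrix_mult_def sum_subtractf[symmetric] right_diff_distrib)

lemma matrix_mult_minus_left: "(- A) ** B = - (A ** (B :: 'a::ring_1^'n^'m))"
  by (vector matrix_matrix_mult_def sum_negf[symmetric])

lemma matrix_mult_minus_right: "A ** (- B) = - (A ** (B :: 'a::ring_1^'n^'m))"
  by (vector matrix_matrix_mult_def sum_negf[symmetric])

lemma matrix_mult_scaleR_left: "(c *\<^sub>R A) ** B = c *\<^sub>R (A ** (B :: 'a::real_algebra_1^'n^'m))"
  by (simp add: matrix_matrix_mult_def vec_eq_iff scaleR_sum_right)

lemma matrix_mult_scaleR_right: "A ** (c *\<^sub>R B) = c *\<^sub>R (A ** (B :: 'a::real_algebra_1^'n^'m))"
  by (simp add: matrix_matrix_mult_def vec_eq_iff scaleR_sum_right)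

lemmas matrix_mult_linear = matrix_mult_add_left matrix_add_ldistrib matrix_mult_diff_left matrix_mult_diff_right
  matrix_mult_minus_left matrix_mult_minus_right matrix_mult_scaleR_left matrix_mult_scaleR_right

lemma transpose_add: "transpose (A + B) = transpose A + transpose (B :: 'a::ring_1^'n^'m)"
  by (vector transpose_def)
lemma transpose_diff: "transpose (A - B) = transpose A - transpose (B :: 'a::ring_1^'n^'m)"
  by (vector transpose_def)
lemma transpose_uminus: "transpose (- A) = - transpose (A :: 'a::ring_1^'n^'m)"
  by (vector transpose_def)
lemma transpose_scaleR: "transpose (c *\<^sub>R A) = c *\<^sub>R transpose (A :: 'a::real_algebra_1^'n^'m)"
  by (simp add: transpose_def vec_eq_iff)

lemmas transpose_linear = transpose_add transpose_diff transpose_uminus transpose_scaleR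

lemma J_mult_vec:
  fixes x :: "real^('n::finite + 'n)"
  shows "J *v x = (\<chi> i. case i of Inl k \<Rightarrow> - x $ Inr k | Inr k \<Rightarrow> x $ Inl k)"
proof -
  have "(J *v x) $ i = (case i of Inl k \<Rightarrow> - x $ Inr k | Inr k \<Rightarrow> x $ Inl k)" for i
    by (cases i) (simp_all add: J_def matrix_vector_mult_def UNIV_Plus_UNIV[symmetric] sum.Plus mult_delta_left del: UNIV_Plus_UNIV)
  then show ?thesis by (simp add: vec_eq_iff)
qed

lemma matrix_vector_mult_minus: "(- A) *v x = - (A *v x)" for A :: "'a::ring_1^'n^'m"
  by (vector matrix_vector_mult_def sum_negf)

lemma J_J_vec: "J *v (J *v x) = - x"
  by (auto simp: J_mult_vec vec_eq_iff split: sum.splits)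

lemma J_mult_J [simp]: "J ** J = (- mat 1 :: 'n::finite sqmat)"
proof -
  have "(J ** J) *v x = (- mat 1 :: 'n sqmat) *v x" for x :: "real^('n + 'n)"
    by (simp add: matrix_vector_mul_assoc[symmetric] J_J_vec matrix_vector_mult_minus)
  then show ?thesis by (simp add: matrix_eq)
qed

lemma transpose_J [simp]: "transpose J = - J"
  by (auto simp: transpose_def J_def vec_eq_iff split: sum.splits)

lemma inner_J: "x \<bullet> (J *v y) = - ((J *v x) \<bullet> y)"
proof -
  have "x \<bullet> (J *v y) = (transpose J *v x) \<bullet> y" by (simp only: dot_lmul_matrix transpose_matrix_vector)
  then show ?thesis by (simp add: matrix_vector_mult_minus del: transpose_matrix_vector)
qed

lemma inner_J_J: "(J *v x) \<bullet> (J *v y) = x \<bullet> y"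
  by (simp add: inner_J J_J_vec)

lemma norm_J [simp]: "norm (J *v x) = norm x"
  by (simp add: norm_eq_sqrt_inner inner_J_J)

lemma Sp_iff: "M \<in> Sp \<longleftrightarrow> transpose M ** J ** M = J"
proof -
  have "invertible M" if "transpose M ** J ** M = J"
  proof -
    have "(- J ** transpose M ** J) ** M = - (J ** (transpose M ** J ** M))"
      by (simp add: matrix_mult_linear matrix_mul_assoc)
    also have "\<dots> = mat 1" by (simp add: that)
    finally show ?thesis using invertible_left_inverse by blast
  qed
  then show ?thesis by (auto simp: Sp_def)
qed

lemma Sp_inner: "M \<in> Sp \<Longrightarrow> (M *v x) \<bullet> (J *v (M *v y)) = x \<bullet> (J *v y)"
proof -
  assume "M \<in> Sp"
  then have "transpose M *v (J *v (M *v y)) = J *v y"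
    unfolding Sp_iff by (simp add: matrix_vector_mul_assoc matrix_mul_assoc del: transpose_matrix_vector)
  then show ?thesis by (metis dot_lmul_matrix inner_commute transpose_matrix_vector)
qed

lemma Sp_mat_1 [simp]: "mat 1 \<in> Sp"
  by (simp add: Sp_iff)

lemma Sp_mult: "M \<in> Sp \<Longrightarrow> N \<in> Sp \<Longrightarrow> M ** N \<in> Sp"
  unfolding Sp_iff by (simp add: matrix_transpose_mul matrix_mul_assoc) (metis matrix_mul_assoc)

text \<open>This inverse is polynomial in \<open>M\<close>, so products with it remain manifestly
  continuous; it replaces \<open>matrix_inv\<close> in the formulas for flows.\<close>

lemma Sp_transpose_J: "M \<in> Sp \<Longrightarrow> M ** (- J ** transpose M ** J) = mat 1"
proof -
  assume "M \<in> Sp"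
  have "(- J ** transpose M ** J) ** M = - (J ** (transpose M ** J ** M))"
      by (simp add: matrix_mult_linear matrix_mul_assoc)
  also have "\<dots> = mat 1" using \<open>M \<in> Sp\<close> by (simp add: Sp_iff)
  finally show ?thesis using matrix_left_right_inverse by blast
qed

lemma exp_J_0 [simp]: "exp_J 0 = mat 1"
  by (simp add: exp_J_def)

lemma exp_J_add: "exp_J s ** exp_J t = exp_J (s + t)"
  by (simp add: exp_J_def matrix_mult_linear cos_add sin_add algebra_simps)

lemma transpose_exp_J: "transpose (exp_J t) = exp_J (- t)"
  by (simp add: exp_J_def transpose_linear)

lemma exp_J_J: "exp_J t ** J = J ** exp_J t"
  by (simp add: exp_J_def matrix_mult_linear)

lemma exp_J_in_Sp [simp]: "exp_J t \<in> Sp"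
  unfolding Sp_iff transpose_exp_J
  by (simp add: matrix_mul_assoc[symmetric] exp_J_J[symmetric]) (simp add: matrix_mul_assoc exp_J_add)

lemma continuous_on_exp_J [continuous_intros]:
  "continuous_on S f \<Longrightarrow> continuous_on S (\<lambda>x. exp_J (f x))"
  unfolding exp_J_def
  by (intro continuous_intros continuous_on_compose2[of UNIV cos S f] continuous_on_compose2[of UNIV sin S f]) auto

lemma continuous_on_matrix_mult [continuous_intros]:
  fixes f :: "'a::topological_space \<Rightarrow> ('b::real_normed_algebra_1)^'n^'m" and g :: "'a \<Rightarrow> 'b^'k^'n"
  assumes "continuous_on S f" "continuous_on S g"
  shows "continuous_on S (\<lambda>x. f x ** g x)"
  unfolding matrix_matrix_mult_def by (intro continuous_intros assms)

lemma continuous_on_det [continuous_intros]: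
  fixes f :: "'a::topological_space \<Rightarrow> ('b::real_normed_field)^'n^'n"
  assumes "continuous_on S f"
  shows "continuous_on S (\<lambda>x. det (f x))"
  unfolding det_def by (intro continuous_intros assms)

section \<open>Complexification, determinant pencils and the Cayley determinant\<close>

abbreviation cmat :: "real^'m^'n \<Rightarrow> complex^'m^'n" where
  "cmat \<equiv> map_matrix complex_of_real"

lemma cmat_mult: "cmat (A ** B) = cmat A ** cmat B"
  by (simp add: matrix_matrix_mult_def vec_eq_iff)

lemma cmat_diff: "cmat (A - B) = cmat A - cmat B"
  and cmat_add: "cmat (A + B) = cmat A + cmat B"
  and cmat_scaleR: "cmat (c *\<^sub>R A) = c *\<^sub>R cmat A"
  by (simp_all add: vec_eq_iff complex_eq_iff)

lemma cmat_1 [simp]: "cmat (mat 1) = mat 1"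
  by (simp add: mat_def vec_eq_iff)

lemma det_cmat: "det (cmat A) = of_real (det A)"
  unfolding det_def by simp

definition pencil :: "'a::comm_ring_1^'n^'n \<Rightarrow> 'a^'n^'n \<Rightarrow> 'a \<Rightarrow> 'a^'n^'n" where
  "pencil A B z = (\<chi> i j. A $ i $ j + z * B $ i $ j)"

lemma pencil_mult_vec: "pencil A B z *v x = A *v x + z *s (B *v x)"
  by (simp add: pencil_def matrix_vector_mult_def vec_eq_iff sum.distrib sum_distrib_left algebra_simps)

lemma pencil_0 [simp]: "pencil A B 0 = A"
  by (simp add: pencil_def vec_eq_iff)

text \<open>The Leibniz formula, read over matrices of linear polynomials, is the polynomial; each
  permutation contributes at most one degree per row.\<close>

lemma det_pencil_poly:
  fixes A B :: "'a::{comm_ring_1}^'n^'n"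
  obtains p where "\<And>z. poly p z = det (pencil A B z)" "degree p \<le> CARD('n)"
proof
  let ?p = "det (\<chi> i j. [:A $ i $ j, B $ i $ j:]) :: 'a poly"
  show "poly ?p z = det (pencil A B z)" for z
    unfolding det_def pencil_def by (simp add: poly_sum poly_prod)
  show "degree ?p \<le> CARD('n)"
    unfolding det_def
  proof (rule degree_sum_le)
    fix p :: "'n \<Rightarrow> 'n"
    have "degree (of_int (sign p) * (\<Prod>i\<in>UNIV. (\<chi> i j. [:A $ i $ j, B $ i $ j:]) $ i $ p i)) \<le> degree (of_int (sign p) :: 'a poly) + (\<Sum>i\<in>UNIV. degree ([:A $ i $ p i, B $ i $ p i:]))"
      by (intro order_trans[OF degree_mult_le] add_mono degree_prod_sum_le order_refl) 
        (auto intro!: order_trans[OF degree_prod_sum_le])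
    also have "\<dots> \<le> 0 + (\<Sum>i\<in>(UNIV::'n set). 1)"
      by (intro add_mono sum_mono) (auto simp: degree_pCons_eq_if)
    finally show "degree (of_int (sign p) * (\<Prod>i\<in>UNIV. (\<chi> i j. [:A $ i $ j, B $ i $ j:]) $ i $ p i)) \<le> CARD('n)"
      by simp
  qed simp
qed

text \<open>For real \<open>\<sigma>\<close>, the matrix at parameter \<open>- \<i> \<sigma>\<close> is singular only if \<open>\<sigma> = 0\<close>, and for real \<open>t\<close> the
  matrix at parameter \<open>- t\<close> is, up to an invertible factor, that of the rotated matrix
  \<open>exp_J (- 2 arctan t) ** M\<close> at parameter \<open>0\<close>.\<close>

definition cay :: "complex \<Rightarrow> 'n::finite sqmat \<Rightarrow> complex^('n+'n)^('n+'n)" where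
  "cay z M = pencil (cmat (M - mat 1)) (cmat (J ** (M + mat 1))) z"

definition gdet :: "complex \<Rightarrow> 'n::finite sqmat \<Rightarrow> complex" where
  "gdet z M = det (cay z M)"

lemma continuous_on_gdet [continuous_intros]:
  fixes f :: "'a::topological_space \<Rightarrow> 'n::finite sqmat"
  assumes "continuous_on S f" "continuous_on S g"
  shows "continuous_on S (\<lambda>x. gdet (g x) (f x))"
  unfolding gdet_def cay_def pencil_def nth_map_matrix by (intro continuous_intros assms)

lemma gdet_0: "gdet 0 M = of_real (det (M - mat 1))"
  by (simp add: gdet_def cay_def det_cmat)

lemma det_shift_1: "det_shift 1 M = gdet 0 M"
  by (simp add: det_shift_def gdet_def cay_def cmat_diff)

lemma Sp0_1_iff: "M \<in> Sp0 1 \<longleftrightarrow> M \<in> Sp \<and> det (M - mat 1) = 0"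
  by (simp add: Sp0_def det_shift_1 gdet_0)

definition Rev :: "complex^'n \<Rightarrow> real^'n" where "Rev x = (\<chi> i. Re (x $ i))"
definition Imv :: "complex^'n \<Rightarrow> real^'n" where "Imv x = (\<chi> i. Im (x $ i))"

lemma Rev_cmat [simp]: "Rev (cmat A *v x) = A *v Rev x"
  and Imv_cmat [simp]: "Imv (cmat A *v x) = A *v Imv x"
  by (simp_all add: Rev_def Imv_def matrix_vector_mult_def vec_eq_iff)

lemma Rev_add [simp]: "Rev (x + y) = Rev x + Rev y"
  and Imv_add [simp]: "Imv (x + y) = Imv x + Imv y"
  by (simp_all add: Rev_def Imv_def vec_eq_iff)

lemma Rev_scale: "Rev ((- \<i> * of_real s) *s x) = s *\<^sub>R Imv x"
  and Imv_scale: "Imv ((- \<i> * of_real s) *s x) = - s *\<^sub>R Rev x"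
  by (simp_all add: Rev_def Imv_def vec_eq_iff)

lemma norm_complex_vec: "(norm x)\<^sup>2 = (norm (Rev x))\<^sup>2 + (norm (Imv x))\<^sup>2" for x :: "complex^'n"
  by (simp add: norm_vec_def L2_set_def Rev_def Imv_def sum_nonneg cmod_power2 sum.distrib)

lemma norm_cmat_J: "norm (cmat J *v x) = norm x"
proof -
  have "(norm (cmat J *v x))\<^sup>2 = (norm x)\<^sup>2" by (simp add: norm_complex_vec)
  then show ?thesis by (metis norm_ge_zero power2_eq_imp_eq)
qed

text \<open>Preservation of the Hermitian form \<open>x\<^sup>* \<i>J x\<close> by \<open>M\<close>, polarized in \<open>M x - x\<close> and \<open>M x + x\<close>.\<close>

lemma cay_norm_bound:
  assumes M: "M \<in> Sp" and s: "s > 0"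
  shows "s * norm (cmat (M + mat 1) *v x) \<le> norm (cay (- \<i> * of_real s) M *v x)"
proof -
  define y where "y = cay (- \<i> * of_real s) M *v x"
  define w where "w = cmat (M + mat 1) *v x"
  define p q where "p = Rev x" and "q = Imv x"
  have y: "y = cmat (M - mat 1) *v x + (- \<i> * of_real s) *s (cmat J *v w)"
    unfolding y_def w_def cay_def pencil_mult_vec cmat_mult by (simp add: matrix_vector_mul_assoc)
  have w1: "Rev w = M *v p + p" and w2: "Imv w = M *v q + q"
    by (simp_all add: w_def p_def q_def algebra_simps)
  have y1: "M *v p - p = Rev y - s *\<^sub>R (J *v Imv w)"
    unfolding y Rev_add Rev_scale by (simp add: p_def algebra_simps)
  have y2: "M *v q - q = Imv y + s *\<^sub>R (J *v Rev w)"
    unfolding y Imv_add Imv_scale by (simp add: q_def algebra_simps)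
  have "(M *v p - p) \<bullet> (J *v Imv w) + Rev w \<bullet> (J *v (M *v q - q)) = 2 * ((M *v p) \<bullet> (J *v (M *v q)) - p \<bullet> (J *v q))"
    unfolding w1 w2 by (simp add: algebra_simps inner_simps)
  also have "\<dots> = 0" using Sp_inner[OF M] by simp
  finally have "(Rev y - s *\<^sub>R (J *v Imv w)) \<bullet> (J *v Imv w) + Rev w \<bullet> (J *v (Imv y + s *\<^sub>R (J *v Rev w))) = 0"
    unfolding y1 y2 .
  moreover have "(Rev y - s *\<^sub>R (J *v Imv w)) \<bullet> (J *v Imv w) = Rev y \<bullet> (J *v Imv w) - s * (norm (Imv w))\<^sup>2"
    by (simp add: inner_diff_left inner_J_J dot_square_norm)
  moreover have "Rev w \<bullet> (J *v (Imv y + s *\<^sub>R (J *v Rev w))) = - (Imv y \<bullet> (J *v Rev w)) - s * (norm (Rev w))\<^sup>2"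
    by (simp add: matrix_vector_right_distrib matrix_vector_mult_scaleR J_J_vec inner_diff_right dot_square_norm
        inner_J[of "Rev w"] inner_commute[of "J *v Rev w"])
  ultimately have "s * ((norm (Rev w))\<^sup>2 + (norm (Imv w))\<^sup>2) = Rev y \<bullet> (J *v Imv w) - Imv y \<bullet> (J *v Rev w)"
    by (simp add: distrib_left)
  also have "\<dots> \<le> norm (Rev y) * norm (Imv w) + norm (Imv y) * norm (Rev w)"
    using Cauchy_Schwarz_ineq2[of "Rev y" "J *v Imv w"] Cauchy_Schwarz_ineq2[of "Imv y" "J *v Rev w"] by (simp add: abs_le_iff)
  \<comment> \<open>Lagrange's identity: the difference of the squares is the square of
    \<open>norm (Rev y) * norm (Rev w) - norm (Imv y) * norm (Imv w)\<close>.\<close>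
  also have "\<dots> \<le> norm y * norm w"
  proof (rule power2_le_imp_le)
    have "0 \<le> (norm (Rev y) * norm (Rev w) - norm (Imv y) * norm (Imv w))\<^sup>2" by simp
    then show "(norm (Rev y) * norm (Imv w) + norm (Imv y) * norm (Rev w))\<^sup>2 \<le> (norm y * norm w)\<^sup>2"
      unfolding power_mult_distrib norm_complex_vec by (simp add: power2_eq_square algebra_simps)
  qed simp
  finally have "s * (norm w)\<^sup>2 \<le> norm y * norm w" by (simp add: norm_complex_vec)
  then have "s * norm w \<le> norm y"
    by (cases "norm w = 0") (simp_all add: power2_eq_square)
  then show ?thesis by (simp add: w_def y_def)
qed

text \<open>With \<open>y\<close> the image of \<open>x\<close>, the vector
  \<open>w = M x + x\<close> has norm at most that of \<open>y\<close>, and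
  \<open>u = M x - x\<close> at most twice that. Since \<open>2 x = w - u\<close> and
  \<open>2 M x = w + u\<close>, the constant is \<open>3 / 2\<close>, whatever the size of
  \<open>M\<close>.\<close>

lemma cay_norm_bound_1:
  assumes M: "M \<in> Sp"
  shows "norm x \<le> 3 / 2 * norm (cay (- \<i>) M *v x)" "norm (cmat M *v x) \<le> 3 / 2 * norm (cay (- \<i>) M *v x)"
proof -
  let ?y = "cay (- \<i>) M *v x" and ?w = "cmat (M + mat 1) *v x" and ?u = "cmat (M - mat 1) *v x"
  have w: "norm ?w \<le> norm ?y" using cay_norm_bound[OF M, of 1 x] by simp
  have "?u = ?y + \<i> *s (cmat J *v ?w)"
    by (simp add: cay_def pencil_mult_vec cmat_mult matrix_vector_mul_assoc)
  moreover have "norm (\<i> *s v) = norm v" for v :: "complex^'m"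
    by (simp add: norm_vec_def norm_mult)
  ultimately have u: "norm ?u \<le> norm ?y + norm ?w"
    using norm_triangle_ineq[of ?y "\<i> *s (cmat J *v ?w)"] by (metis norm_cmat_J)
  have x: "2 *\<^sub>R x = ?w - ?u" and Mx: "2 *\<^sub>R (cmat M *v x) = ?w + ?u"
    by (simp_all add: cmat_add cmat_diff algebra_simps scaleR_2)
  have "norm (2 *\<^sub>R x) \<le> 3 * norm ?y" "norm (2 *\<^sub>R (cmat M *v x)) \<le> 3 * norm ?y"
    unfolding x Mx using w u norm_triangle_ineq[of ?w ?u] norm_triangle_ineq4[of ?w ?u] by linarith+
  then show "norm x \<le> 3 / 2 * norm ?y" "norm (cmat M *v x) \<le> 3 / 2 * norm ?y" by simp_all
qed

lemma det_nz_iff_kernel: "det (A :: 'a::field^'n^'n) \<noteq> 0 \<longleftrightarrow> (\<forall>x. A *v x = 0 \<longrightarrow> x = 0)"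
  unfolding invertible_det_nz[symmetric] invertible_left_inverse matrix_left_invertible_ker ..

lemma gdet_nz:
  assumes "M \<in> Sp" "s > 0"
  shows "gdet (- \<i> * of_real s) M \<noteq> 0"
  unfolding gdet_def det_nz_iff_kernel
proof (intro allI impI)
  fix x assume x: "cay (- \<i> * of_real s) M *v x = 0"
  then have w: "cmat (M + mat 1) *v x = 0" using cay_norm_bound[OF assms, of x] assms(2)
    by (simp add: mult_le_0_iff)
  have "cmat (M - mat 1) *v x = 0" using x w
    by (simp add: cay_def pencil_mult_vec cmat_mult matrix_vector_mul_assoc[symmetric])
  with w have "2 *\<^sub>R x = 0" by (simp add: cmat_add cmat_diff algebra_simps scaleR_2)
  then show "x = 0" by simp
qed

lemma gdet_poly:
  fixes M :: "'n::finite sqmat"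
  obtains p where "\<And>z. poly p z = gdet z M" "degree p \<le> CARD('n + 'n)"
  using det_pencil_poly[of "cmat (M - mat 1)" "cmat (J ** (M + mat 1))"] unfolding gdet_def cay_def by blast

lemma gdet_rotated:
  fixes M :: "'n::finite sqmat"
  assumes "cos (\<theta> / 2) \<noteq> 0"
  shows "gdet 0 (exp_J (- \<theta>) ** M) = 0 \<longleftrightarrow> gdet (- of_real (tan (\<theta> / 2))) M = 0"
proof -
  define t where "t = tan (\<theta> / 2)"
  have c: "cos \<theta> + t * sin \<theta> = 1" and s: "sin \<theta> = t * (1 + cos \<theta>)"
  proof -
    define C S where "C = cos (\<theta> / 2)" and "S = sin (\<theta> / 2)"
    have C: "C \<noteq> 0" and tC: "t * C = S" using assms by (simp_all add: C_def S_def t_def tan_def)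
    have cos: "cos \<theta> = 2 * C\<^sup>2 - 1" using cos_double_cos[of "\<theta>/2"] by (simp add: C_def)
    have sin: "sin \<theta> = 2 * S * C" using sin_double[of "\<theta>/2"] by (simp add: C_def S_def)
    have "t * sin \<theta> = 2 * S * (t * C)" unfolding sin by (simp only: ac_simps)
    also have "\<dots> = 2 * S\<^sup>2" unfolding tC by (simp add: power2_eq_square)
    also have "\<dots> = 2 - 2 * C\<^sup>2" using sin_cos_squared_add[of "\<theta>/2"] unfolding C_def S_def by linarith
    finally show "cos \<theta> + t * sin \<theta> = 1" by (simp add: cos)
    show "sin \<theta> = t * (1 + cos \<theta>)" unfolding sin cos tC[symmetric] by (simp add: power2_eq_square)
  qed
  \<comment> \<open>The Cayley form of a rotation: \<open>exp_J (- \<theta>)\<close> is the quotient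
    of \<open>I - t J\<close> by \<open>I + t J\<close> for
    \<open>t = tan (\<theta> / 2)\<close>.\<close>
  have e: "(mat 1 + t *\<^sub>R J) ** exp_J (- \<theta>) = mat 1 - t *\<^sub>R J"
  proof -
    have "(mat 1 + t *\<^sub>R J) ** exp_J (- \<theta>) = (cos \<theta> + t * sin \<theta>) *\<^sub>R mat 1 + (t * cos \<theta> - sin \<theta>) *\<^sub>R J"
      by (simp add: exp_J_def matrix_mult_linear algebra_simps)
    also have "t * cos \<theta> - sin \<theta> = - t" using s by (simp add: algebra_simps)
    finally show ?thesis using c by simp
  qed
  have inv: "det (mat 1 + t *\<^sub>R J :: 'n sqmat) \<noteq> 0"
    unfolding det_nz_iff_kernel
  proof (intro allI impI)
    fix x :: "real^('n+'n)" assume "(mat 1 + t *\<^sub>R J) *v x = 0"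
    then have "x + t *\<^sub>R (J *v x) = 0" by (simp add: algebra_simps scaleR_matrix_vector_assoc[symmetric])
    then have "x \<bullet> (x + t *\<^sub>R (J *v x)) = 0" by simp
    moreover have "x \<bullet> (J *v x) = 0" using inner_J[of x x] by (simp add: inner_commute)
    ultimately show "x = 0" by (simp add: inner_simps)
  qed
  have "pencil (cmat (M - mat 1)) (cmat (J ** (M + mat 1))) (- of_real t) = cmat (M - mat 1 - t *\<^sub>R (J ** (M + mat 1)))"
    by (simp add: pencil_def vec_eq_iff)
  also have "M - mat 1 - t *\<^sub>R (J ** (M + mat 1)) = (mat 1 - t *\<^sub>R J) ** M - (mat 1 + t *\<^sub>R J)"
    by (simp add: matrix_mult_linear algebra_simps)
  also have "\<dots> = (mat 1 + t *\<^sub>R J) ** (exp_J (- \<theta>) ** M - mat 1)"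
    by (simp add: matrix_mult_linear(3,4) matrix_mul_assoc e)
  finally have "gdet (- of_real t) M = of_real (det (mat 1 + t *\<^sub>R J :: 'n sqmat) * det (exp_J (- \<theta>) ** M - mat 1))"
    unfolding gdet_def cay_def by (simp add: det_cmat det_mul)
  then show ?thesis using inv by (simp add: gdet_0 t_def)
qed

text \<open>The polynomial in the parameter is not identically zero because its value at
  \<open>- \<i>\<close> is not.\<close>

lemma finite_gdet_real_zeros:
  assumes M: "M \<in> Sp" shows "finite {t. gdet (complex_of_real t) M = 0}"
proof -
  obtain p where p: "\<And>z. poly p z = gdet z M" using gdet_poly by blast
  have "p \<noteq> 0" using gdet_nz[OF M, of 1] p[of "- \<i>"] by auto
  then have "finite (complex_of_real -` {z. poly p z = 0})"
    by (intro finite_vimageI poly_roots_finite) (auto simp: inj_def)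
  then show ?thesis by (simp add: vimage_def p)
qed

lemma eventually_rotated_not_Sp0:
  assumes M: "M \<in> Sp"
  shows "\<forall>\<^sub>F \<epsilon> in at_right 0. exp_J (- \<epsilon>) ** M \<notin> Sp0 1"
proof -
  \<comment> \<open>Zero is removed since \<open>M\<close> itself may lie on the hypersurface; the
    remaining zeros are finitely many and keep a distance from \<open>0\<close>.\<close>
  let ?Z = "{t. gdet (complex_of_real t) M = 0} - {0}"
  have "open (- ?Z)" by (intro open_Compl finite_imp_closed finite_Diff finite_gdet_real_zeros M)
  then have nhd: "\<forall>\<^sub>F t in nhds 0. t \<in> - ?Z" by (intro eventually_nhds_in_open) auto
  have "((\<lambda>\<epsilon>::real. - tan (\<epsilon> / 2)) \<longlongrightarrow> - tan (0 / 2)) (at 0)"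
    by (intro tendsto_intros) auto
  then have "((\<lambda>\<epsilon>::real. - tan (\<epsilon> / 2)) \<longlongrightarrow> 0) (at_right 0)"
    by (simp add: filterlim_at_split)
  then have ev: "\<forall>\<^sub>F \<epsilon> in at_right 0. - tan (\<epsilon> / 2) \<in> - ?Z"
    using nhd by (rule eventually_compose_filterlim[rotated])
  have ev2: "\<forall>\<^sub>F \<epsilon>::real in at_right 0. 0 < \<epsilon> \<and> \<epsilon> < 1"
    by (auto simp: eventually_at_right_field intro!: exI[of _ 1])
  show ?thesis using ev ev2
  proof eventually_elim
    case (elim \<epsilon>)
    have pos: "cos (\<epsilon> / 2) > 0" "tan (\<epsilon> / 2) > 0"
      using elim(2) pi_gt3 by (auto intro!: cos_gt_zero tan_gt_zero)
    then show ?case using elim(1) gdet_rotated[of \<epsilon> M] by (simp add: Sp0_1_iff gdet_0)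
  qed
qed

subsection \<open>The argument of the Cayley determinant counts crossings\<close>

text \<open>The change of argument along a bracket-shaped path, in half turns: up from
  \<open>z = 0\<close> to \<open>z = 1\<close> at \<open>\<sigma> a\<close>, along \<sigma> at
  \<open>z = 1\<close>, down again at \<open>\<sigma> b\<close>. The determinants at both ends are
  real, so this is an integer when the endpoints avoid \<open>Sp0 1\<close>.\<close>

definition maslov_arg :: "(real \<Rightarrow> 'n::finite sqmat) \<Rightarrow> real \<Rightarrow> real \<Rightarrow> real" where
  "maslov_arg \<sigma> a b =
     (darg (\<lambda>t. gdet (- \<i>) (\<sigma> t)) a b
      - darg (\<lambda>z. gdet (- \<i> * of_real z) (\<sigma> b)) 0 1
      + darg (\<lambda>z. gdet (- \<i> * of_real z) (\<sigma> a)) 0 1) / pi"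

lemma gdet_nz_strip:
  assumes "M \<in> Sp" "z \<ge> 0" "z > 0 \<or> M \<notin> Sp0 1"
  shows "gdet (- \<i> * of_real z) M \<noteq> 0"
  using assms gdet_nz[of M z] by (cases "z = 0") (auto simp: gdet_0 Sp0_1_iff)

text \<open>The endpoints may move as long as they stay off the hypersurface. This covers homotopies
  with fixed ends as well as the change of the rotation angle \<epsilon>.\<close>

lemma maslov_arg_homotopy:
  fixes h :: "real \<times> real \<Rightarrow> 'n::finite sqmat"
  assumes ab: "a \<le> b" and cont: "continuous_on ({0..1} \<times> {a..b}) h" and Sp: "h ` ({0..1} \<times> {a..b}) \<subseteq> Sp"
    and ends: "\<And>u. u \<in> {0..1} \<Longrightarrow> h (u, a) \<notin> Sp0 1" "\<And>u. u \<in> {0..1} \<Longrightarrow> h (u, b) \<notin> Sp0 1"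
  shows "maslov_arg (\<lambda>t. h (0, t)) a b = maslov_arg (\<lambda>t. h (1, t)) a b"
proof -
  have "darg (\<lambda>u. gdet (- \<i>) (h (u, a))) 0 1 + darg (\<lambda>t. gdet (- \<i>) (h (1, t))) a b
      = darg (\<lambda>t. gdet (- \<i>) (h (0, t))) a b + darg (\<lambda>u. gdet (- \<i>) (h (u, b))) 0 1"
  proof (rule darg_rectangle[of 0 1 a b "\<lambda>x. gdet (- \<i>) (h x)"])
    fix u t assume "u \<in> {0..1::real}" "t \<in> {a..b}"
    then have "h (u, t) \<in> Sp" using Sp by auto
    then show "gdet (- \<i>) (h (u, t)) \<noteq> 0" using gdet_nz[of _ 1] by simp
  qed (auto intro!: continuous_intros cont ab)
  moreover have "darg (\<lambda>z. gdet (- \<i> * of_real z) (h (1, e))) 0 1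
     = darg (\<lambda>z. gdet (- \<i> * of_real z) (h (0, e))) 0 1 + darg (\<lambda>u. gdet (- \<i>) (h (u, e))) 0 1"
    if e: "e \<in> {a..b}" "\<And>u. u \<in> {0..1} \<Longrightarrow> h (u, e) \<notin> Sp0 1" for e
  proof -
    have c: "continuous_on ({0..1} \<times> {0..1}) (\<lambda>x::real\<times>real. h (fst x, e))"
      using e(1) by (intro continuous_on_compose2[OF cont] continuous_intros) auto
    have c0: "continuous_on {0..1} (\<lambda>u::real. h (u, e))"
      using e(1) by (intro continuous_on_compose2[OF cont] continuous_intros) auto
    have "darg (\<lambda>u. gdet (- \<i> * of_real 0) (h (u, e))) 0 1 + darg (\<lambda>z. gdet (- \<i> * of_real z) (h (1, e))) 0 1
     = darg (\<lambda>z. gdet (- \<i> * of_real z) (h (0, e))) 0 1 + darg (\<lambda>u. gdet (- \<i> * of_real 1) (h (u, e))) 0 1"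
    proof (rule darg_rectangle[of 0 1 0 1 "\<lambda>x. gdet (- \<i> * of_real (snd x)) (h (fst x, e))", unfolded fst_conv snd_conv])
      fix u z assume u: "u \<in> {0..1::real}" "z \<in> {0..1::real}"
      then have "h (u, e) \<in> Sp" using Sp e(1) by auto
      then show "gdet (- \<i> * of_real z) (h (u, e)) \<noteq> 0" using u e(2) by (intro gdet_nz_strip) auto
    qed (auto intro!: continuous_intros c)
    \<comment> \<open>At \<open>z = 0\<close> the determinant is real and nonvanishing along the
      moving endpoint, so this side of the rectangle contributes nothing.\<close>
    moreover have "darg (\<lambda>u. gdet (- \<i> * of_real 0) (h (u, e))) 0 1 = 0"
      using c0 e(2) Sp gdet_nz_strip[of _ 0] e(1) by (intro darg_real) (auto intro!: continuous_intros simp: gdet_0 Sp0_1_iff image_subset_iff)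
    ultimately show ?thesis by simp
  qed
  ultimately show ?thesis unfolding maslov_arg_def using ends ab by simp
qed

lemma continuous_on_gdet_path:
  "continuous_on S \<sigma> \<Longrightarrow> continuous_on S (\<lambda>t. gdet z (\<sigma> t))"
  "continuous_on T (\<lambda>s. gdet (- \<i> * of_real s) M)"
  by (intro continuous_intros; assumption)+

lemma maslov_arg_combine:
  assumes "a \<le> b" "b \<le> c" "continuous_on {a..c} \<sigma>" "\<sigma> ` {a..c} \<subseteq> Sp"
  shows "maslov_arg \<sigma> a c = maslov_arg \<sigma> a b + maslov_arg \<sigma> b c"
proof -
  have "darg (\<lambda>t. gdet (- \<i>) (\<sigma> t)) a c = darg (\<lambda>t. gdet (- \<i>) (\<sigma> t)) a b + darg (\<lambda>t. gdet (- \<i>) (\<sigma> t)) b c"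
  proof (rule darg_combine)
    fix t assume "t \<in> {a..c}"
    then have "\<sigma> t \<in> Sp" using assms by auto
    then show "gdet (- \<i>) (\<sigma> t) \<noteq> 0" using gdet_nz[of _ 1] by simp
  qed (use assms in \<open>auto intro!: continuous_on_gdet_path\<close>)
  then show ?thesis by (simp add: maslov_arg_def field_simps)
qed

text \<open>The horizontal part of the bracket can be lowered from \<open>z = 1\<close> to any
  height \<eta>, since nothing vanishes in between. This is needed because the linear approximation
  at a crossing controls only small \<open>z\<close>.\<close>

lemma maslov_arg_level:
  assumes ab: "a \<le> b" and cont: "continuous_on {a..b} \<sigma>" and Sp: "\<sigma> ` {a..b} \<subseteq> Sp"
    and ends: "\<sigma> a \<notin> Sp0 1" "\<sigma> b \<notin> Sp0 1" and \<eta>: "0 < \<eta>" "\<eta> \<le> 1"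
  shows "pi * maslov_arg \<sigma> a b = darg (\<lambda>t. gdet (- \<i> * of_real \<eta>) (\<sigma> t)) a b
      - darg (\<lambda>z. gdet (- \<i> * of_real z) (\<sigma> b)) 0 \<eta>
      + darg (\<lambda>z. gdet (- \<i> * of_real z) (\<sigma> a)) 0 \<eta>"
proof -
  have c: "continuous_on ({a..b} \<times> {\<eta>..1}) (\<lambda>x. \<sigma> (fst x))"
    by (intro continuous_on_compose2[OF cont] continuous_intros) auto
  have "darg (\<lambda>t. gdet (- \<i> * of_real \<eta>) (\<sigma> t)) a b + darg (\<lambda>z. gdet (- \<i> * of_real z) (\<sigma> b)) \<eta> 1
      = darg (\<lambda>z. gdet (- \<i> * of_real z) (\<sigma> a)) \<eta> 1 + darg (\<lambda>t. gdet (- \<i> * of_real 1) (\<sigma> t)) a b"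
  proof (rule darg_rectangle[of a b \<eta> 1 "\<lambda>x. gdet (- \<i> * of_real (snd x)) (\<sigma> (fst x))", unfolded fst_conv snd_conv])
    show "gdet (- \<i> * of_real z) (\<sigma> t) \<noteq> 0" if "t \<in> {a..b}" "z \<in> {\<eta>..1}" for t z
      using that Sp \<eta> by (intro gdet_nz_strip) auto
  qed (auto intro!: continuous_intros c ab \<eta>)
  moreover have "darg (\<lambda>z. gdet (- \<i> * of_real z) (\<sigma> e)) 0 1
      = darg (\<lambda>z. gdet (- \<i> * of_real z) (\<sigma> e)) 0 \<eta> + darg (\<lambda>z. gdet (- \<i> * of_real z) (\<sigma> e)) \<eta> 1"
    if "e \<in> {a..b}" "\<sigma> e \<notin> Sp0 1" for e
    using that Sp \<eta> by (intro darg_combine continuous_on_gdet_path gdet_nz_strip) auto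
  ultimately show ?thesis unfolding maslov_arg_def using ab ends by simp
qed

text \<open>Without crossings the horizontal part can be lowered to \<open>z = 0\<close>, where the
  determinant is real.\<close>

lemma maslov_arg_no_crossing:
  assumes ab: "a \<le> b" and cont: "continuous_on {a..b} \<sigma>" and Sp: "\<sigma> ` {a..b} \<subseteq> Sp - Sp0 1"
  shows "maslov_arg \<sigma> a b = 0"
proof -
  have c: "continuous_on ({a..b} \<times> {0..1::real}) (\<lambda>x. \<sigma> (fst x))"
    by (intro continuous_on_compose2[OF cont] continuous_intros) auto
  have "darg (\<lambda>t. gdet (- \<i> * of_real 0) (\<sigma> t)) a b + darg (\<lambda>z. gdet (- \<i> * of_real z) (\<sigma> b)) 0 1
      = darg (\<lambda>z. gdet (- \<i> * of_real z) (\<sigma> a)) 0 1 + darg (\<lambda>t. gdet (- \<i> * of_real 1) (\<sigma> t)) a b"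
  proof (rule darg_rectangle[of a b 0 1 "\<lambda>x. gdet (- \<i> * of_real (snd x)) (\<sigma> (fst x))", unfolded fst_conv snd_conv])
    show "gdet (- \<i> * of_real z) (\<sigma> t) \<noteq> 0" if "t \<in> {a..b}" "z \<in> {0..1}" for t z
    proof -
      have "\<sigma> t \<in> Sp - Sp0 1" using that(1) Sp by blast
      then show ?thesis using that by (intro gdet_nz_strip) auto
    qed
  qed (auto intro!: continuous_intros c ab)
  moreover have "darg (\<lambda>t. gdet (- \<i> * of_real 0) (\<sigma> t)) a b = 0"
  proof (intro darg_real ab continuous_on_gdet_path cont)
    fix t assume "t \<in> {a..b}"
    then have "\<sigma> t \<in> Sp - Sp0 1" using Sp by blast
    then show "gdet (- \<i> * of_real 0) (\<sigma> t) \<noteq> 0" by (intro gdet_nz_strip) auto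
  qed (simp add: gdet_0)
  ultimately show ?thesis unfolding maslov_arg_def by simp
qed

section \<open>First-order behaviour of the determinant at a crossing\<close>

definition ddet :: "'a::comm_ring_1^'n^'n \<Rightarrow> 'a^'n^'n \<Rightarrow> 'a" where
  "ddet N X = (\<Sum>i\<in>UNIV. det (\<chi> k. if k = i then X $ i else N $ k))"

text \<open>This is Jacobi's \<open>trace (adj N ** X)\<close> in Leibniz form; linearity in
  \<open>X\<close> and compatibility with complexification can be read off.\<close>

lemma ddet_expand:
  "ddet N X = (\<Sum>i\<in>UNIV. \<Sum>p | p permutes UNIV. of_int (sign p) * (X $ i $ p i * (\<Prod>j\<in>UNIV - {i}. N $ j $ p j)))"
  unfolding ddet_def det_def
  by (intro sum.cong refl arg_cong2[of _ _ _ _ "(*)"], subst prod.remove[of UNIV]) (auto intro!: prod.cong)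

lemma has_derivative_det:
  fixes f :: "'a::real_normed_vector \<Rightarrow> ('b::real_normed_field)^'n^'n"
  assumes "(f has_derivative f') (at x within S)"
  shows "((\<lambda>x. det (f x)) has_derivative (\<lambda>h. ddet (f x) (f' h))) (at x within S)"
proof -
  have c: "((\<lambda>x. f x $ i $ j) has_derivative (\<lambda>h. f' h $ i $ j)) (at x within S)" for i j
    by (intro bounded_linear.has_derivative[OF bounded_linear_vec_nth] assms)
  have "((\<lambda>x. det (f x)) has_derivative (\<lambda>h. \<Sum>p | p permutes UNIV. of_int (sign p) * (\<Sum>i\<in>UNIV. f' h $ i $ p i * (\<Prod>j\<in>UNIV - {i}. f x $ j $ p j)))) (at x within S)"
    unfolding det_def by (intro has_derivative_sum has_derivative_mult_right has_derivative_prod c)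
  moreover have "(\<Sum>p | p permutes UNIV. of_int (sign p) * (\<Sum>i\<in>UNIV. f' h $ i $ p i * (\<Prod>j\<in>UNIV - {i}. f x $ j $ p j))) = ddet (f x) (f' h)" for h
    unfolding ddet_expand by (subst sum.swap) (simp add: sum_distrib_left)
  ultimately show ?thesis by simp
qed

lemma eventually_det_nonzero:
  fixes f :: "'a::real_normed_vector \<Rightarrow> ('b::real_normed_field)^'n^'n"
  assumes f: "(f has_derivative f') (at x)" and nz: "det (f x) \<noteq> 0"
  shows "\<forall>\<^sub>F y in nhds x. det (f y) \<noteq> 0"
proof -
  have "isCont (\<lambda>y. det (f y)) x" using has_derivative_continuous[OF has_derivative_det[OF f]] .
  then have "\<forall>\<^sub>F y in at x. det (f y) \<noteq> 0" using nz by (auto simp: isCont_def dest: tendsto_imp_eventually_ne)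
  then show ?thesis using nz by (simp add: eventually_nhds_conv_at)
qed

lemma ddet_add: "ddet N (X + Y) = ddet N X + ddet N Y"
  and ddet_diff: "ddet N (X - Y) = ddet N X - ddet N Y"
  and ddet_scale: "ddet N (map_matrix ((*) c) X) = c * ddet N X"
  unfolding ddet_expand by (simp_all add: sum.distrib sum_subtractf sum_distrib_left algebra_simps)

lemma ddet_scaleR: "ddet N (c *\<^sub>R X) = c *\<^sub>R ddet N X" for X :: "('a::{real_algebra_1, comm_ring_1})^'n^'n"
  unfolding ddet_expand by (simp add: scaleR_sum_right)

lemma ddet_cmat: "ddet (cmat N) (cmat X) = of_real (ddet N X)"
  unfolding ddet_expand by simp

lemma ddet_eq_0_of_line:
  fixes N :: "real^'n^'n"
  assumes "\<And>s. det (N + s *\<^sub>R X) = 0" shows "ddet N X = 0"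
proof -
  have "((\<lambda>s::real. N + s *\<^sub>R X) has_derivative (\<lambda>h. h *\<^sub>R X)) (at 0)"
    by (auto intro!: derivative_eq_intros)
  from has_derivative_det[OF this]
  have "((\<lambda>s::real. 0) has_derivative (\<lambda>h. ddet N (h *\<^sub>R X))) (at 0)"
    by (simp add: assms)
  then have "(\<lambda>h. ddet N (h *\<^sub>R X)) = (\<lambda>h. 0)"
    using has_derivative_unique has_derivative_const by blast
  then show ?thesis by (metis scaleR_one)
qed

text \<open>The line \<open>N + s N Z = N (I + s Z)\<close> stays inside the singular
  matrices.\<close>

lemma ddet_mult_right:
  fixes N :: "real^'n^'n"
  assumes "det N = 0" shows "ddet N (N ** Z) = 0"
proof (rule ddet_eq_0_of_line)
  fix s :: real
  have "N + s *\<^sub>R (N ** Z) = N ** (mat 1 + s *\<^sub>R Z)" by (simp add: matrix_mult_linear)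
  then show "det (N + s *\<^sub>R (N ** Z)) = 0" by (simp add: det_mul assms)
qed

lemma ddet_mult_left:
  fixes N :: "real^'n^'n"
  assumes "det N = 0" shows "ddet N (Z ** N) = 0"
proof (rule ddet_eq_0_of_line)
  fix s :: real
  have "N + s *\<^sub>R (Z ** N) = (mat 1 + s *\<^sub>R Z) ** N" by (simp add: matrix_mult_linear)
  then show "det (N + s *\<^sub>R (Z ** N)) = 0" by (simp add: det_mul assms)
qed

lemma det_shift_1_has_derivative:
  "(det_shift 1 has_derivative (\<lambda>X. of_real (ddet (M - mat 1) X))) (at M)"
proof -
  have "((\<lambda>M. M - mat 1) has_derivative (\<lambda>X. X)) (at M)" by (auto intro!: derivative_eq_intros)
  from has_derivative_of_real[OF has_derivative_det[OF this]]
  have "((\<lambda>M. complex_of_real (det (M - mat 1))) has_derivative (\<lambda>X. of_real (ddet (M - mat 1) X))) (at M)" .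
  also have "(\<lambda>M. complex_of_real (det (M - mat 1))) = det_shift 1"
    by (rule ext) (simp add: det_shift_1 gdet_0)
  finally show ?thesis .
qed

text \<open>The co-orienting vector \<open>\<tau> t ** J\<close> differs from \<open>J\<close> by
  \<open>N ** J\<close> with \<open>N = \<tau> t - I\<close>, and \<open>ddet N\<close> kills that
  because \<open>N\<close> is singular. The condition thus involves only real derivatives of
  \<open>det (M - I)\<close>.\<close>

lemma crossing_speed_1_iff:
  assumes "\<tau> t \<in> Sp0 1"
  shows "crossing_speed 1 \<tau> t c \<longleftrightarrow>
    (\<exists>V. (\<tau> has_vector_derivative V) (at t) \<and> ddet (\<tau> t - mat 1) J \<noteq> 0
       \<and> ddet (\<tau> t - mat 1) V = c * ddet (\<tau> t - mat 1) J)"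
proof -
  let ?N = "\<tau> t - mat 1"
  have d0: "det ?N = 0" using assms by (simp add: Sp0_1_iff)
  have J: "ddet ?N (\<tau> t ** J) = ddet ?N J"
  proof -
    have "\<tau> t ** J = ?N ** J + J" by (simp add: matrix_mult_linear)
    then show ?thesis by (simp add: ddet_add ddet_mult_right[OF d0])
  qed
  have u: "(det_shift 1 has_derivative f') (at (\<tau> t)) \<longleftrightarrow> f' = (\<lambda>X. of_real (ddet ?N X))" for f'
    using det_shift_1_has_derivative has_derivative_unique by blast
  show ?thesis unfolding crossing_speed_def u
    by (auto simp: J scaleR_conv_of_real simp flip: of_real_mult)
qed

lemma crossing_speed_unique:
  assumes "\<tau> t \<in> Sp0 1" "crossing_speed 1 \<tau> t c" "crossing_speed 1 \<tau> t c'"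
  shows "c = c'"
  using assms vector_derivative_unique_at unfolding crossing_speed_1_iff[where \<tau> = \<tau> and t = t, OF assms(1)] by force

lemma bounded_linear_matrix_map:
  fixes f :: "real^'n^'m \<Rightarrow> 'a::euclidean_space"
  assumes "\<And>X Y. f (X + Y) = f X + f Y" "\<And>c X. f (c *\<^sub>R X) = c *\<^sub>R f X"
  shows "bounded_linear f"
  using assms by (auto intro!: linear_conv_bounded_linear[THEN iffD1] linearI)

text \<open>To first order in height and time the determinant is \<alpha> times
  \<open>c (t - x) - 2 \<i> z\<close>. The factor 2 comes from \<open>J (M + I) = J N + 2 J\<close>,
  whose first term is tangent to the singular matrices.\<close>

lemma gdet_expansion_at_crossing:
  fixes \<tau> :: "real \<Rightarrow> 'n::finite sqmat"
  assumes x: "\<tau> x \<in> Sp0 1" and V: "(\<tau> has_vector_derivative V) (at x)"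
    and c: "ddet (\<tau> x - mat 1) V = c * \<alpha>" and \<alpha>: "\<alpha> = ddet (\<tau> x - mat 1) J"
  shows "((\<lambda>p. gdet (- \<i> * of_real (fst p)) (\<tau> (snd p))) has_derivative
     (\<lambda>h. of_real \<alpha> * (of_real (c * snd h) - 2 * \<i> * of_real (fst h)))) (at (0, x))"
proof -
  let ?N = "\<tau> x - mat 1"
  have d0: "det ?N = 0" using x by (simp add: Sp0_1_iff)
  define L where "L X = map_matrix ((*) (- \<i>)) (cmat (J ** X))" for X :: "'n sqmat"
  have blL: "bounded_linear L"
    by (rule bounded_linear_matrix_map) (simp_all add: L_def vec_eq_iff cmat_add matrix_mult_linear algebra_simps complex_eq_iff)
  have blc: "bounded_linear (cmat :: 'n sqmat \<Rightarrow> _)"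
    by (rule bounded_linear_matrix_map) (simp_all add: cmat_add cmat_scaleR)
  have t: "((\<lambda>p. \<tau> (snd p)) has_derivative (\<lambda>h. snd h *\<^sub>R V)) (at (0::real, x))"
    using has_derivative_compose[OF bounded_linear_imp_has_derivative[OF bounded_linear_snd], of \<tau> "\<lambda>h. h *\<^sub>R V" "(0::real, x)" UNIV] V
    by (simp add: has_vector_derivative_def)
  have 1: "((\<lambda>p. cmat (\<tau> (snd p) - mat 1)) has_derivative (\<lambda>h. cmat (snd h *\<^sub>R V))) (at (0::real, x))"
    using has_derivative_diff[OF t has_derivative_const[of "mat 1"]]
    by (intro bounded_linear.has_derivative[OF blc]) simp
  have 2: "((\<lambda>p. L (\<tau> (snd p) + mat 1)) has_derivative (\<lambda>h. L (snd h *\<^sub>R V))) (at (0::real, x))"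
    using has_derivative_add[OF t has_derivative_const[of "mat 1"]]
    by (intro bounded_linear.has_derivative[OF blL]) simp
  have 3: "((\<lambda>p. cmat (\<tau> (snd p) - mat 1) + fst p *\<^sub>R L (\<tau> (snd p) + mat 1)) has_derivative
      (\<lambda>h. cmat (snd h *\<^sub>R V) + fst h *\<^sub>R L (\<tau> x + mat 1))) (at (0, x))"
    by (rule derivative_eq_intros 1 2 refl)+ simp
  have eq: "cay (- \<i> * of_real (fst p)) (\<tau> (snd p)) = cmat (\<tau> (snd p) - mat 1) + fst p *\<^sub>R L (\<tau> (snd p) + mat 1)" for p
    by (simp add: cay_def pencil_def L_def vec_eq_iff complex_eq_iff)
  have J: "ddet ?N (J ** (\<tau> x + mat 1)) = 2 * \<alpha>"
  proof -
    have "J ** (\<tau> x + mat 1) = J ** ?N + J + J" by (simp add: matrix_mult_linear)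
    then show ?thesis by (simp only: ddet_add ddet_mult_left[OF d0] \<alpha>)
  qed
  have "((\<lambda>p. gdet (- \<i> * of_real (fst p)) (\<tau> (snd p))) has_derivative
     (\<lambda>h. ddet (cmat ?N) (cmat (snd h *\<^sub>R V) + fst h *\<^sub>R L (\<tau> x + mat 1)))) (at (0, x))"
    using has_derivative_det[OF 3] unfolding gdet_def eq by simp
  moreover have "ddet (cmat ?N) (cmat (snd h *\<^sub>R V) + fst h *\<^sub>R L (\<tau> x + mat 1))
      = of_real \<alpha> * (of_real (c * snd h) - 2 * \<i> * of_real (fst h))" for h :: "real \<times> real"
    by (simp add: ddet_add ddet_scaleR L_def ddet_scale ddet_cmat J c cmat_scaleR complex_eq_iff)
  ultimately show ?thesis by simp
qed

lemma Im_Ln_imaginary: "r \<noteq> 0 \<Longrightarrow> Im (Ln (\<i> * of_real r)) = pi / 2 * sgn r"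
  by (cases "r > 0") (simp_all add: Ln_times_ii Ln_of_real Ln_of_real' Im_Ln_of_real)

text \<open>Multiplied by \<open>\<i> / \<alpha>\<close>, the determinant behaves like
  \<open>2 z + \<i> c (t - x)\<close>. For small \<open>z \<ge> 0\<close> it avoids the cut of
  \<open>Ln\<close> on the whole box except at its zero, and at \<open>z = 0\<close> its argument
  passes from \<open>- sgn c * pi / 2\<close> to \<open>sgn c * pi / 2\<close>.\<close>

lemma maslov_arg_local_crossing:
  fixes \<tau> :: "real \<Rightarrow> 'n::finite sqmat"
  assumes x: "\<tau> x \<in> Sp0 1" and c: "crossing_speed 1 \<tau> x c" "c \<noteq> 0"
  obtains \<delta> where "\<delta> > 0" 
    "\<And>t. \<bar>t - x\<bar> < \<delta> \<Longrightarrow> t \<noteq> x \<Longrightarrow> \<tau> t \<notin> Sp0 1"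
    "\<And>a b. x - \<delta> < a \<Longrightarrow> a < x \<Longrightarrow> x < b \<Longrightarrow> b < x + \<delta> \<Longrightarrow> continuous_on {a..b} \<tau> \<Longrightarrow> \<tau> ` {a..b} \<subseteq> Sp
       \<Longrightarrow> maslov_arg \<tau> a b = sgn c"
proof -
  define \<alpha> where "\<alpha> = ddet (\<tau> x - mat 1) J"
  obtain V where V: "(\<tau> has_vector_derivative V) (at x)" and \<alpha>0: "\<alpha> \<noteq> 0" and cV: "ddet (\<tau> x - mat 1) V = c * \<alpha>"
    using c(1) unfolding crossing_speed_1_iff[where \<tau> = \<tau> and t = x, OF x] \<alpha>_def by blast
  define F where "F p = gdet (- \<i> * of_real (fst p)) (\<tau> (snd p)) / of_real \<alpha>" for p :: "real \<times> real"
  have F0: "F (0, x) = 0" using x by (simp add: F_def gdet_0 Sp0_1_iff)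
  have "(F has_derivative (\<lambda>h. of_real \<alpha> * (of_real (c * snd h) - 2 * \<i> * of_real (fst h)) / of_real \<alpha>)) (at (0, x))"
    unfolding F_def divide_inverse by (intro has_derivative_mult_left gdet_expansion_at_crossing[OF x V cV \<alpha>_def])
  then have DF: "(F has_derivative (\<lambda>h. of_real (c * snd h) - 2 * \<i> * of_real (fst h))) (at (0, x))"
    using \<alpha>0 by simp
  \<comment> \<open>The errors in real and imaginary part add up, so \<open>2 * e\<close> has to
    stay below both coefficients \<open>\<bar>c\<bar>\<close> and \<open>2\<close> of the linear
    part.\<close>
  define e where "e = min \<bar>c\<bar> 1 / 4"
  have e: "e > 0" "2 * e < \<bar>c\<bar>" "2 * e < 2" using c(2) by (auto simp: e_def min_def)
  obtain d where d: "d > 0" "\<And>p. norm (p - (0, x)) < d \<Longrightarrow>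
      norm (F p - F (0, x) - (of_real (c * snd (p - (0, x))) - 2 * \<i> * of_real (fst (p - (0, x))))) \<le> e * norm (p - (0, x))"
    using DF e(1) unfolding has_derivative_at_alt by blast
  \<comment> \<open>Heights go up to \<open>\<delta> / 2\<close>, so
    \<open>\<bar>z\<bar> + \<bar>t - x\<bar>\<close> stays below
    \<open>3 * \<delta> / 2 < d\<close>; the cap by \<open>1\<close> keeps the height within the
    strip of \<open>maslov_arg\<close>.\<close>
  define \<delta> where "\<delta> = min (d / 2) 1"
  have \<delta>: "\<delta> > 0" "\<delta> \<le> 1" "\<delta> \<le> d / 2" using d(1) by (auto simp: \<delta>_def)
  have est: "cmod (F (z, t) - (of_real (c * (t - x)) - 2 * \<i> * of_real z)) \<le> e * (\<bar>z\<bar> + \<bar>t - x\<bar>)"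
    if "\<bar>z\<bar> \<le> \<delta> / 2" "\<bar>t - x\<bar> < \<delta>" for z t
  proof -
    have n: "norm ((z, t) - (0, x)) \<le> \<bar>z\<bar> + \<bar>t - x\<bar>" using norm_Pair_le[of z "t - x"] by simp
    also have "\<dots> < d" using that \<delta> by linarith
    finally have "norm (F (z, t) - F (0, x) - (of_real (c * snd ((z, t) - (0, x))) - 2 * \<i> * of_real (fst ((z, t) - (0, x))))) \<le> e * norm ((z, t) - (0, x))"
      by (rule d(2))
    also have "\<dots> \<le> e * (\<bar>z\<bar> + \<bar>t - x\<bar>)" using n e(1) by (intro mult_left_mono) auto
    finally show ?thesis by (simp add: F0)
  qed
  \<comment> \<open>On the cut the real part of \<open>F\<close> is zero and its imaginary part
    nonnegative, so the error would have to outweigh both parts of the linear approximation.\<close>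
  have key: "\<i> * F (z, t) \<notin> \<real>\<^sub>\<le>\<^sub>0" if "0 \<le> z" "z \<le> \<delta> / 2" "\<bar>t - x\<bar> < \<delta>" "z > 0 \<or> t \<noteq> x" for z t
  proof
    assume "\<i> * F (z, t) \<in> \<real>\<^sub>\<le>\<^sub>0"
    then have F: "Re (F (z, t)) = 0" "Im (F (z, t)) \<ge> 0" by (simp_all add: complex_nonpos_Reals_iff)
    let ?E = "F (z, t) - (of_real (c * (t - x)) - 2 * \<i> * of_real z)"
    have "\<bar>c * (t - x)\<bar> \<le> e * (z + \<bar>t - x\<bar>)"
      using abs_Re_le_cmod[of ?E] est[of z t] that F by simp
    moreover have "2 * z \<le> e * (z + \<bar>t - x\<bar>)"
      using abs_Im_le_cmod[of ?E] est[of z t] that F by simp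
    ultimately have "\<bar>c\<bar> * \<bar>t - x\<bar> + 2 * z \<le> 2 * (e * (z + \<bar>t - x\<bar>))" unfolding abs_mult by linarith
    also have "\<dots> = (2 * e) * \<bar>t - x\<bar> + (2 * e) * z" by (simp add: distrib_left)
    finally have "\<bar>c\<bar> * \<bar>t - x\<bar> + 2 * z \<le> (2 * e) * \<bar>t - x\<bar> + (2 * e) * z" .
    moreover have "(2 * e) * \<bar>t - x\<bar> + (2 * e) * z < \<bar>c\<bar> * \<bar>t - x\<bar> + 2 * z"
    proof (cases "z > 0")
      case True
      then show ?thesis using e by (intro add_le_less_mono mult_right_mono mult_strict_right_mono) auto
    next
      case False
      then show ?thesis using that e by (intro add_less_le_mono mult_right_mono mult_strict_right_mono) auto
    qed
    ultimately show False by simp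
  qed
  have not0: "\<tau> t \<notin> Sp0 1" if "\<bar>t - x\<bar> < \<delta>" "t \<noteq> x" for t
  proof
    assume "\<tau> t \<in> Sp0 1"
    then have "F (0, t) = 0" by (simp add: F_def gdet_0 Sp0_1_iff)
    then show False using key[of 0 t] that \<delta> by simp
  qed
  have real: "\<exists>r. F (0, t) = of_real r \<and> r \<noteq> 0 \<and> sgn r = sgn (c * (t - x))" if "\<bar>t - x\<bar> < \<delta>" "t \<noteq> x" for t
  proof (intro exI conjI)
    define r where "r = det (\<tau> t - mat 1) / \<alpha>"
    show Fr: "F (0, t) = of_real (det (\<tau> t - mat 1) / \<alpha>)" by (simp add: F_def gdet_0)
    have "cmod (of_real (r - c * (t - x))) \<le> e * \<bar>t - x\<bar>"
      using est[of 0 t] that \<delta> unfolding Fr r_def[symmetric] by simp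
    then have "\<bar>r - c * (t - x)\<bar> \<le> e * \<bar>t - x\<bar>" by (simp only: norm_of_real)
    also have "\<dots> < \<bar>c\<bar> * \<bar>t - x\<bar>" using that e by (intro mult_strict_right_mono) auto
    also have "\<dots> = \<bar>c * (t - x)\<bar>" by (simp add: abs_mult)
    finally have "\<bar>r - c * (t - x)\<bar> < \<bar>c * (t - x)\<bar>" .
    then show "det (\<tau> t - mat 1) / \<alpha> \<noteq> 0" "sgn (det (\<tau> t - mat 1) / \<alpha>) = sgn (c * (t - x))"
      unfolding r_def[symmetric] by (auto simp: sgn_if abs_if split: if_splits)
  qed
  show thesis
  proof (rule that[OF \<delta>(1) not0])
    fix a b assume ab: "x - \<delta> < a" "a < x" "x < b" "b < x + \<delta>" and cont: "continuous_on {a..b} \<tau>" and Sp: "\<tau> ` {a..b} \<subseteq> Sp"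
    define \<eta> where "\<eta> = \<delta> / 2"
    have \<eta>: "0 < \<eta>" "\<eta> \<le> 1" using \<delta> by (auto simp: \<eta>_def)
    define G where "G p = gdet (- \<i> * of_real (fst p)) (\<tau> (snd p))" for p :: "real \<times> real"
    have GF: "\<i> / of_real \<alpha> * G p = \<i> * F p" for p by (simp add: F_def G_def)
    have a0: "\<tau> a \<notin> Sp0 1" "\<tau> b \<notin> Sp0 1" using not0[of a] not0[of b] ab by auto
    have ca: "continuous_on {a..b} (\<lambda>t. G (\<eta>, t))" "continuous_on T (\<lambda>z. G (z, t))" for t T
      unfolding G_def fst_conv snd_conv by (intro continuous_on_gdet_path cont)+
    have A: "darg (\<lambda>t. G (\<eta>, t)) a b = Im (Ln (\<i> * F (\<eta>, b))) - Im (Ln (\<i> * F (\<eta>, a)))"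
    proof (rule darg_Ln[of a b "\<lambda>t. G (\<eta>, t)" "\<i> / of_real \<alpha>", unfolded GF])
      fix t assume "t \<in> {a..b}"
      then show "\<i> * F (\<eta>, t) \<notin> \<real>\<^sub>\<le>\<^sub>0" using ab \<eta> by (intro key) (auto simp: \<eta>_def)
    qed (use ab \<alpha>0 ca in auto)
    have B: "darg (\<lambda>z. G (z, t)) 0 \<eta> = Im (Ln (\<i> * F (\<eta>, t))) - Im (Ln (\<i> * F (0, t)))" if "\<bar>t - x\<bar> < \<delta>" "t \<noteq> x" for t
    proof (rule darg_Ln[of 0 \<eta> "\<lambda>z. G (z, t)" "\<i> / of_real \<alpha>", unfolded GF])
      fix z assume "z \<in> {0..\<eta>}"
      then show "\<i> * F (z, t) \<notin> \<real>\<^sub>\<le>\<^sub>0" using that by (intro key) (auto simp: \<eta>_def)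
    qed (use \<eta> \<alpha>0 ca in auto)
    have "pi * maslov_arg \<tau> a b = darg (\<lambda>t. G (\<eta>, t)) a b - darg (\<lambda>z. G (z, b)) 0 \<eta> + darg (\<lambda>z. G (z, a)) 0 \<eta>"
      unfolding G_def fst_conv snd_conv using ab by (intro maslov_arg_level cont Sp a0 \<eta>) auto
    \<comment> \<open>The logarithms at the two upper corners \<open>(\<eta>, a)\<close> and
      \<open>(\<eta>, b)\<close> cancel.\<close>
    also have "\<dots> = Im (Ln (\<i> * F (0, b))) - Im (Ln (\<i> * F (0, a)))"
      using ab by (subst A, subst B, simp, simp, subst B) auto
    also have "\<dots> = pi / 2 * sgn (c * (b - x)) - pi / 2 * sgn (c * (a - x))"
    proof -
      obtain r where "F (0, a) = of_real r" "r \<noteq> 0" "sgn r = sgn (c * (a - x))" using real[of a] ab by auto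
      moreover obtain q where "F (0, b) = of_real q" "q \<noteq> 0" "sgn q = sgn (c * (b - x))" using real[of b] ab by auto
      ultimately show ?thesis by (simp add: Im_Ln_imaginary)
    qed
    also have "\<dots> = pi * sgn c" using ab by (simp add: sgn_mult)
    finally show "maslov_arg \<tau> a b = sgn c" by simp
  qed
qed

section \<open>Signed crossing counts as changes of argument\<close>

lemma transversal_path_subinterval:
  assumes "transversal_path \<omega> \<tau> a b" "a \<le> c" "d \<le> b" "\<tau> c \<notin> Sp0 \<omega>" "\<tau> d \<notin> Sp0 \<omega>"
  shows "transversal_path \<omega> \<tau> c d"
  unfolding transversal_path_def
proof (intro conjI)
  have sub: "{c..d} \<subseteq> {a..b}" using assms by auto
  have "{t \<in> {c..d}. \<tau> t \<in> Sp0 \<omega>} \<subseteq> {t \<in> {a..b}. \<tau> t \<in> Sp0 \<omega>}" using sub by auto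
  then show "finite {t \<in> {c..d}. \<tau> t \<in> Sp0 \<omega>}"
    using assms(1) unfolding transversal_path_def by (metis (no_types, lifting) finite_subset)
  show "continuous_on {c..d} \<tau>" using assms(1) sub unfolding transversal_path_def by (auto intro: continuous_on_subset)
qed (use assms in \<open>auto simp: transversal_path_def\<close>)

text \<open>A crossing at \<open>b\<close> would be counted on both sides.\<close>

lemma crossing_count_combine:
  assumes "a \<le> b" "b \<le> c" "finite {t \<in> {a..c}. \<tau> t \<in> Sp0 \<omega>}" "\<tau> b \<notin> Sp0 \<omega>"
  shows "crossing_count \<omega> \<tau> a c = crossing_count \<omega> \<tau> a b + crossing_count \<omega> \<tau> b c"
proof -
  have "card {t \<in> {a..c}. \<tau> t \<in> Sp0 \<omega> \<and> P t} = card {t \<in> {a..b}. \<tau> t \<in> Sp0 \<omega> \<and> P t} + card {t \<in> {b..c}. \<tau> t \<in> Sp0 \<omega> \<and> P t}" for P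
  proof -
    have fin: "finite {t \<in> {d..e}. \<tau> t \<in> Sp0 \<omega> \<and> P t}" if "a \<le> d" "e \<le> c" for d e
      by (rule finite_subset[OF _ assms(3)]) (use that in auto)
    have "{t \<in> {a..c}. \<tau> t \<in> Sp0 \<omega> \<and> P t} = {t \<in> {a..b}. \<tau> t \<in> Sp0 \<omega> \<and> P t} \<union> {t \<in> {b..c}. \<tau> t \<in> Sp0 \<omega> \<and> P t}"
      using assms by auto
    moreover have "{t \<in> {a..b}. \<tau> t \<in> Sp0 \<omega> \<and> P t} \<inter> {t \<in> {b..c}. \<tau> t \<in> Sp0 \<omega> \<and> P t} = {}"
      using assms(4) by (auto dest: antisym)
    ultimately show ?thesis using fin assms by (simp add: card_Un_disjoint)
  qed
  then show ?thesis unfolding crossing_count_def by simp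
qed

lemma crossing_count_single:
  assumes "a < x" "x < b" "\<tau> x \<in> Sp0 1" "crossing_speed 1 \<tau> x c" "\<And>t. t \<in> {a..b} \<Longrightarrow> \<tau> t \<in> Sp0 1 \<Longrightarrow> t = x"
  shows "real_of_int (crossing_count 1 \<tau> a b) = sgn c"
proof -
  have u: "crossing_speed 1 \<tau> x c' \<longleftrightarrow> c' = c" for c'
    using crossing_speed_unique assms(3,4) by blast
  have "{t \<in> {a..b}. \<tau> t \<in> Sp0 1 \<and> (\<exists>c. P c \<and> crossing_speed 1 \<tau> t c)} = (if P c then {x} else {})" for P
    using assms u by (auto split: if_splits)
  then show ?thesis unfolding crossing_count_def by (auto simp: sgn_if)
qed

text \<open>Both sides are additive under cutting at times off the hypersurface. A short interval
  around one crossing is settled locally, and the two remaining pieces have fewer crossings.\<close>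

lemma maslov_arg_eq_crossing_count:
  fixes \<tau> :: "real \<Rightarrow> 'n::finite sqmat"
  assumes "a \<le> b" "transversal_path 1 \<tau> a b"
  shows "maslov_arg \<tau> a b = crossing_count 1 \<tau> a b"
  using assms
proof (induction "card {t \<in> {a..b}. \<tau> t \<in> Sp0 1}" arbitrary: a b rule: less_induct)
  case less
  let ?F = "\<lambda>a b. {t \<in> {a..b}. \<tau> t \<in> Sp0 1}"
  note tp = less.prems(2)[unfolded transversal_path_def]
  have fin: "finite (?F a b)" using tp by blast
  show ?case
  proof (cases "?F a b = {}")
    case True
    then have "maslov_arg \<tau> a b = 0" using tp less.prems(1) by (intro maslov_arg_no_crossing) auto
    moreover have "crossing_count 1 \<tau> a b = 0"
    proof -
      have e: "{t \<in> {a..b}. \<tau> t \<in> Sp0 1 \<and> P t} = {}" for P using True by auto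
      show ?thesis unfolding crossing_count_def e by simp
    qed
    ultimately show ?thesis by simp
  next
    case False
    then obtain x where x: "x \<in> {a..b}" "\<tau> x \<in> Sp0 1" by auto
    then obtain c where c: "c \<noteq> 0" "crossing_speed 1 \<tau> x c" using tp by blast
    have axb: "a < x" "x < b" using x tp by (auto simp: order.strict_iff_order)
    obtain \<delta> where \<delta>: "\<delta> > 0" "\<And>t. \<bar>t - x\<bar> < \<delta> \<Longrightarrow> t \<noteq> x \<Longrightarrow> \<tau> t \<notin> Sp0 1"
      "\<And>a b. x - \<delta> < a \<Longrightarrow> a < x \<Longrightarrow> x < b \<Longrightarrow> b < x + \<delta> \<Longrightarrow> continuous_on {a..b} \<tau> \<Longrightarrow> \<tau> ` {a..b} \<subseteq> Sp
       \<Longrightarrow> maslov_arg \<tau> a b = sgn c"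
      using maslov_arg_local_crossing[OF x(2) c(2,1)] by metis
    \<comment> \<open>Half of \<delta> leaves the strict inequalities that the local lemma asks for;
      clipping keeps the interval inside \<open>{a..b}\<close>.\<close>
    define d where "d = max a (x - \<delta> / 2)"
    define e where "e = min b (x + \<delta> / 2)"
    have de: "a \<le> d" "d < x" "x < e" "e \<le> b" "x - \<delta> < d" "e < x + \<delta>"
      using axb \<delta>(1) by (auto simp: d_def e_def)
    have d0: "\<tau> d \<notin> Sp0 1" "\<tau> e \<notin> Sp0 1" using \<delta>(2)[of d] \<delta>(2)[of e] de by auto
    have cont: "continuous_on {a..b} \<tau>" "\<tau> ` {a..b} \<subseteq> Sp" using tp by auto
    have "?F a d \<subseteq> ?F a b" "?F e b \<subseteq> ?F a b" "x \<notin> ?F a d" "x \<notin> ?F e b" "x \<in> ?F a b" using de x by auto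
    then have "?F a d \<subset> ?F a b" "?F e b \<subset> ?F a b" by blast+
    then have lt: "card (?F a d) < card (?F a b)" "card (?F e b) < card (?F a b)" using fin psubset_card_mono by blast+
    have ad: "maslov_arg \<tau> a d = crossing_count 1 \<tau> a d"
      using de d0 tp by (intro less.hyps[OF lt(1)] transversal_path_subinterval[OF less.prems(2)]) auto
    have eb: "maslov_arg \<tau> e b = crossing_count 1 \<tau> e b"
      using de d0 tp by (intro less.hyps[OF lt(2)] transversal_path_subinterval[OF less.prems(2)]) auto
    have "maslov_arg \<tau> d e = sgn c"
      using de cont by (intro \<delta>(3)) (auto intro: continuous_on_subset)
    also have "\<dots> = crossing_count 1 \<tau> d e"
    proof (rule crossing_count_single[symmetric, OF de(2,3) x(2) c(2)])
      fix t assume t: "t \<in> {d..e}" "\<tau> t \<in> Sp0 1"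
      then have "\<bar>t - x\<bar> < \<delta>" using de by auto
      then show "t = x" using \<delta>(2) t(2) by blast
    qed
    finally have de': "maslov_arg \<tau> d e = crossing_count 1 \<tau> d e" .
    have fin': "finite (?F d b)" by (rule finite_subset[OF _ fin]) (use de in auto)
    have "maslov_arg \<tau> a b = maslov_arg \<tau> a d + (maslov_arg \<tau> d e + maslov_arg \<tau> e b)"
      using de cont 
      by (subst maslov_arg_combine[of a d b], simp, simp, simp, simp, subst maslov_arg_combine[of d e b]) (auto intro: continuous_on_subset)
    moreover have "crossing_count 1 \<tau> a b = crossing_count 1 \<tau> a d + (crossing_count 1 \<tau> d e + crossing_count 1 \<tau> e b)"
      using de fin fin' d0 
      by (subst crossing_count_combine[of a d b], simp, simp, simp, simp, subst crossing_count_combine[of d e b]) auto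
    ultimately show ?thesis using ad eb de' by simp
  qed
qed

subsection \<open>Linear algebra of determinants\<close>

lemma matrix_inv_right:
  fixes A :: "'a::field^'n^'n"
  assumes "det A \<noteq> 0" shows "A ** matrix_inv A = mat 1"
proof -
  have "\<exists>A'. A ** A' = mat 1 \<and> A' ** A = mat 1" using assms invertible_det_nz[of A] by (simp add: invertible_def)
  then show ?thesis unfolding matrix_inv_def by (rule someI2_ex) blast
qed

lemma matrix_inv_left:
  fixes A :: "'a::field^'n^'n"
  assumes "det A \<noteq> 0" shows "matrix_inv A ** A = mat 1"
  using matrix_inv_right[OF assms] matrix_left_right_inverse by blast

lemma matrix_inv_unique:
  fixes A B :: "'a::field^'n^'n"
  assumes "A ** B = mat 1" shows "det A \<noteq> 0" "matrix_inv A = B"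
proof -
  have "det A * det B = 1" using assms by (metis det_I det_mul)
  then show d: "det A \<noteq> 0" by auto
  have "matrix_inv A = matrix_inv A ** (A ** B)" using assms by simp
  also have "\<dots> = B" using matrix_inv_left[OF d] by (simp add: matrix_mul_assoc)
  finally show "matrix_inv A = B" .
qed

lemma matrix_inv_entry:
  fixes A :: "'a::field^'n^'n"
  assumes "det A \<noteq> 0"
  shows "matrix_inv A $ i $ j = det (\<chi> k l. if l = i then (if k = j then 1 else 0) else A $ k $ l) / det A"
proof -
  have "A *v (\<chi> i. matrix_inv A $ i $ j) = (\<chi> k. (A ** matrix_inv A) $ k $ j)"
    by (simp add: matrix_vector_mult_def matrix_matrix_mult_def)
  also have "\<dots> = (\<chi> k. if k = j then 1 else 0)"
    unfolding matrix_inv_right[OF assms] by (simp add: mat_def)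
  finally have "(\<chi> i. matrix_inv A $ i $ j) = (\<chi> k. det (\<chi> i l. if l = k then (\<chi> k. if k = j then 1 else 0) $ i else A $ i $ l) / det A)"
    unfolding cramer[OF assms] .
  then have "(\<chi> i. matrix_inv A $ i $ j) $ i = (\<chi> k. det (\<chi> i l. if l = k then (\<chi> k. if k = j then 1 else 0) $ i else A $ i $ l) / det A) $ i"
    by (rule arg_cong)
  then show ?thesis by (simp only: vec_lambda_beta)
qed

lemma continuous_on_matrix_inv:
  fixes f :: "'a::topological_space \<Rightarrow> ('b::real_normed_field)^'n^'n"
  assumes f: "continuous_on S f" and nz: "\<And>x. x \<in> S \<Longrightarrow> det (f x) \<noteq> 0"
  shows "continuous_on S (\<lambda>x. matrix_inv (f x))"
proof -
  have entry: "continuous_on S (\<lambda>x. if l = i then (if k = j then 1 else 0) else f x $ k $ l)" for i j k l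
    by (cases "l = i") (auto intro!: continuous_intros f)
  have "continuous_on S (\<lambda>x. det (\<chi> k l. if l = i then (if k = j then 1 else 0) else f x $ k $ l) / det (f x))" for i j
    by (intro continuous_on_divide continuous_on_det continuous_on_vec_lambda entry f ballI nz)
  then have "continuous_on S (\<lambda>x. matrix_inv (f x) $ i $ j)" for i j
    by (simp add: matrix_inv_entry nz cong: continuous_on_cong)
  then have "continuous_on S (\<lambda>x. \<chi> i j. matrix_inv (f x) $ i $ j)"
    by (intro continuous_on_vec_lambda)
  then show ?thesis by simp
qed

lemma has_derivative_matrix:
  fixes f :: "'a::real_normed_vector \<Rightarrow> real^'n^'m"
  assumes "\<And>i j. ((\<lambda>x. f x $ i $ j) has_derivative (\<lambda>h. f' h $ i $ j)) (at x within S)"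
  shows "(f has_derivative f') (at x within S)"
proof (rule iffD2[OF has_derivative_componentwise_within], rule ballI)
  fix b :: "real^'n^'m" assume "b \<in> Basis"
  then obtain i j where b: "b = axis i (axis j 1)" by (auto simp: Basis_vec_def)
  have e: "g \<bullet> b = g $ i $ j" for g by (simp add: b inner_axis)
  show "((\<lambda>x. f x \<bullet> b) has_derivative (\<lambda>x. f' x \<bullet> b)) (at x within S)"
    unfolding e by (rule assms)
qed

text \<open>Near \<open>x\<close> Cramer's rule turns the entries into quotients of determinants.
  Later arguments ask only for the existence of the derivative, so no formula for it is
  carried.\<close>

lemma differentiable_matrix_inv:
  fixes f :: "'a::real_normed_vector \<Rightarrow> real^'n^'n"
  assumes f: "(f has_derivative f') (at x)" and nz: "det (f x) \<noteq> 0"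
  shows "(\<lambda>x. matrix_inv (f x)) differentiable (at x)"
proof -
  have c: "((\<lambda>x. f x $ i $ j) has_derivative (\<lambda>h. f' h $ i $ j)) (at x)" for i j
    by (intro bounded_linear.has_derivative[OF bounded_linear_vec_nth] f)
  note ev = eventually_det_nonzero[OF f nz]
  have "\<exists>D. ((\<lambda>y. matrix_inv (f y) $ i $ j) has_derivative D) (at x)" for i j
  proof -
    let ?M = "\<lambda>y. \<chi> k l. if l = i then (if k = j then 1 else 0) else f y $ k $ l"
    have "(?M has_derivative (\<lambda>h. \<chi> k l. if l = i then 0 else f' h $ k $ l)) (at x)"
    proof (rule has_derivative_matrix)
      fix k l show "((\<lambda>y. ?M y $ k $ l) has_derivative (\<lambda>h. (\<chi> k l. if l = i then 0 else f' h $ k $ l) $ k $ l)) (at x)"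
        by (cases "l = i") (simp_all add: c)
    qed
    from has_derivative_divide[OF has_derivative_det[OF this] has_derivative_det[OF f] nz]
    have "\<exists>D. ((\<lambda>y. det (?M y) / det (f y)) has_derivative D) (at x)" by blast
    then obtain D where D: "((\<lambda>y. det (?M y) / det (f y)) has_derivative D) (at x)" by blast
    have "((\<lambda>y. matrix_inv (f y) $ i $ j) has_derivative D) (at x)"
    proof (rule has_derivative_transform_eventually[OF D])
      show "\<forall>\<^sub>F y in at x. det (?M y) / det (f y) = matrix_inv (f y) $ i $ j"
        using ev by (auto simp: eventually_at_filter matrix_inv_entry elim!: eventually_mono)
    qed (auto simp: matrix_inv_entry[OF nz])
    then show ?thesis by blast
  qed
  then obtain D where D: "\<And>i j. ((\<lambda>y. matrix_inv (f y) $ i $ j) has_derivative D i j) (at x)" by metis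
  have "((\<lambda>x. matrix_inv (f x)) has_derivative (\<lambda>h. \<chi> i j. D i j h)) (at x)"
    by (rule has_derivative_matrix) (simp add: D)
  then show ?thesis unfolding differentiable_def by blast
qed

subsection \<open>Orthogonal diagonalization\<close>

text \<open>A maximizer \<open>v\<close> of the quadratic form \<open>x \<bullet> f x\<close> on the
  unit sphere of \<open>S\<close> is an eigenvector, and its orthogonal complement in
  \<open>S\<close> is invariant and of smaller dimension.\<close>

lemma selfadjoint_eigenbasis:
  fixes f :: "'a::euclidean_space \<Rightarrow> 'a"
  assumes lin: "linear f" and sa: "\<And>x y. f x \<bullet> y = x \<bullet> f y"
    and S: "subspace S" "f ` S \<subseteq> S"
  shows "\<exists>B \<mu>. B \<subseteq> S \<and> pairwise orthogonal B \<and> (\<forall>b\<in>B. norm b = 1 \<and> f b = \<mu> b *\<^sub>R b) \<and> S \<subseteq> span B"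
  using S
proof (induction "dim S" arbitrary: S rule: less_induct)
  case (less S)
  show ?case
  proof (cases "S \<subseteq> {0}")
    case True
    then show ?thesis by (intro exI[of _ "{}"]) auto
  next
    case False
    then obtain x0 where x0: "x0 \<in> S" "x0 \<noteq> 0" by auto
    let ?K = "sphere 0 1 \<inter> S"
    have "compact ?K" by (intro compact_Int_closed compact_sphere closed_subspace less.prems)
    moreover have "sgn x0 \<in> ?K" using x0 less.prems(1) by (simp add: sgn_div_norm subspace_scale)
    moreover have "continuous_on ?K (\<lambda>x. x \<bullet> f x)"
      by (intro continuous_intros linear_continuous_on linear_conv_bounded_linear[THEN iffD1] lin)
    ultimately obtain v where v: "v \<in> S" "norm v = 1" and max: "\<And>x. x \<in> ?K \<Longrightarrow> x \<bullet> f x \<le> v \<bullet> f v"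
      using continuous_attains_sup[of ?K "\<lambda>x. x \<bullet> f x"] by (metis (no_types, lifting) IntE dist_0_norm empty_iff mem_sphere)
    define m where "m = v \<bullet> f v"
    have vv: "v \<bullet> v = 1" using v(2) by (simp add: norm_eq_1)
    have h: "x \<bullet> f x \<le> m * (x \<bullet> x)" if "x \<in> S" for x
    proof (cases "x = 0")
      case False
      have "sgn x \<in> ?K" using False that less.prems(1) by (simp add: sgn_div_norm subspace_scale)
      from max[OF this] have "(x \<bullet> f x) / (norm x)\<^sup>2 \<le> m"
        by (simp add: sgn_div_norm linear_scale[OF lin] m_def power2_eq_square divide_inverse ac_simps)
      then show ?thesis using False by (simp add: divide_le_eq dot_square_norm)
    qed (simp add: linear_0[OF lin])
    \<comment> \<open>The eigenvector defect: moving \<open>v\<close> along \<open>w\<close> changes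
      \<open>m (x \<bullet> x) - x \<bullet> f x\<close>, which is never negative on
      \<open>S\<close>, at first order by \<open>2 * t * (w \<bullet> w)\<close>.\<close>
    define w where "w = m *\<^sub>R v - f v"
    have wS: "w \<in> S" using v less.prems by (auto simp: w_def intro!: subspace_diff subspace_scale)
    have expand: "0 \<le> 2 * t * (w \<bullet> w) + t\<^sup>2 * (m * (w \<bullet> w) - w \<bullet> f w)" for t
    proof -
      have "v + t *\<^sub>R w \<in> S" using v wS less.prems by (intro subspace_add subspace_scale)
      from h[OF this] have "0 \<le> m * ((v + t *\<^sub>R w) \<bullet> (v + t *\<^sub>R w)) - (v + t *\<^sub>R w) \<bullet> f (v + t *\<^sub>R w)" by simp
      also have "\<dots> = 2 * t * ((m *\<^sub>R v - f v) \<bullet> w) + t\<^sup>2 * (m * (w \<bullet> w) - w \<bullet> f w)"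
        using sa[of v w] vv by (simp add: linear_add[OF lin] linear_scale[OF lin] inner_simps m_def inner_commute power2_eq_square algebra_simps)
      finally show ?thesis by (simp only: w_def[symmetric])
    qed
    have "w = 0"
    proof (rule ccontr)
      assume "w \<noteq> 0"
      then have ww: "w \<bullet> w > 0" by simp
      define c where "c = \<bar>m * (w \<bullet> w) - w \<bullet> f w\<bar> + 1"
      \<comment> \<open>With this negative \<open>t\<close> the quadratic term is at most half the
        size of the linear one.\<close>
      define t where "t = - (w \<bullet> w) / c"
      have c: "c > 0" by (simp add: c_def)
      have "t\<^sup>2 * (m * (w \<bullet> w) - w \<bullet> f w) \<le> t\<^sup>2 * c" by (intro mult_left_mono) (auto simp: c_def)
      also have "\<dots> = - t * (w \<bullet> w)" using c by (simp add: t_def power2_eq_square)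
      finally have "0 \<le> 2 * t * (w \<bullet> w) - t * (w \<bullet> w)" using expand[of t] by linarith
      moreover have "t * (w \<bullet> w) < 0" using c ww by (simp add: t_def divide_neg_pos mult_neg_pos)
      ultimately show False by simp
    qed
    then have fv: "f v = m *\<^sub>R v" by (simp add: w_def)
    let ?S' = "{x \<in> S. x \<bullet> v = 0}"
    have S': "subspace ?S'" using less.prems(1) by (auto simp: subspace_def inner_simps)
    have inv: "f ` ?S' \<subseteq> ?S'" using less.prems(2) sa fv by auto
    have "v \<notin> ?S'" using vv by simp
    then have "?S' \<subset> S" using v(1) by blast
    then have "dim ?S' < dim S"
      by (metis (no_types, lifting) dim_psubset less.prems(1) S' span_eq_iff)
    from less.hyps[OF this S' inv] obtain B \<mu> where B: "B \<subseteq> ?S'" "pairwise orthogonal B"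
      "\<forall>b\<in>B. norm b = 1 \<and> f b = \<mu> b *\<^sub>R b" "?S' \<subseteq> span B" by blast
    have vB: "v \<notin> B" using B(1) vv by auto
    show ?thesis
    proof (intro exI[of _ "insert v B"] exI[of _ "\<mu>(v := m)"] conjI)
      show "insert v B \<subseteq> S" using B(1) v by auto
      show "pairwise orthogonal (insert v B)"
        using B(1,2) by (auto simp: pairwise_insert orthogonal_def inner_commute)
      show "\<forall>b\<in>insert v B. norm b = 1 \<and> f b = (\<mu>(v := m)) b *\<^sub>R b" using B(3) fv v(2) vB by auto
      show "S \<subseteq> span (insert v B)"
      proof
        fix x assume "x \<in> S"
        then have "x - (x \<bullet> v) *\<^sub>R v \<in> ?S'" using v vv less.prems(1) by (auto intro!: subspace_diff subspace_scale simp: inner_simps)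
        then show "x \<in> span (insert v B)" using B(4) by (auto simp: span_breakdown_eq)
      qed
    qed
  qed
qed

definition diag_mat :: "('n \<Rightarrow> 'a::zero) \<Rightarrow> 'a^'n^'n" where
  "diag_mat d = (\<chi> i j. if i = j then d i else 0)"

lemma diag_mat_add: "diag_mat (\<lambda>i. f i + g i) = diag_mat f + (diag_mat g :: 'a::monoid_add^'n^'n)"
  by (simp add: diag_mat_def vec_eq_iff)

lemma diag_mat_scaleR: "diag_mat (\<lambda>i. c * f i) = c *\<^sub>R (diag_mat f :: real^'n^'n)"
  by (simp add: diag_mat_def vec_eq_iff)

lemma diag_mat_1: "diag_mat (\<lambda>i. 1) = mat 1"
  by (simp add: diag_mat_def mat_def vec_eq_iff)

lemma det_diag_mat: "det (diag_mat d) = (\<Prod>i\<in>UNIV. d i)"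
  by (subst det_diagonal) (auto simp: diag_mat_def)

lemma transpose_diag_mat [simp]: "transpose (diag_mat d) = diag_mat d"
  by (auto simp: diag_mat_def transpose_def vec_eq_iff)

lemma symmetric_diagonalization:
  fixes S :: "real^'n^'n"
  assumes "transpose S = S"
  obtains P :: "real^'n^'n" and d where "transpose P ** P = mat 1" "P ** transpose P = mat 1" "S = P ** diag_mat d ** transpose P"
proof -
  have sa: "(S *v x) \<bullet> y = x \<bullet> (S *v y)" for x y
    using dot_lmul_matrix[of x S y] assms by (metis transpose_matrix_vector)
  obtain B \<mu> where B: "pairwise orthogonal B" "\<forall>b\<in>B. norm b = 1 \<and> S *v b = \<mu> b *\<^sub>R b" "UNIV \<subseteq> span B"
    using selfadjoint_eigenbasis[of "(*v) S" UNIV] sa by auto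
  have "independent B" using B(1,2) by (intro pairwise_orthogonal_independent) auto
  then have "card B = dim (UNIV :: (real^'n) set)" "finite B"
    using B(3) basis_card_eq_dim[of B UNIV] independent_imp_finite by auto
  then have "card B = CARD('n)" "finite B" by simp_all
  then obtain e where e: "bij_betw e (UNIV :: 'n set) B"
    by (metis bij_betw_iff_card finite_class.finite_UNIV)
  define P where "P = (\<chi> i j. e j $ i)"
  have eB: "e j \<in> B" for j using e by (auto simp: bij_betw_def)
  have ee: "e i \<bullet> e j = (if i = j then 1 else 0)" for i j
  proof (cases "i = j")
    case False
    then have "e i \<noteq> e j" using e by (auto simp: bij_betw_def inj_def)
    then show ?thesis using B(1) eB[of i] eB[of j] False by (simp add: pairwise_def orthogonal_def)
  qed (use B(2) eB in \<open>simp add: norm_eq_1\<close>)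
  have PP: "transpose P ** P = mat 1"
    using ee by (simp add: P_def transpose_def matrix_matrix_mult_def mat_def vec_eq_iff inner_vec_def)
  then have PP': "P ** transpose P = mat 1" using matrix_left_right_inverse by blast
  have Se: "S *v e j = \<mu> (e j) *\<^sub>R e j" for j using B(2) eB by blast
  have "S ** P = P ** diag_mat (\<lambda>j. \<mu> (e j))"
  proof -
    have "(S ** P) $ i $ j = (S *v e j) $ i" for i j
      by (simp add: P_def matrix_matrix_mult_def matrix_vector_mult_def)
    then show ?thesis by (simp add: Se vec_eq_iff P_def matrix_matrix_mult_def diag_mat_def if_distrib cong: if_cong)
  qed
  then have "S = P ** diag_mat (\<lambda>j. \<mu> (e j)) ** transpose P"
    by (metis PP' matrix_mul_assoc matrix_mul_rid)
  then show thesis using that PP PP' by blast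
qed

lemma det_diag_conj:
  fixes P :: "real^'n^'n"
  assumes "P ** transpose P = mat 1"
  shows "det (P ** diag_mat d ** transpose P) = (\<Prod>i\<in>UNIV. d i)"
proof -
  have "det P * det (transpose P) = 1" using assms by (metis det_I det_mul)
  then show ?thesis by (simp add: det_mul det_diag_mat)
qed

lemma symmetric_shift_nonsingular:
  fixes S :: "real^'n^'n"
  assumes "transpose S = S" "e > 0"
  obtains \<delta> where "0 < \<delta>" "\<delta> < e" "det (S + \<delta> *\<^sub>R mat 1) \<noteq> 0"
proof -
  obtain P :: "real^'n^'n" and d where P: "transpose P ** P = mat 1" "P ** transpose P = mat 1" "S = P ** diag_mat d ** transpose P"
    using symmetric_diagonalization[OF assms(1)] by metis
  have eq: "S + \<delta> *\<^sub>R mat 1 = P ** diag_mat (\<lambda>i. d i + \<delta> * 1) ** transpose P" for \<delta>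
    unfolding diag_mat_add diag_mat_scaleR diag_mat_1 P(3) by (simp add: matrix_mult_linear P(2))
  have "infinite ({0<..<e} - range (\<lambda>i. - d i))" using assms(2) by (intro Diff_infinite_finite) (auto simp: infinite_Ioo)
  then obtain \<delta> where "\<delta> \<in> {0<..<e} - range (\<lambda>i. - d i)" using infinite_imp_nonempty by blast
  then have "0 < \<delta>" "\<delta> < e" "\<And>i. d i + \<delta> \<noteq> 0" by (auto simp: image_iff add_eq_0_iff2) (metis add.inverse_inverse)
  moreover from this have "det (S + \<delta> *\<^sub>R mat 1) \<noteq> 0" unfolding eq det_diag_conj[OF P(2)] by auto
  ultimately show thesis using that by blast
qed

text \<open>A generic positive definite direction that is diagonal in an eigenbasis of \<open>S\<close> splits all
  zeros of the determinant into simple ones.\<close>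

lemma symmetric_simple_pencil:
  fixes S :: "real^'n^'n"
  assumes sym: "transpose S = S" and nz: "det S \<noteq> 0" and e: "e > 0"
  obtains A where "transpose A = A" "norm (A - mat 1) < e" "finite {u. det (S + u *\<^sub>R A) = 0}"
    "\<And>u. det (S + u *\<^sub>R A) = 0 \<Longrightarrow> ddet (S + u *\<^sub>R A) A \<noteq> 0"
proof -
  obtain P :: "real^'n^'n" and d where P: "transpose P ** P = mat 1" "P ** transpose P = mat 1" "S = P ** diag_mat d ** transpose P"
    using symmetric_diagonalization[OF sym] by metis
  have d0: "d i \<noteq> 0" for i using nz unfolding P(3) det_diag_conj[OF P(2)] by simp
  \<comment> \<open>Distinct weights separate eigenvalues that coincide; the choice of
    \<open>x\<close> below keeps the others apart.\<close>
  obtain c :: "'n \<Rightarrow> nat" where c: "inj c" using finite_imp_inj_to_nat_seg[of "UNIV :: 'n set"] by auto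
  define C where "C = P ** diag_mat (\<lambda>i. real (c i)) ** transpose P"
  \<comment> \<open>These are the \<open>x\<close> at which two roots
    \<open>- d i / \<alpha> i\<close> of the pencil coincide, with
    \<open>\<alpha> i = 1 + x c i\<close>. A vanishing denominator yields \<open>0\<close>, which
    \<open>x > 0\<close> excludes anyway.\<close>
  define bad where "bad = (\<Union>(i, j) \<in> UNIV. {(d j - d i) / (d i * c j - d j * c i)})"
  have "finite bad" unfolding bad_def by auto
  moreover have "e / (norm C + 1) > 0" using e by (simp add: add_nonneg_pos)
  ultimately have "infinite ({0<..<e / (norm C + 1)} - bad)" by (intro Diff_infinite_finite) (auto simp: infinite_Ioo)
  then obtain x where x: "0 < x" "x < e / (norm C + 1)" "x \<notin> bad" using infinite_imp_nonempty by force
  define \<alpha> where "\<alpha> i = 1 + x * real (c i)" for i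
  have \<alpha>: "\<alpha> i > 0" for i using x by (simp add: \<alpha>_def add_pos_nonneg)
  have distinct: "d i * \<alpha> j \<noteq> d j * \<alpha> i" if "i \<noteq> j" for i j
  proof
    assume eq: "d i * \<alpha> j = d j * \<alpha> i"
    then have eq': "x * (d i * c j - d j * c i) = d j - d i" by (simp add: \<alpha>_def algebra_simps)
    show False
    proof (cases "d i * c j - d j * c i = 0")
      \<comment> \<open>Coincidence then forces \<open>d i = d j\<close>; as \<open>S\<close> is
        nonsingular this value is nonzero, so the weights would agree.\<close>
      case True
      then have "d i = d j" using eq' by simp
      with True have "real (c i) = real (c j)" using d0 by (simp add: right_diff_distrib[symmetric])
      then show False using c that by (auto dest: injD)
    next
      case False
      then have "x = (d j - d i) / (d i * c j - d j * c i)" using eq' by (simp add: field_simps)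
      then show False using x(3) unfolding bad_def by blast
    qed
  qed
  define A where "A = P ** diag_mat \<alpha> ** transpose P"
  have A: "A = mat 1 + x *\<^sub>R C"
    unfolding A_def \<alpha>_def diag_mat_add diag_mat_scaleR diag_mat_1 C_def by (simp add: matrix_mult_linear P(2))
  have line: "S + u *\<^sub>R A = P ** diag_mat (\<lambda>i. d i + u * \<alpha> i) ** transpose P" for u
    unfolding diag_mat_add diag_mat_scaleR P(3) A_def by (simp add: matrix_mult_linear)
  have det: "det (S + u *\<^sub>R A) = (\<Prod>i\<in>UNIV. d i + u * \<alpha> i)" for u
    unfolding line det_diag_conj[OF P(2)] ..
  show thesis
  proof
    show "transpose A = A" by (simp add: A_def matrix_transpose_mul matrix_mul_assoc)
    have "norm (A - mat 1) = x * norm C" using x(1) by (simp add: A)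
    also have "\<dots> \<le> x * (norm C + 1)" using x(1) by simp
    also have "\<dots> < e" using x(2) by (simp add: pos_less_divide_eq add_nonneg_pos)
    finally show "norm (A - mat 1) < e" .
    have "{u. det (S + u *\<^sub>R A) = 0} \<subseteq> range (\<lambda>i. - d i / \<alpha> i)"
    proof safe
      fix u assume "det (S + u *\<^sub>R A) = 0"
      then obtain i where "d i + u * \<alpha> i = 0" unfolding det by auto
      then have "u = - d i / \<alpha> i" using \<alpha>[of i] by (simp add: field_simps)
      then show "u \<in> range (\<lambda>i. - d i / \<alpha> i)" by blast
    qed
    then show "finite {u. det (S + u *\<^sub>R A) = 0}" by (rule finite_subset) simp
  next
    fix u assume "det (S + u *\<^sub>R A) = 0"
    then obtain i where i: "d i + u * \<alpha> i = 0" unfolding det by auto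
    have nzj: "d j + u * \<alpha> j \<noteq> 0" if "j \<noteq> i" for j
    proof
      assume j: "d j + u * \<alpha> j = 0"
      have "d i * \<alpha> j = - u * \<alpha> i * \<alpha> j" "d j * \<alpha> i = - u * \<alpha> i * \<alpha> j"
        using i j by (simp_all add: add_eq_0_iff2)
      then show False using distinct[of i j] that by simp
    qed
    have 1: "((\<lambda>u. S + u *\<^sub>R A) has_derivative (\<lambda>h. h *\<^sub>R A)) (at u)"
      by (auto intro!: derivative_eq_intros)
    have 2: "((\<lambda>u. \<Prod>i\<in>UNIV. d i + u * \<alpha> i) has_derivative
        (\<lambda>h. \<Sum>k\<in>UNIV. h * \<alpha> k * (\<Prod>j\<in>UNIV - {k}. d j + u * \<alpha> j))) (at u)"
      by (rule has_derivative_prod) (auto intro!: derivative_eq_intros)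
    have "(\<lambda>h. ddet (S + u *\<^sub>R A) (h *\<^sub>R A)) = (\<lambda>h. \<Sum>k\<in>UNIV. h * \<alpha> k * (\<Prod>j\<in>UNIV - {k}. d j + u * \<alpha> j))"
      using has_derivative_unique[OF has_derivative_det[OF 1, unfolded det] 2] .
    then have "ddet (S + u *\<^sub>R A) (1 *\<^sub>R A) = (\<Sum>k\<in>UNIV. 1 * \<alpha> k * (\<Prod>j\<in>UNIV - {k}. d j + u * \<alpha> j))"
      by metis
    also have "\<dots> = \<alpha> i * (\<Prod>j\<in>UNIV - {i}. d j + u * \<alpha> j)"
    proof -
      have "(\<Sum>k\<in>UNIV - {i}. 1 * \<alpha> k * (\<Prod>j\<in>UNIV - {k}. d j + u * \<alpha> j)) = 0"
      proof (rule sum.neutral, rule ballI)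
        fix k assume "k \<in> UNIV - {i}"
        then have "(\<Prod>j\<in>UNIV - {k}. d j + u * \<alpha> j) = 0" using i by (intro prod_zero) auto
        then show "1 * \<alpha> k * (\<Prod>j\<in>UNIV - {k}. d j + u * \<alpha> j) = 0" by (simp only: mult_zero_right)
      qed
      then show ?thesis by (subst sum.remove[of UNIV i]) (simp_all only: finite_class.finite_UNIV UNIV_I mult_1_left add_0_right)
    qed
    also have "\<dots> \<noteq> 0" using \<alpha>[of i] nzj by auto
    finally show "ddet (S + u *\<^sub>R A) A \<noteq> 0" by simp
  qed
qed

text \<open>A common kernel vector of \<open>N\<close> and \<open>X\<close> is killed by every
  matrix obtained from \<open>N\<close> by substituting one row of \<open>X\<close>.\<close>

lemma ddet_zero_kernel:
  fixes N :: "'a::field^'n^'n"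
  assumes "N *v z = 0" "X *v z = 0" "z \<noteq> 0"
  shows "ddet N X = 0"
proof -
  have "det (\<chi> k. if k = i then X $ i else N $ k) = 0" for i
  proof -
    have "(\<chi> k. if k = i then X $ i else N $ k) *v z = 0"
      using assms(1,2) by (auto simp: matrix_vector_mult_def vec_eq_iff)
    then show ?thesis using det_nz_iff_kernel assms(3) by blast
  qed
  then show ?thesis by (simp add: ddet_def)
qed

text \<open>At a smooth point of \<open>Sp0 1\<close> the kernel of \<open>M - I\<close> is a line spanned by some \<open>v\<close>, the cokernel
  is spanned by \<open>J v\<close>, and the derivative of the determinant is a multiple of \<open>X \<mapsto> J v \<bullet> X v\<close>.\<close>

lemma ddet_J_nonzero:
  fixes M :: "'n::finite sqmat"
  assumes M: "M \<in> Sp" and d0: "det (M - mat 1) = 0" and V: "ddet (M - mat 1) V \<noteq> 0"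
  shows "ddet (M - mat 1) J \<noteq> 0"
proof
  assume J0: "ddet (M - mat 1) J = 0"
  define N where "N = M - mat 1"
  obtain v where v: "v \<noteq> 0" "N *v v = 0" using d0 det_nz_iff_kernel unfolding N_def by blast
  \<comment> \<open>A two-dimensional kernel contains a nonzero vector orthogonal to any given row
    of \<open>V\<close>, so all row-replaced determinants would vanish, against the hypothesis on
    \<open>V\<close>.\<close>
  have ker: "\<exists>c. z = c *\<^sub>R v" if z: "N *v z = 0" for z
  proof (rule ccontr)
    assume indep: "\<nexists>c. z = c *\<^sub>R v"
    have "det (\<chi> k. if k = i then V $ i else N $ k) = 0" for i
    proof -
      define w where "w = (if V $ i \<bullet> v = 0 then v else (V $ i \<bullet> v) *\<^sub>R z - (V $ i \<bullet> z) *\<^sub>R v)"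
      have "w \<noteq> 0"
      proof (cases "V $ i \<bullet> v = 0")
        case False
        show ?thesis
        proof
          assume "w = 0"
          then have "(V $ i \<bullet> v) *\<^sub>R z = (V $ i \<bullet> z) *\<^sub>R v" using False by (simp add: w_def)
          then have "inverse (V $ i \<bullet> v) *\<^sub>R ((V $ i \<bullet> v) *\<^sub>R z) = inverse (V $ i \<bullet> v) *\<^sub>R ((V $ i \<bullet> z) *\<^sub>R v)" by simp
          then have "z = (inverse (V $ i \<bullet> v) * (V $ i \<bullet> z)) *\<^sub>R v" using False by simp
          then show False using indep by blast
        qed
      qed (simp add: w_def v)
      have Nw: "N *v w = 0" using v z by (simp add: w_def algebra_simps matrix_vector_mult_scaleR)
      have Vw: "V $ i \<bullet> w = 0" by (simp add: w_def inner_simps)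
      have "(\<chi> k. if k = i then V $ i else N $ k) *v w = 0"
        using Nw Vw by (auto simp: matrix_mult_dot vec_eq_iff)
      then show ?thesis using det_nz_iff_kernel \<open>w \<noteq> 0\<close> by blast
    qed
    then show False using V unfolding ddet_def N_def[symmetric] by simp
  qed
  \<comment> \<open>A fixed vector \<open>w\<close> of \<open>transpose M\<close> gives, by
    symplecticity, the fixed vector \<open>- J w\<close> of \<open>M\<close>.\<close>
  have coker: "\<exists>c. w = c *\<^sub>R (J *v v)" if w: "transpose N *v w = 0" for w
  proof -
    have inj: "y = 0" if "transpose M *v (J *v y) = 0" for y
    proof -
      have "y = (M ** (- J ** transpose M ** J)) *v y" using Sp_transpose_J[OF M] by simp
      also have "\<dots> = M *v (- J *v (transpose M *v (J *v y)))" 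
        by (simp only: matrix_vector_mul_assoc matrix_mul_assoc)
      finally show ?thesis using that by simp
    qed
    have Mw: "transpose M *v w = w" using w unfolding N_def transpose_diff transpose_mat
      by (simp add: matrix_vector_mult_diff_rdistrib del: transpose_matrix_vector)
    define z where "z = - (J *v w)"
    have Jz: "J *v z = w" by (simp add: z_def J_J_vec vec.neg)
    have "transpose M *v (J *v (M *v z)) = J *v z"
      using M unfolding Sp_iff by (simp add: matrix_vector_mul_assoc matrix_mul_assoc del: transpose_matrix_vector)
    then have "transpose M *v (J *v (N *v z)) = 0"
      by (simp add: N_def matrix_vector_mult_diff_rdistrib matrix_vector_mult_diff_distrib Jz Mw del: transpose_matrix_vector)
    then have "N *v z = 0" by (rule inj)
    then obtain c where "z = c *\<^sub>R v" using ker by blast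
    then have "w = c *\<^sub>R (J *v v)" using Jz by (simp add: matrix_vector_mult_scaleR)
    then show ?thesis by blast
  qed
  \<comment> \<open>The range of \<open>N\<close> is the orthogonal complement of its cokernel.
    Hence \<open>X v = N y\<close> for some \<open>y\<close>, and \<open>X\<close> differs from a
    tangent direction \<open>N Z\<close> by a matrix that kills \<open>v\<close>.\<close>
  have vanish: "ddet N X = 0" if X: "(J *v v) \<bullet> (X *v v) = 0" for X
  proof -
    have sub: "subspace (range ((*v) N))" by (intro linear_subspace_image) auto
    obtain r w where rw: "r \<in> span (range ((*v) N))" "\<And>y. y \<in> span (range ((*v) N)) \<Longrightarrow> orthogonal w y" "X *v v = r + w"
      using orthogonal_subspace_decomp_exists[of "range ((*v) N)" "X *v v"] by blast
    have r: "r \<in> range ((*v) N)" using rw(1) sub by (simp add: span_eq_iff[THEN iffD2])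
    have "(transpose N *v w) \<bullet> y = 0" for y
      using rw(2)[OF span_base, of "N *v y"] by (simp add: dot_lmul_matrix orthogonal_def)
    then have "transpose N *v w = 0" using inner_eq_zero_iff by blast
    then obtain c where c: "w = c *\<^sub>R (J *v v)" using coker by blast
    have "w \<bullet> w = w \<bullet> (X *v v) - w \<bullet> r" using rw(3) by (simp add: inner_simps)
    also have "w \<bullet> r = 0" using rw(1,2) by (simp add: orthogonal_def)
    also have "w \<bullet> (X *v v) = 0" using X c by simp
    finally have "w = 0" by simp
    then obtain y where y: "X *v v = N *v y" using r rw(3) by auto
    define Z :: "'n sqmat" where "Z = (\<chi> i j. y $ i * v $ j / (v \<bullet> v))"
    have "Z *v v = y"
    proof -
      have "(Z *v v) $ i = y $ i / (v \<bullet> v) * (\<Sum>j\<in>UNIV. v $ j * v $ j)" for i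
        unfolding Z_def matrix_vector_mult_def sum_distrib_left by (auto intro!: sum.cong)
      moreover have "(\<Sum>j\<in>UNIV. v $ j * v $ j) = v \<bullet> v" by (simp add: inner_vec_def)
      ultimately have "(Z *v v) $ i = y $ i" for i using v(1) by (simp del: inner_eq_zero_iff) (metis inner_eq_zero_iff)
      then show ?thesis by (simp add: vec_eq_iff)
    qed
    then have "(X - N ** Z) *v v = 0" 
      by (simp add: matrix_vector_mult_diff_rdistrib matrix_vector_mul_assoc[symmetric] y)
    then have "ddet N (X - N ** Z) = 0" using ddet_zero_kernel v by blast
    moreover have "ddet N (N ** Z) = 0" using d0 by (intro ddet_mult_right) (simp add: N_def)
    ultimately show ?thesis by (simp add: ddet_diff)
  qed
  \<comment> \<open>This multiple makes \<open>V - k J\<close> satisfy the hypothesis of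
    \<open>vanish\<close>, because \<open>J\<close> is an isometry:
    \<open>(J v) \<bullet> (J v) = v \<bullet> v\<close>.\<close>
  define k where "k = (J *v v) \<bullet> (V *v v) / (v \<bullet> v)"
  have "(J *v v) \<bullet> ((V - k *\<^sub>R J) *v v) = 0"
    using v(1) by (simp add: matrix_vector_mult_diff_rdistrib scaleR_matrix_vector_assoc[symmetric] inner_simps inner_J_J k_def)
  from vanish[OF this] have "ddet N V = k * ddet N J" by (simp add: ddet_diff ddet_scaleR)
  then show False using J0 V by (simp add: N_def)
qed

subsection \<open>Transversal representatives\<close>

abbreviation homotopic_rel_ends ::
    "real \<Rightarrow> real \<Rightarrow> (real \<Rightarrow> 'n::finite sqmat) \<Rightarrow> (real \<Rightarrow> 'n sqmat) \<Rightarrow> bool" where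
  "homotopic_rel_ends a b \<sigma> \<equiv> homotopic_with_canon (\<lambda>\<rho>. \<rho> a = \<sigma> a \<and> \<rho> b = \<sigma> b) {a..b} Sp \<sigma>"

lemma homotopic_rel_ends_iff:
  fixes \<sigma> \<tau> :: "real \<Rightarrow> 'n::finite sqmat"
  assumes "a \<le> b"
  shows "homotopic_rel_ends a b \<sigma> \<tau> \<longleftrightarrow>
    (\<exists>h. continuous_on ({0..1} \<times> {a..b}) h \<and> h ` ({0..1} \<times> {a..b}) \<subseteq> Sp \<and>
      (\<forall>t\<in>{a..b}. h (0, t) = \<sigma> t) \<and> (\<forall>t\<in>{a..b}. h (1, t) = \<tau> t) \<and>
      (\<forall>u\<in>{0..1::real}. h (u, a) = \<sigma> a \<and> h (u, b) = \<sigma> b))"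
proof -
  have "prod_topology (top_of_set {0..1::real}) (top_of_set {a..b}) = top_of_set ({0..1} \<times> {a..b})"
    by (simp add: subtopology_Times)
  then show ?thesis
    using assms by (subst homotopic_with) (auto simp: continuous_map_subtopology_eu image_subset_iff_funcset)
qed

text \<open>The existence that the definite description in \<open>intersection_number 1\<close>
  presupposes.\<close>

definition transversalizable :: "(real \<Rightarrow> 'n::finite sqmat) \<Rightarrow> real \<Rightarrow> real \<Rightarrow> bool" where
  "transversalizable \<sigma> a b \<longleftrightarrow> (\<exists>\<tau>. homotopic_rel_ends a b \<sigma> \<tau> \<and>
     transversal_path 1 \<tau> a b)"

lemma crossing_speed_cong:
  assumes "\<forall>\<^sub>F s in nhds t. \<tau> s = \<tau>' s"
  shows "crossing_speed \<omega> \<tau> t c \<longleftrightarrow> crossing_speed \<omega> \<tau>' t c"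
proof -
  have "\<tau> t = \<tau>' t" using eventually_nhds_x_imp_x[OF assms] .
  moreover have "(\<tau> has_vector_derivative V) (at t) = (\<tau>' has_vector_derivative V) (at t)" for V
    using assms \<open>\<tau> t = \<tau>' t\<close> by (intro has_vector_derivative_cong_ev) (auto elim: eventually_mono)
  ultimately show ?thesis unfolding crossing_speed_def by simp
qed

text \<open>The glued path may have a corner at \<open>m\<close>, but \<open>m\<close> is not a
  crossing, and near every other time it agrees with one of the pieces.\<close>

lemma transversal_path_join:
  assumes ab: "a \<le> m" "m \<le> b" and \<tau>1: "transversal_path \<omega> \<tau>1 a m" and \<tau>2: "transversal_path \<omega> \<tau>2 m b"
    and m: "\<tau>1 m = \<tau>2 m"
  shows "transversal_path \<omega> (\<lambda>t. if t \<le> m then \<tau>1 t else \<tau>2 t) a b"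
proof -
  let ?\<tau> = "\<lambda>t. if t \<le> m then \<tau>1 t else \<tau>2 t"
  have cont: "continuous_on {a..m} \<tau>1" "continuous_on {m..b} \<tau>2"
    and Sp: "\<And>t. t \<in> {a..m} \<Longrightarrow> \<tau>1 t \<in> Sp" "\<And>t. t \<in> {m..b} \<Longrightarrow> \<tau>2 t \<in> Sp"
    and ends: "\<tau>1 a \<notin> Sp0 \<omega>" "\<tau>1 m \<notin> Sp0 \<omega>" "\<tau>2 b \<notin> Sp0 \<omega>"
    and fin: "finite {t \<in> {a..m}. \<tau>1 t \<in> Sp0 \<omega>}" "finite {t \<in> {m..b}. \<tau>2 t \<in> Sp0 \<omega>}"
    and cr: "\<And>t. t \<in> {a..m} \<Longrightarrow> \<tau>1 t \<in> Sp0 \<omega> \<Longrightarrow> \<exists>c. c \<noteq> 0 \<and> crossing_speed \<omega> \<tau>1 t c"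
      "\<And>t. t \<in> {m..b} \<Longrightarrow> \<tau>2 t \<in> Sp0 \<omega> \<Longrightarrow> \<exists>c. c \<noteq> 0 \<and> crossing_speed \<omega> \<tau>2 t c"
    using \<tau>1 \<tau>2 unfolding transversal_path_def by blast+
  have U: "{a..b} = {a..m} \<union> {m..b}" using ab by auto
  have eq2: "?\<tau> t = \<tau>2 t" if "t \<in> {m..b}" for t using that m by auto
  show ?thesis unfolding transversal_path_def
  proof (intro conjI ballI impI)
    show "continuous_on {a..b} ?\<tau>" unfolding U
    proof (rule continuous_on_If[OF closed_real_atLeastAtMost closed_real_atLeastAtMost cont])
      fix t assume "t \<in> {m..b}" "t \<le> m"
      then have "t = m" by simp
      then show "\<tau>1 t = \<tau>2 t" using m by simp
    qed simp
    show "?\<tau> ` {a..b} \<subseteq> Sp" using Sp by auto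
    show "?\<tau> a \<notin> Sp0 \<omega>" using ends ab by simp
    show "?\<tau> b \<notin> Sp0 \<omega>" using ends ab eq2[of b] by simp
    have "{t \<in> {a..b}. ?\<tau> t \<in> Sp0 \<omega>} \<subseteq> {t \<in> {a..m}. \<tau>1 t \<in> Sp0 \<omega>} \<union> {t \<in> {m..b}. \<tau>2 t \<in> Sp0 \<omega>}"
      by auto
    then show "finite {t \<in> {a..b}. ?\<tau> t \<in> Sp0 \<omega>}"
      using fin finite_subset by blast
    fix t assume t: "t \<in> {a..b}" "?\<tau> t \<in> Sp0 \<omega>"
    have "t \<noteq> m" using t(2) ends(2) by auto
    then consider "t < m" | "t > m" by linarith
    then show "\<exists>c. c \<noteq> 0 \<and> crossing_speed \<omega> ?\<tau> t c"
    proof cases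
      case 1
      have "\<forall>\<^sub>F s in nhds t. ?\<tau> s = \<tau>1 s"
        using eventually_nhds_in_open[of "{..<m}" t] 1 by (auto elim: eventually_mono)
      then show ?thesis using crossing_speed_cong[of ?\<tau> \<tau>1 t \<omega>] 1 t cr(1)[of t] by auto
    next
      case 2
      have "\<forall>\<^sub>F s in nhds t. ?\<tau> s = \<tau>2 s"
        using eventually_nhds_in_open[of "{m<..}" t] 2 by (auto elim: eventually_mono)
      then show ?thesis using crossing_speed_cong[of ?\<tau> \<tau>2 t \<omega>] 2 t cr(2)[of t] by auto
    qed
  qed
qed

lemma transversalizable_join:
  fixes \<sigma> :: "real \<Rightarrow> 'n::finite sqmat"
  assumes ab: "a \<le> m" "m \<le> b" and 1: "transversalizable \<sigma> a m" and 2: "transversalizable \<sigma> m b"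
  shows "transversalizable \<sigma> a b"
proof -
  obtain \<tau>1 h1 where t1: "transversal_path 1 \<tau>1 a m" and h1: "continuous_on ({0..1} \<times> {a..m}) h1"
    "h1 ` ({0..1} \<times> {a..m}) \<subseteq> Sp" "\<And>t. t \<in> {a..m} \<Longrightarrow> h1 (0, t) = \<sigma> t" "\<And>t. t \<in> {a..m} \<Longrightarrow> h1 (1, t) = \<tau>1 t"
    "\<And>u. u \<in> {0..1::real} \<Longrightarrow> h1 (u, a) = \<sigma> a" "\<And>u. u \<in> {0..1} \<Longrightarrow> h1 (u, m) = \<sigma> m"
    using 1 unfolding transversalizable_def homotopic_rel_ends_iff[OF ab(1)] by metis
  obtain \<tau>2 h2 where t2: "transversal_path 1 \<tau>2 m b" and h2: "continuous_on ({0..1} \<times> {m..b}) h2"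
    "h2 ` ({0..1} \<times> {m..b}) \<subseteq> Sp" "\<And>t. t \<in> {m..b} \<Longrightarrow> h2 (0, t) = \<sigma> t" "\<And>t. t \<in> {m..b} \<Longrightarrow> h2 (1, t) = \<tau>2 t"
    "\<And>u. u \<in> {0..1::real} \<Longrightarrow> h2 (u, m) = \<sigma> m" "\<And>u. u \<in> {0..1} \<Longrightarrow> h2 (u, b) = \<sigma> b"
    using 2 unfolding transversalizable_def homotopic_rel_ends_iff[OF ab(2)] by metis
  have m: "\<tau>1 m = \<tau>2 m" using h1(4)[of m] h2(4)[of m] h1(6)[of 1] h2(5)[of 1] ab by auto
  let ?\<tau> = "\<lambda>t. if t \<le> m then \<tau>1 t else \<tau>2 t"
  let ?h = "\<lambda>x. if snd x \<le> m then h1 x else h2 x"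
  have U: "{0..1::real} \<times> {a..b} = ({0..1} \<times> {a..m}) \<union> ({0..1} \<times> {m..b})" using ab by auto
  have hc: "continuous_on ({0..1} \<times> {a..b}) ?h"
    unfolding U
  proof (rule continuous_on_If[OF _ _ h1(1) h2(1)])
    fix x assume "x \<in> {0..1::real} \<times> {m..b}" "snd x \<le> m"
    then have "fst x \<in> {0..1}" "snd x = m" by auto
    then show "h1 x = h2 x" using h1(6)[of "fst x"] h2(5)[of "fst x"] by (metis prod.collapse)
  next
    fix x assume "x \<in> {0..1::real} \<times> {a..m}" "\<not> snd x \<le> m"
    then show "h1 x = h2 x" by auto
  qed (intro closed_Times closed_real_atLeastAtMost)+
  have hSp: "?h ` ({0..1} \<times> {a..b}) \<subseteq> Sp"
  proof (rule image_subsetI)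
    fix x assume x: "x \<in> {0..1::real} \<times> {a..b}"
    show "?h x \<in> Sp"
    proof (cases "snd x \<le> m")
      case True
      then have "x \<in> {0..1} \<times> {a..m}" using x by auto
      then have "h1 x \<in> Sp" using h1(2) by blast
      then show ?thesis using True by simp
    next
      case False
      then have "x \<in> {0..1} \<times> {m..b}" using x by auto
      then have "h2 x \<in> Sp" using h2(2) by blast
      then show ?thesis using False by simp
    qed
  qed
  have h01: "?h (0, t) = \<sigma> t" "?h (1, t) = ?\<tau> t" if "t \<in> {a..b}" for t
    using that h1(3,4)[of t] h2(3,4)[of t] by simp_all
  have ha: "?h (u, a) = \<sigma> a" if "u \<in> {0..1}" for u using h1(5)[OF that] ab by simp
  have hb: "?h (u, b) = \<sigma> b" if "u \<in> {0..1}" for u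
  proof (cases "b \<le> m")
    case True
    then have "b = m" using ab by simp
    then show ?thesis using h1(6)[OF that] by simp
  qed (simp add: h2(6)[OF that])
  have "homotopic_rel_ends a b \<sigma> ?\<tau>"
    unfolding homotopic_rel_ends_iff[OF order_trans[OF ab]]
    by (rule exI[of _ ?h]) (intro conjI ballI hc hSp h01 ha hb)
  then show ?thesis
    unfolding transversalizable_def using transversal_path_join[OF ab t1 t2 m] by blast
qed

text \<open>The Cayley-type chart \<open>S = J N (I + Q N)\<^sup>-\<^sup>1\<close> with \<open>N = M - I\<close> and \<open>Q = I/2 + \<kappa> J\<close> identifies the
  symplectic \<open>M\<close> with \<open>I + Q N\<close> invertible with symmetric matrices \<open>S\<close>, and \<open>Sp0 1\<close> with \<open>det S = 0\<close>.
  In the other direction \<open>N = - (I + J S Q)\<^sup>-\<^sup>1 J S\<close>.\<close>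

definition chart_Q :: "real \<Rightarrow> 'n::finite sqmat" where
  "chart_Q \<kappa> = (1/2) *\<^sub>R mat 1 + \<kappa> *\<^sub>R J"

definition chart_dom :: "real \<Rightarrow> 'n::finite sqmat \<Rightarrow> 'n sqmat" where
  "chart_dom \<kappa> M = mat 1 + chart_Q \<kappa> ** (M - mat 1)"

definition chart :: "real \<Rightarrow> 'n::finite sqmat \<Rightarrow> 'n sqmat" where
  "chart \<kappa> M = J ** (M - mat 1) ** matrix_inv (chart_dom \<kappa> M)"

definition param_dom :: "real \<Rightarrow> 'n::finite sqmat \<Rightarrow> 'n sqmat" where
  "param_dom \<kappa> S = mat 1 + J ** S ** chart_Q \<kappa>"

definition param :: "real \<Rightarrow> 'n::finite sqmat \<Rightarrow> 'n sqmat" where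
  "param \<kappa> S = mat 1 - matrix_inv (param_dom \<kappa> S) ** (J ** S)"

lemma J_mult_J_left [simp]: "J ** (J ** A) = - A"
  by (simp add: matrix_mul_assoc matrix_mult_minus_left)

lemma Sp_iff_shift:
  "M \<in> Sp \<longleftrightarrow> J ** (M - mat 1) + transpose (M - mat 1) ** J + transpose (M - mat 1) ** J ** (M - mat 1) = 0"
proof -
  have "J ** (M - mat 1) + transpose (M - mat 1) ** J + transpose (M - mat 1) ** J ** (M - mat 1) = transpose M ** J ** M - J"
    by (simp add: transpose_linear transpose_mat matrix_mult_linear matrix_mul_assoc)
  then show ?thesis by (simp add: Sp_iff)
qed

text \<open>Up to congruence by \<open>chart_dom \<kappa> M\<close> this matrix is the chart value.
  It equals \<open>J N + (1/2) N' J N + \<kappa> N' N\<close> with \<open>N'\<close> the transpose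
  of \<open>N = M - I\<close>. The last term is symmetric for every \<kappa>, and the
  \<open>1/2\<close> in \<open>chart_Q\<close> makes the difference from the transpose exactly the
  symplectic condition on \<open>N\<close>.\<close>

lemma chart_form_symmetric_iff:
  fixes M :: "'n::finite sqmat"
  shows "M \<in> Sp \<longleftrightarrow> transpose (transpose (chart_dom \<kappa> M) ** J ** (M - mat 1)) = transpose (chart_dom \<kappa> M) ** J ** (M - mat 1)"
proof -
  define N where "N = M - mat 1"
  have "transpose (chart_dom \<kappa> M) ** J ** N = J ** N + (1/2) *\<^sub>R (transpose N ** J ** N) + \<kappa> *\<^sub>R (transpose N ** N)"
    by (simp add: chart_dom_def chart_Q_def transpose_linear transpose_mat matrix_mult_linear matrix_transpose_mul N_def[symmetric])
       (simp add: matrix_mult_linear matrix_mul_assoc[symmetric] algebra_simps)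
  moreover have "transpose (J ** N + (1/2) *\<^sub>R (transpose N ** J ** N) + \<kappa> *\<^sub>R (transpose N ** N))
     = - (transpose N ** J) - (1/2) *\<^sub>R (transpose N ** J ** N) + \<kappa> *\<^sub>R (transpose N ** N)"
    by (simp add: transpose_linear matrix_mult_linear matrix_transpose_mul matrix_mul_assoc)
  moreover have "J ** N + (1/2) *\<^sub>R (transpose N ** J ** N) + \<kappa> *\<^sub>R (transpose N ** N)
      - (- (transpose N ** J) - (1/2) *\<^sub>R (transpose N ** J ** N) + \<kappa> *\<^sub>R (transpose N ** N))
     = J ** N + transpose N ** J + transpose N ** J ** N"
    by (simp add: algebra_simps flip: scaleR_2)
  ultimately show ?thesis unfolding Sp_iff_shift N_def[symmetric] by (metis (no_types, lifting) right_minus_eq)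
qed

lemma param_eq:
  assumes "det (param_dom \<kappa> S) \<noteq> 0"
  shows "param_dom \<kappa> S ** (param \<kappa> S - mat 1) = - (J ** S)"
  by (simp add: param_def matrix_mult_linear matrix_mul_assoc matrix_inv_right[OF assms])

lemma param_in_Sp:
  assumes S: "transpose S = S" and d: "det (param_dom \<kappa> S) \<noteq> 0"
  shows "param \<kappa> S \<in> Sp"
proof -
  let ?N = "param \<kappa> S - mat 1" and ?C = "chart_dom \<kappa> (param \<kappa> S)"
  have "?N + J ** S ** chart_Q \<kappa> ** ?N = - (J ** S)"
    using param_eq[OF d] by (simp only: param_dom_def matrix_mult_add_left matrix_mul_lid)
  then have "?N = - (J ** S) - J ** S ** chart_Q \<kappa> ** ?N" by (simp only: eq_diff_eq)
  then have "J ** ?N = J ** (- (J ** S) - J ** S ** chart_Q \<kappa> ** ?N)" by (rule arg_cong)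
  also have "\<dots> = S ** ?C"
    by (simp add: chart_dom_def matrix_mult_linear matrix_mul_assoc[symmetric])
  finally have JN: "J ** ?N = S ** ?C" .
  have "transpose ?C ** J ** ?N = transpose ?C ** S ** ?C" by (simp add: matrix_mul_assoc[symmetric] JN)
  then have "transpose (transpose ?C ** J ** ?N) = transpose ?C ** J ** ?N"
    by (simp add: matrix_transpose_mul S matrix_mul_assoc)
  then show ?thesis using chart_form_symmetric_iff by blast
qed

lemma chart_inverse:
  assumes M: "M \<in> Sp" and d: "det (chart_dom \<kappa> M) \<noteq> 0"
  shows "transpose (chart \<kappa> M) = chart \<kappa> M" "det (param_dom \<kappa> (chart \<kappa> M)) \<noteq> 0" "param \<kappa> (chart \<kappa> M) = M"
proof -
  let ?N = "M - mat 1" and ?C = "chart_dom \<kappa> M" and ?S = "chart \<kappa> M" and ?Q = "chart_Q \<kappa>"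
  have SC: "?S ** ?C = J ** ?N" by (simp add: chart_def matrix_mul_assoc[symmetric] matrix_inv_left[OF d])
  have C': "?C ** matrix_inv ?C = mat 1" "matrix_inv ?C ** ?C = mat 1"
    using matrix_inv_right[OF d] matrix_inv_left[OF d] by auto
  have tC': "matrix_inv (transpose ?C) ** transpose ?C = mat 1" using d by (intro matrix_inv_left) (simp add: det_transpose)
  have "transpose ?C ** ?S ** ?C = transpose ?C ** J ** ?N" by (simp add: matrix_mul_assoc[symmetric] SC)
  then have "transpose (transpose ?C ** ?S ** ?C) = transpose ?C ** ?S ** ?C"
    using M chart_form_symmetric_iff[of M \<kappa>] by simp
  then have "transpose ?C ** transpose ?S ** ?C = transpose ?C ** ?S ** ?C"
    by (simp add: matrix_transpose_mul matrix_mul_assoc)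
  then have "matrix_inv (transpose ?C) ** (transpose ?C ** transpose ?S ** ?C) ** matrix_inv ?C
      = matrix_inv (transpose ?C) ** (transpose ?C ** ?S ** ?C) ** matrix_inv ?C" by simp
  then have "(matrix_inv (transpose ?C) ** transpose ?C) ** transpose ?S ** (?C ** matrix_inv ?C)
      = (matrix_inv (transpose ?C) ** transpose ?C) ** ?S ** (?C ** matrix_inv ?C)"
    by (simp only: matrix_mul_assoc)
  then show "transpose ?S = ?S" by (simp add: tC' C')
  have JSC: "J ** ?S ** ?C = - ?N" by (simp add: matrix_mul_assoc[symmetric] SC)
  then have eq: "J ** ?S + J ** ?S ** ?Q ** ?N = - ?N"
    by (simp add: chart_dom_def matrix_mult_linear matrix_mul_assoc)
  \<comment> \<open>The inverse of \<open>I + J S Q\<close> in closed form is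
    \<open>I + N Q\<close>, by the relation \<open>eq\<close> between \<open>S\<close> and
    \<open>N\<close>.\<close>
  have "param_dom \<kappa> ?S ** (mat 1 + ?N ** ?Q) = mat 1 + ?N ** ?Q + (J ** ?S + J ** ?S ** ?Q ** ?N) ** ?Q"
    by (simp add: param_dom_def matrix_mult_linear matrix_mul_assoc algebra_simps)
  also have "\<dots> = mat 1" unfolding eq by (simp add: matrix_mult_linear)
  finally have inv: "param_dom \<kappa> ?S ** (mat 1 + ?N ** ?Q) = mat 1" .
  show dp: "det (param_dom \<kappa> ?S) \<noteq> 0" using matrix_inv_unique[OF inv] by blast
  have "param_dom \<kappa> ?S ** ?N = - (J ** ?S)"
    using eq by (simp add: param_dom_def matrix_mult_linear matrix_mul_assoc algebra_simps eq_neg_iff_add_eq_0)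
  then have "?N = matrix_inv (param_dom \<kappa> ?S) ** (- (J ** ?S))"
    by (metis matrix_inv_left[OF dp] matrix_mul_assoc matrix_mul_lid)
  then show "param \<kappa> ?S = M" by (simp add: param_def matrix_mult_minus_right algebra_simps)
qed

lemma det_J_nonzero: "det (J :: 'n::finite sqmat) \<noteq> 0"
  unfolding det_nz_iff_kernel using norm_J by (metis norm_eq_zero)

lemma param_Sp0_iff:
  fixes S :: "'n::finite sqmat"
  assumes S: "transpose S = S" and d: "det (param_dom \<kappa> S) \<noteq> 0"
  shows "param \<kappa> S \<in> Sp0 1 \<longleftrightarrow> det S = 0"
proof -
  have "det (param_dom \<kappa> S) * det (param \<kappa> S - mat 1) = det ((- J) ** S)"
    unfolding det_mul[symmetric] param_eq[OF d] by (simp add: matrix_mult_minus_left)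
  moreover have "det (- J :: 'n sqmat) \<noteq> 0"
    using det_J_nonzero by (metis det_transpose transpose_J)
  ultimately show ?thesis using d param_in_Sp[OF S d] by (auto simp: Sp0_1_iff det_mul)
qed

text \<open>For \<open>\<kappa> = - 1 / (2 t)\<close> one has
  \<open>2 t J ** chart_dom \<kappa> M = (M - I) + t J (M + I)\<close>, so the bad \<open>t\<close>
  are among the finitely many real zeros of the Cayley determinant of \<open>M\<close>.\<close>

lemma exists_chart:
  fixes M :: "'n::finite sqmat"
  assumes M: "M \<in> Sp"
  obtains \<kappa> where "det (chart_dom \<kappa> M) \<noteq> 0"
proof -
  have "infinite ({0<..<1} - {t. gdet (complex_of_real t) M = 0})"
    using finite_gdet_real_zeros[OF M] by (intro Diff_infinite_finite) (auto simp: infinite_Ioo)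
  then obtain t where "t \<in> {0<..<1} - {t. gdet (complex_of_real t) M = 0}" using infinite_imp_nonempty by blast
  then have t: "t > 0" "gdet (of_real t) M \<noteq> 0" by auto
  let ?\<kappa> = "- 1 / (2 * t)"
  have "pencil (cmat (M - mat 1)) (cmat (J ** (M + mat 1))) (of_real t) = cmat (M - mat 1 + t *\<^sub>R (J ** (M + mat 1)))"
    by (simp add: pencil_def vec_eq_iff)
  also have "M - mat 1 + t *\<^sub>R (J ** (M + mat 1)) = (2 * t) *\<^sub>R J ** chart_dom ?\<kappa> M"
  proof -
    have "J ** (M + mat 1) = 2 *\<^sub>R J + J ** (M - mat 1)" by (simp add: matrix_mult_linear scaleR_2)
    moreover have "(2 * t) *\<^sub>R J ** (mat 1 + chart_Q ?\<kappa> ** N) = N + t *\<^sub>R (J ** N) + (2 * t) *\<^sub>R J" for N :: "'n sqmat"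
      using t(1) by (simp add: chart_Q_def matrix_mult_linear scaleR_diff_right)
    ultimately show ?thesis unfolding chart_dom_def by (simp add: scaleR_add_right ac_simps)
  qed
  finally have "gdet (of_real t) M = of_real (det ((2 * t) *\<^sub>R J :: 'n sqmat) * det (chart_dom ?\<kappa> M))"
    unfolding gdet_def cay_def by (simp add: det_cmat det_mul)
  with t(2) have "det (chart_dom ?\<kappa> M) \<noteq> 0" by auto
  then show thesis using that by blast
qed

lemma continuous_on_chart_dom: "continuous_on T (chart_dom \<kappa>)"
  unfolding chart_dom_def by (intro continuous_intros)

lemma continuous_on_param_dom [continuous_intros]:
  "continuous_on T f \<Longrightarrow> continuous_on T (\<lambda>x. param_dom \<kappa> (f x))"
  unfolding param_dom_def by (intro continuous_intros)

lemma continuous_on_chart: "(\<And>M. M \<in> T \<Longrightarrow> det (chart_dom \<kappa> M) \<noteq> 0) \<Longrightarrow> continuous_on T (chart \<kappa>)"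
  unfolding chart_def by (intro continuous_intros continuous_on_matrix_inv continuous_on_chart_dom) auto

lemma continuous_on_param:
  "continuous_on T f \<Longrightarrow> (\<And>x. x \<in> T \<Longrightarrow> det (param_dom \<kappa> (f x)) \<noteq> 0) \<Longrightarrow> continuous_on T (\<lambda>x. param \<kappa> (f x))"
  unfolding param_def by (intro continuous_intros continuous_on_matrix_inv) auto

text \<open>Differentiate \<open>det D * det N = det (- J) * det S\<close> at a zero, with
  \<open>D\<close> the value of \<open>param_dom\<close>: only \<open>det D * ddet N V\<close>
  survives on the left. Nondegeneracy of the co-orientation then comes from
  \<open>ddet_J_nonzero\<close>.\<close>

lemma crossing_speed_param:
  fixes S :: "real \<Rightarrow> 'n::finite sqmat"
  assumes S: "(S has_vector_derivative S') (at t)" and sym: "transpose (S t) = S t"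
    and d: "det (param_dom \<kappa> (S t)) \<noteq> 0" and zero: "det (S t) = 0" and nz: "ddet (S t) S' \<noteq> 0"
  shows "\<exists>c. c \<noteq> 0 \<and> crossing_speed 1 (\<lambda>s. param \<kappa> (S s)) t c"
proof -
  let ?\<tau> = "\<lambda>s. param \<kappa> (S s)"
  let ?D = "\<lambda>s. param_dom \<kappa> (S s)"
  have Sd: "(S has_derivative (\<lambda>h. h *\<^sub>R S')) (at t)" using S by (simp add: has_vector_derivative_def)
  have bl: "bounded_linear (\<lambda>X. A ** X ** B)" for A B :: "'n sqmat"
    by (rule bounded_linear_matrix_map) (simp_all add: matrix_mult_linear)
  have Dd: "(?D has_derivative (\<lambda>h. J ** (h *\<^sub>R S') ** chart_Q \<kappa>)) (at t)"
    using has_derivative_add[OF has_derivative_const[of "mat 1"] bounded_linear.has_derivative[OF bl[of J "chart_Q \<kappa>"] Sd]]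
    by (simp add: param_dom_def)
  have prod: "(\<lambda>x. f x ** g x) differentiable (at t)"
    if fd: "f differentiable (at t)" and gd: "g differentiable (at t)" for f g :: "real \<Rightarrow> 'n sqmat"
  proof -
    obtain f' g' where f: "(f has_derivative f') (at t)" and g: "(g has_derivative g') (at t)"
      using fd gd unfolding differentiable_def by blast
    have c: "((\<lambda>x. f x $ i $ j) has_derivative (\<lambda>h. f' h $ i $ j)) (at t)" "((\<lambda>x. g x $ i $ j) has_derivative (\<lambda>h. g' h $ i $ j)) (at t)" for i j
      by (intro bounded_linear.has_derivative[OF bounded_linear_vec_nth] f g)+
    have "((\<lambda>x. f x ** g x) has_derivative (\<lambda>h. \<chi> i j. \<Sum>k\<in>UNIV. f t $ i $ k * g' h $ k $ j + f' h $ i $ k * g t $ k $ j)) (at t)"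
      unfolding matrix_matrix_mult_def by (rule has_derivative_matrix) (auto intro!: has_derivative_sum has_derivative_mult c)
    then show ?thesis by (auto simp: differentiable_def)
  qed
  have "(\<lambda>s. J ** S s ** mat 1) differentiable (at t)"
    using bounded_linear.has_derivative[OF bl[of J "mat 1"] Sd] by (auto simp: differentiable_def)
  then have "(\<lambda>s. J ** S s) differentiable (at t)" by (simp only: matrix_mul_rid)
  then have "(\<lambda>s. matrix_inv (?D s) ** (J ** S s)) differentiable (at t)"
    by (rule prod[OF differentiable_matrix_inv[OF Dd d]])
  then have "?\<tau> differentiable (at t)" unfolding param_def by (intro differentiable_diff) auto
  then obtain V where V: "(?\<tau> has_vector_derivative V) (at t)"
    unfolding vector_derivative_works by blast
  let ?N = "\<lambda>s. param \<kappa> (S s) - mat 1"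
  have Nd: "(?N has_derivative (\<lambda>h. h *\<^sub>R V)) (at t)"
    using has_derivative_diff[OF V[unfolded has_vector_derivative_def] has_derivative_const[of "mat 1"]] by simp
  have in0: "param \<kappa> (S t) \<in> Sp0 1" using param_Sp0_iff[OF sym d] zero by simp
  then have N0: "det (?N t) = 0" by (simp add: Sp0_1_iff)
  have 1: "((\<lambda>s. det (?D s) * det (?N s)) has_derivative
      (\<lambda>h. det (?D t) * ddet (?N t) (h *\<^sub>R V) + ddet (?D t) (J ** (h *\<^sub>R S') ** chart_Q \<kappa>) * det (?N t))) (at t)"
    by (rule has_derivative_mult[OF has_derivative_det[OF Dd] has_derivative_det[OF Nd]])
  note ev = eventually_det_nonzero[OF Dd d]
  have eq: "det (?D s) * det (?N s) = det (- J :: 'n sqmat) * det (S s)" if "det (?D s) \<noteq> 0" for s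
    using that unfolding det_mul[symmetric] by (simp add: param_eq matrix_mult_minus_left)
  have 2: "((\<lambda>s. det (- J :: 'n sqmat) * det (S s)) has_derivative
      (\<lambda>h. det (?D t) * ddet (?N t) (h *\<^sub>R V) + ddet (?D t) (J ** (h *\<^sub>R S') ** chart_Q \<kappa>) * det (?N t))) (at t)"
    by (rule has_derivative_transform_eventually[OF 1])
       (use ev eq d in \<open>auto simp: eventually_at_filter elim!: eventually_mono\<close>)
  have "((\<lambda>s. det (- J :: 'n sqmat) * det (S s)) has_derivative (\<lambda>h. det (- J :: 'n sqmat) * ddet (S t) (h *\<^sub>R S'))) (at t)"
    by (intro has_derivative_mult_right has_derivative_det Sd)
  from has_derivative_unique[OF this 2] have
    "det (- J :: 'n sqmat) * ddet (S t) (1 *\<^sub>R S') = det (?D t) * ddet (?N t) (1 *\<^sub>R V) + ddet (?D t) (J ** (1 *\<^sub>R S') ** chart_Q \<kappa>) * det (?N t)"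
    by metis
  moreover have "det (- J :: 'n sqmat) \<noteq> 0"
    using det_J_nonzero by (metis det_transpose transpose_J)
  ultimately have NV: "ddet (?N t) V \<noteq> 0" using nz N0 by auto
  have NJ: "ddet (?N t) J \<noteq> 0"
    using in0 NV by (intro ddet_J_nonzero) (auto simp: Sp0_1_iff)
  show ?thesis
    unfolding crossing_speed_1_iff[where \<tau> = ?\<tau> and t = t, OF in0]
    using V NV NJ by (intro exI[of _ "ddet (?N t) V / ddet (?N t) J"]) auto
qed

text \<open>In the chart the path becomes a curve of symmetric matrices in a ball. It is replaced by
  a ramp from \<open>S c\<close> along a generic direction near the identity, an interpolation near
  \<open>S0 + \<delta> I\<close> where nothing is singular, and a ramp back to \<open>S d\<close>.
  Crossings lie on the two ramps only, and convexity of the ball gives the homotopy.\<close>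

lemma local_transversalizable:
  fixes M :: "'n::finite sqmat"
  assumes M: "M \<in> Sp"
  obtains U where "open U" "M \<in> U"
    "\<And>\<rho> c d. c < d \<Longrightarrow> continuous_on {c..d} \<rho> \<Longrightarrow> \<rho> ` {c..d} \<subseteq> Sp \<inter> U \<Longrightarrow> \<rho> c \<notin> Sp0 1 \<Longrightarrow> \<rho> d \<notin> Sp0 1
       \<Longrightarrow> transversalizable \<rho> c d"
proof -
  obtain \<kappa> where \<kappa>: "det (chart_dom \<kappa> M) \<noteq> 0" using exists_chart[OF M] .
  define S0 where "S0 = chart \<kappa> M"
  have S0: "transpose S0 = S0" "det (param_dom \<kappa> S0) \<noteq> 0"
    using chart_inverse[OF M \<kappa>] by (simp_all add: S0_def)
  have "open ((\<lambda>S. det (param_dom \<kappa> S)) -` (- {0}))"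
    by (intro open_vimage continuous_intros)
  then obtain r where r: "r > 0" "ball S0 r \<subseteq> (\<lambda>S. det (param_dom \<kappa> S)) -` (- {0})"
    using S0(2) openE by blast
  have pd: "det (param_dom \<kappa> S) \<noteq> 0" if "S \<in> ball S0 r" for S using r(2) that by auto
  let ?k = "norm (mat 1 :: 'n sqmat) + 1"
  have k: "?k > 0" by (simp add: add_nonneg_pos)
  obtain \<delta> where \<delta>: "0 < \<delta>" "\<delta> < r / (2 * ?k)" "det (S0 + \<delta> *\<^sub>R mat 1) \<noteq> 0"
    using symmetric_shift_nonsingular[OF S0(1), of "r / (2 * ?k)"] r(1) k by auto
  have \<delta>k: "\<delta> * ?k < r / 2" using \<delta>(2) k by (simp add: pos_less_divide_eq algebra_simps)
  have "open ((\<lambda>S. det S) -` (- {0::real}))"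
    by (intro open_vimage continuous_intros)
  then obtain \<epsilon> where \<epsilon>: "\<epsilon> > 0" "ball (S0 + \<delta> *\<^sub>R mat 1) \<epsilon> \<subseteq> (\<lambda>S. det S) -` (- {0})"
    using \<delta>(3) openE by blast
  \<comment> \<open>Two requirements are balanced: \<open>\<eta> + \<delta> * ?k < r\<close> keeps
    the ramps in the chart, where \<open>?k\<close> bounds the norm of directions within distance
    \<open>1\<close> of the identity, and \<open>\<eta> + \<delta> * e \<le> \<epsilon>\<close>
    keeps the interpolation off the singular matrices.\<close>
  define \<eta> where "\<eta> = min (\<epsilon> / 2) (r / 2)"
  define e where "e = min 1 (\<epsilon> / (2 * \<delta>))"
  have \<eta>: "\<eta> > 0" "\<eta> \<le> \<epsilon> / 2" "\<eta> \<le> r / 2" using r \<epsilon> by (auto simp: \<eta>_def)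
  have e: "e > 0" "e \<le> 1" "\<delta> * e \<le> \<epsilon> / 2" using \<delta>(1) \<epsilon>(1) by (auto simp: e_def min_def field_simps)
  define D where "D = {M :: 'n sqmat. det (chart_dom \<kappa> M) \<noteq> 0}"
  define U where "U = D \<inter> chart \<kappa> -` ball S0 \<eta>"
  have "D = (\<lambda>M. det (chart_dom \<kappa> M)) -` (- {0})" by (auto simp: D_def)
  then have "open D"
    by (simp only:) (intro open_vimage continuous_on_det continuous_on_chart_dom continuous_intros)
  moreover have "continuous_on D (chart \<kappa>)" by (rule continuous_on_chart) (simp add: D_def)
  ultimately have oU: "open U" unfolding U_def by (intro continuous_open_preimage) auto
  have MU: "M \<in> U" using \<kappa> \<eta>(1) by (simp add: U_def D_def S0_def)
  show thesis
  proof (rule that[OF oU MU])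
    fix \<rho> :: "real \<Rightarrow> 'n sqmat" and c d assume cd: "c < d" and cont: "continuous_on {c..d} \<rho>" and SpU: "\<rho> ` {c..d} \<subseteq> Sp \<inter> U"
      and ends: "\<rho> c \<notin> Sp0 1" "\<rho> d \<notin> Sp0 1"
    define S where "S t = chart \<kappa> (\<rho> t)" for t
    have \<rho>: "\<rho> t \<in> Sp" "\<rho> t \<in> U" if "t \<in> {c..d}" for t using SpU that by auto
    have S: "transpose (S t) = S t" "param \<kappa> (S t) = \<rho> t" "dist S0 (S t) < \<eta>" if "t \<in> {c..d}" for t
      using chart_inverse[of "\<rho> t" \<kappa>] \<rho>[OF that] by (auto simp: S_def U_def D_def)
    have Sr: "S t \<in> ball S0 r" if "t \<in> {c..d}" for t using S(3)[OF that] \<eta>(3) r(1) by simp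
    have contS: "continuous_on {c..d} S"
      unfolding S_def using \<rho>(2) by (intro continuous_on_compose2[OF \<open>continuous_on D (chart \<kappa>)\<close> cont]) (auto simp: U_def)
    have Sc: "det (S c) \<noteq> 0" "det (S d) \<noteq> 0"
    proof -
      have mem: "c \<in> {c..d}" "d \<in> {c..d}" using cd by auto
      show "det (S c) \<noteq> 0" using ends(1) param_Sp0_iff[OF S(1)[OF mem(1)] pd[OF Sr[OF mem(1)]]] S(2)[OF mem(1)] by simp
      show "det (S d) \<noteq> 0" using ends(2) param_Sp0_iff[OF S(1)[OF mem(2)] pd[OF Sr[OF mem(2)]]] S(2)[OF mem(2)] by simp
    qed
    obtain A1 where A1: "transpose A1 = A1" "norm (A1 - mat 1) < e" "finite {u. det (S c + u *\<^sub>R A1) = 0}"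
      "\<And>u. det (S c + u *\<^sub>R A1) = 0 \<Longrightarrow> ddet (S c + u *\<^sub>R A1) A1 \<noteq> 0"
      using symmetric_simple_pencil[OF S(1) Sc(1) e(1)] cd by auto
    obtain A2 where A2: "transpose A2 = A2" "norm (A2 - mat 1) < e" "finite {u. det (S d + u *\<^sub>R A2) = 0}"
      "\<And>u. det (S d + u *\<^sub>R A2) = 0 \<Longrightarrow> ddet (S d + u *\<^sub>R A2) A2 \<noteq> 0"
      using symmetric_simple_pencil[OF S(1) Sc(2) e(1)] cd by auto
    define p q where "p = (2 * c + d) / 3" and "q = (c + 2 * d) / 3"
    have pq: "c < p" "p < q" "q < d" using cd by (auto simp: p_def q_def)
    \<comment> \<open>\<open>l1\<close> and \<open>l2\<close> are the heights of the two ramps,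
      saturating at \<delta>; \<open>m\<close> switches from the first to the second between
      \<open>p\<close> and \<open>q\<close>, where both are saturated.\<close>
    define l1 l2 m where "l1 t = \<delta> * min 1 ((t - c) / (p - c))" and "l2 t = \<delta> * min 1 ((d - t) / (d - q))"
      and "m t = max 0 (min 1 ((t - p) / (q - p)))" for t
    define S' where "S' t = (1 - m t) *\<^sub>R (S c + l1 t *\<^sub>R A1) + m t *\<^sub>R (S d + l2 t *\<^sub>R A2)" for t
    have m01: "0 \<le> m t" "m t \<le> 1" for t by (auto simp: m_def)
    have l: "0 \<le> l1 t" "l1 t \<le> \<delta>" "0 \<le> l2 t" "l2 t \<le> \<delta>" if "t \<in> {c..d}" for t
      using that pq \<delta>(1) by (auto simp: l1_def l2_def mult_le_cancel_left1 mult_le_cancel_left2 intro!: mult_nonneg_nonneg)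
    have near0: "X + u *\<^sub>R A \<in> ball S0 r" if "dist S0 X < \<eta>" "0 \<le> u" "u \<le> \<delta>" "norm (A - mat 1) < e" for X A :: "'n sqmat" and u
    proof -
      have "norm A \<le> norm (A - mat 1) + norm (mat 1 :: 'n sqmat)" by norm
      also have "\<dots> \<le> ?k" using that(4) e(2) by simp
      finally have "u * norm A \<le> \<delta> * ?k" using that(2,3) by (intro mult_mono) auto
      moreover have "dist S0 (X + u *\<^sub>R A) \<le> dist S0 X + norm (u *\<^sub>R A)"
        using dist_triangle[of S0 "X + u *\<^sub>R A" X] by (simp add: dist_norm)
      ultimately show ?thesis using that(1,2) \<delta>k \<eta>(3) by simp
    qed
    have near1: "X + \<delta> *\<^sub>R A \<in> ball (S0 + \<delta> *\<^sub>R mat 1) \<epsilon>" if "dist S0 X < \<eta>" "norm (A - mat 1) < e" for X A :: "'n sqmat"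
    proof -
      have "dist (S0 + \<delta> *\<^sub>R mat 1) (X + \<delta> *\<^sub>R A) = norm ((X - S0) + \<delta> *\<^sub>R (A - mat 1))"
        by (simp add: dist_norm norm_minus_commute algebra_simps)
      also have "\<dots> \<le> norm (X - S0) + \<delta> * norm (A - mat 1)" using norm_triangle_ineq[of "X - S0" "\<delta> *\<^sub>R (A - mat 1)"] \<delta>(1) by simp
      also have "\<delta> * norm (A - mat 1) \<le> \<delta> * e" using that(2) \<delta>(1) by (intro mult_left_mono) auto
      finally show ?thesis using that(1) \<eta>(2) e(3) by (simp add: dist_norm norm_minus_commute)
    qed
    have Sd: "dist S0 (S c) < \<eta>" "dist S0 (S d) < \<eta>" using S(3) cd by auto
    have S'r: "S' t \<in> ball S0 r" if "t \<in> {c..d}" for t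
      unfolding S'_def using m01[of t] l[OF that] Sd A1(2) A2(2)
      by (intro convexD[OF convex_ball] near0) auto
    have S'sym: "transpose (S' t) = S' t" for t
      using S(1)[of c] S(1)[of d] cd A1(1) A2(1) by (simp add: S'_def transpose_linear)
    have contS': "continuous_on T S'" for T
      unfolding S'_def l1_def l2_def m_def using pq by (intro continuous_intros) auto
    define H where "H x = (1 - fst x) *\<^sub>R S (snd x) + fst x *\<^sub>R S' (snd x)" for x :: "real \<times> real"
    have Hr: "H x \<in> ball S0 r" if "x \<in> {0..1} \<times> {c..d}" for x
      unfolding H_def using that by (intro convexD[OF convex_ball] Sr S'r) auto
    have Hsym: "transpose (H x) = H x" if "x \<in> {0..1} \<times> {c..d}" for x
      unfolding H_def using that S(1) S'sym by (auto simp: transpose_linear)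
    have contH: "continuous_on ({0..1} \<times> {c..d}) H"
      unfolding H_def
      by (intro continuous_intros continuous_on_compose2[OF contS] continuous_on_compose2[OF contS'[of UNIV]]) auto
    have m0: "m t = 0" if "t \<le> p" for t
    proof -
      have "(t - p) / (q - p) \<le> 0" using that pq by (intro divide_nonpos_pos) auto
      then show ?thesis by (simp add: m_def)
    qed
    have m1: "m t = 1" if "t \<ge> q" for t
    proof -
      have "1 \<le> (t - p) / (q - p)" using that pq by (simp add: le_divide_eq)
      then show ?thesis by (simp add: m_def)
    qed
    have l1_le: "l1 t = \<delta> / (p - c) * (t - c)" if "t \<le> p" for t
    proof -
      have "(t - c) / (p - c) \<le> 1" using that pq by (simp add: divide_le_eq)
      then show ?thesis by (simp add: l1_def)
    qed
    have l1_ge: "l1 t = \<delta>" if "t \<ge> p" for t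
    proof -
      have "1 \<le> (t - c) / (p - c)" using that pq by (simp add: le_divide_eq)
      then show ?thesis by (simp add: l1_def)
    qed
    have l2_ge: "l2 t = - \<delta> / (d - q) * (t - d)" if "t \<ge> q" for t
    proof -
      have "(d - t) / (d - q) \<le> 1" using that pq by (simp add: divide_le_eq)
      then have "l2 t = \<delta> * ((d - t) / (d - q))" by (simp add: l2_def)
      also have "\<dots> = - \<delta> / (d - q) * (t - d)" by (simp add: minus_divide_left[symmetric] algebra_simps diff_divide_distrib)
      finally show ?thesis .
    qed
    have l2_le: "l2 t = \<delta>" if "t \<le> q" for t
    proof -
      have "1 \<le> (d - t) / (d - q)" using that pq by (simp add: le_divide_eq)
      then show ?thesis by (simp add: l2_def)
    qed
    have S'c: "S' c = S c" "S' d = S d" using pq by (simp_all add: S'_def m0 m1 l1_le l2_ge)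
    define \<tau> where "\<tau> t = param \<kappa> (S' t)" for t
    have hom: "homotopic_rel_ends c d \<rho> \<tau>"
      unfolding homotopic_rel_ends_iff[OF less_imp_le[OF cd]]
    proof (rule exI[of _ "\<lambda>x. param \<kappa> (H x)"], intro conjI ballI)
      show "continuous_on ({0..1} \<times> {c..d}) (\<lambda>x. param \<kappa> (H x))"
        by (intro continuous_on_param contH pd Hr)
      show "(\<lambda>x. param \<kappa> (H x)) ` ({0..1} \<times> {c..d}) \<subseteq> Sp"
        using param_in_Sp[OF Hsym pd[OF Hr]] by blast
      show "param \<kappa> (H (0, t)) = \<rho> t" if "t \<in> {c..d}" for t using S(2)[OF that] by (simp add: H_def)
      show "param \<kappa> (H (1, t)) = \<tau> t" for t by (simp add: H_def \<tau>_def)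
      show "param \<kappa> (H (u, c)) = \<rho> c" "param \<kappa> (H (u, d)) = \<rho> d" for u
        using S(2)[of c] S(2)[of d] cd by (simp_all add: H_def S'c flip: scaleR_add_left)
    qed
    have zero_iff: "\<tau> t \<in> Sp0 1 \<longleftrightarrow> det (S' t) = 0" if "t \<in> {c..d}" for t
      unfolding \<tau>_def by (rule param_Sp0_iff[OF S'sym pd[OF S'r[OF that]]])
    define f1 f2 where "f1 t = \<delta> / (p - c) * (t - c)" and "f2 t = - \<delta> / (d - q) * (t - d)" for t
    have left: "S' t = S c + f1 t *\<^sub>R A1" if "t < p" for t
      using that by (simp add: S'_def m0 l1_le f1_def)
    have right: "S' t = S d + f2 t *\<^sub>R A2" if "t > q" for t
      using that by (simp add: S'_def m1 l2_ge f2_def)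
    have mid: "det (S' t) \<noteq> 0" if "p \<le> t" "t \<le> q" for t
    proof -
      have "l1 t = \<delta>" "l2 t = \<delta>" using that by (simp_all add: l1_ge l2_le)
      then have "S' t \<in> ball (S0 + \<delta> *\<^sub>R mat 1) \<epsilon>"
        unfolding S'_def using m01[of t] near1[OF Sd(1) A1(2)] near1[OF Sd(2) A2(2)]
        by (simp only:) (intro convexD[OF convex_ball], auto)
      then show ?thesis using \<epsilon>(2) by auto
    qed
    have d1: "(S' has_vector_derivative (\<delta> / (p - c)) *\<^sub>R A1) (at t)" if "t < p" for t
    proof (rule has_vector_derivative_transform_within_open[of "\<lambda>t. S c + f1 t *\<^sub>R A1" _ t "{..<p}"])
      show "((\<lambda>t. S c + f1 t *\<^sub>R A1) has_vector_derivative (\<delta> / (p - c)) *\<^sub>R A1) (at t)"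
        unfolding f1_def has_vector_derivative_def using pq by (auto intro!: derivative_eq_intros simp: ac_simps)
    qed (use that left in auto)
    have d2: "(S' has_vector_derivative (- \<delta> / (d - q)) *\<^sub>R A2) (at t)" if "t > q" for t
    proof (rule has_vector_derivative_transform_within_open[of "\<lambda>t. S d + f2 t *\<^sub>R A2" _ t "{q<..}"])
      show "((\<lambda>t. S d + f2 t *\<^sub>R A2) has_vector_derivative (- \<delta> / (d - q)) *\<^sub>R A2) (at t)"
        unfolding f2_def has_vector_derivative_def using pq by (auto intro!: derivative_eq_intros simp: ac_simps)
    qed (use that right in auto)
    have "transversal_path 1 \<tau> c d"
      unfolding transversal_path_def
    proof (intro conjI ballI impI)
      show "continuous_on {c..d} \<tau>" unfolding \<tau>_def by (intro continuous_on_param contS' pd S'r)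
      show "\<tau> ` {c..d} \<subseteq> Sp" unfolding \<tau>_def using param_in_Sp[OF S'sym pd[OF S'r]] by blast
      show "\<tau> c \<notin> Sp0 1" "\<tau> d \<notin> Sp0 1" using zero_iff[of c] zero_iff[of d] cd Sc by (simp_all add: S'c)
      have "{t \<in> {c..d}. \<tau> t \<in> Sp0 1} \<subseteq> f1 -` {u. det (S c + u *\<^sub>R A1) = 0} \<union> f2 -` {u. det (S d + u *\<^sub>R A2) = 0}"
      proof
        fix t assume "t \<in> {t \<in> {c..d}. \<tau> t \<in> Sp0 1}"
        then have "det (S' t) = 0" using zero_iff by auto
        moreover from this have "t < p \<or> t > q" using mid[of t] by linarith
        ultimately show "t \<in> f1 -` {u. det (S c + u *\<^sub>R A1) = 0} \<union> f2 -` {u. det (S d + u *\<^sub>R A2) = 0}"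
          using left[of t] right[of t] by auto
      qed
      moreover have "inj f1" "inj f2" using pq \<delta>(1) by (auto simp: f1_def f2_def inj_def)
      ultimately show "finite {t \<in> {c..d}. \<tau> t \<in> Sp0 1}"
        using A1(3) A2(3) by (meson finite_UnI finite_subset finite_vimageI)
      fix t assume t: "t \<in> {c..d}" "\<tau> t \<in> Sp0 1"
      then have z: "det (S' t) = 0" using zero_iff by auto
      then consider "t < p" | "t > q" using mid[of t] by linarith
      then show "\<exists>c. c \<noteq> 0 \<and> crossing_speed 1 \<tau> t c"
      proof cases
        case 1
        have "ddet (S' t) ((\<delta> / (p - c)) *\<^sub>R A1) \<noteq> 0"
          using A1(4)[of "f1 t"] z left[OF 1] pq \<delta>(1) by (subst ddet_scaleR) auto
        then show ?thesis
          unfolding \<tau>_def by (intro crossing_speed_param[OF d1[OF 1] S'sym pd[OF S'r[OF t(1)]] z])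
      next
        case 2
        have "ddet (S' t) ((- \<delta> / (d - q)) *\<^sub>R A2) \<noteq> 0"
          using A2(4)[of "f2 t"] z right[OF 2] pq \<delta>(1) by (subst ddet_scaleR) auto
        then show ?thesis
          unfolding \<tau>_def by (intro crossing_speed_param[OF d2[OF 2] S'sym pd[OF S'r[OF t(1)]] z])
      qed
    qed
    then show "transversalizable \<rho> c d" unfolding transversalizable_def using hom by blast
  qed
qed

text \<open>Rotating the path by a small generic angle in its interior moves all points of a given
  subdivision off \<open>Sp0 1\<close>.\<close>

lemma exists_transversal_representative:
  fixes \<sigma> :: "real \<Rightarrow> 'n::finite sqmat"
  assumes ab: "a < b" and cont: "continuous_on {a..b} \<sigma>" and Sp: "\<sigma> ` {a..b} \<subseteq> Sp"
    and ends: "\<sigma> a \<notin> Sp0 1" "\<sigma> b \<notin> Sp0 1"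
  shows "transversalizable \<sigma> a b"
proof -
  \<comment> \<open>The factor \<open>(t - a) * (b - t)\<close> switches the rotation off at the two
    ends, which therefore stay fixed.\<close>
  define F where "F x = exp_J (- (fst x * ((snd x - a) * (b - snd x)))) ** \<sigma> (snd x)" for x :: "real \<times> real"
  have contF: "continuous_on (UNIV \<times> {a..b}) F"
    unfolding F_def by (intro continuous_intros continuous_on_compose2[OF cont]) auto
  have FSp: "F (\<eta>, t) \<in> Sp" if "t \<in> {a..b}" for \<eta> t
    unfolding F_def using Sp that by (auto intro!: Sp_mult)
  have off: "\<forall>\<^sub>F \<eta> in at_right 0. F (\<eta>, t) \<notin> Sp0 1" if t: "t \<in> {a..b}" for t
  proof (cases "t = a \<or> t = b")
    case True
    then show ?thesis using ends by (auto simp: F_def)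
  next
    case False
    define k where "k = (t - a) * (b - t)"
    have k: "k > 0" using False t by (auto simp: k_def)
    have "filterlim (\<lambda>\<eta>. \<eta> * k) (at_right 0) (at_right 0)"
    proof (rule tendsto_imp_filterlim_at_right)
      show "((\<lambda>\<eta>. \<eta> * k) \<longlongrightarrow> 0) (at_right 0)" by (auto intro!: tendsto_eq_intros)
      show "\<forall>\<^sub>F \<eta> in at_right 0. 0 < \<eta> * k" using k eventually_at_right_less[of 0] by (auto elim: eventually_mono)
    qed
    moreover have "\<sigma> t \<in> Sp" using Sp t by auto
    ultimately have "\<forall>\<^sub>F \<eta> in at_right 0. exp_J (- (\<eta> * k)) ** \<sigma> t \<notin> Sp0 1"
      using eventually_compose_filterlim[OF eventually_rotated_not_Sp0] by blast
    then show ?thesis by (simp add: F_def k_def)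
  qed
  \<comment> \<open>Holding for all small \<eta> is preserved by joining two intervals, so bisection
    reaches all of \<open>{a..b}\<close> with a single \<eta>. The premises make degenerate and
    protruding intervals trivial.\<close>
  define P where "P c d \<longleftrightarrow> (a \<le> c \<longrightarrow> d \<le> b \<longrightarrow> c < d \<longrightarrow> (\<forall>\<^sub>F \<eta> in at_right 0. transversalizable (\<lambda>t. F (\<eta>, t)) c d))" for c d
  have "P a b"
  proof (rule Bolzano[OF less_imp_le[OF ab]])
    fix c m d assume P: "P c m" "P m d" "c \<le> m" "m \<le> d"
    show "P c d"
    proof (cases "c = m \<or> m = d")
      case True
      then show ?thesis using P by auto
    next
      case False
      show ?thesis unfolding P_def
      proof (intro impI)
        assume "a \<le> c" "d \<le> b"
        then have "\<forall>\<^sub>F \<eta> in at_right 0. transversalizable (\<lambda>t. F (\<eta>, t)) c m" "\<forall>\<^sub>F \<eta> in at_right 0. transversalizable (\<lambda>t. F (\<eta>, t)) m d"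
          using P False unfolding P_def by auto
        then show "\<forall>\<^sub>F \<eta> in at_right 0. transversalizable (\<lambda>t. F (\<eta>, t)) c d"
          by eventually_elim (use P transversalizable_join in blast)
      qed
    qed
  next
    fix x assume x: "a \<le> x" "x \<le> b"
    then have "\<sigma> x \<in> Sp" using Sp by auto
    then obtain U where U: "open U" "\<sigma> x \<in> U" "\<And>\<rho> c d. c < d \<Longrightarrow> continuous_on {c..d} \<rho> \<Longrightarrow> \<rho> ` {c..d} \<subseteq> Sp \<inter> U \<Longrightarrow> \<rho> c \<notin> Sp0 1 \<Longrightarrow> \<rho> d \<notin> Sp0 1
       \<Longrightarrow> transversalizable \<rho> c d" using local_transversalizable by blast
    obtain \<epsilon> where \<epsilon>: "\<epsilon> > 0" "ball (\<sigma> x) \<epsilon> \<subseteq> U" using U openE by blast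
    have "(0, x) \<in> UNIV \<times> {a..b}" using x by auto
    \<comment> \<open>Joint continuity at \<open>(0, x)\<close> serves both the small angle and the
      short interval.\<close>
    with contF \<epsilon>(1) obtain \<delta> where \<delta>: "\<delta> > 0" "\<And>y. y \<in> UNIV \<times> {a..b} \<Longrightarrow> dist y (0, x) < \<delta> \<Longrightarrow> dist (F y) (F (0, x)) < \<epsilon>"
      unfolding continuous_on_iff by blast
    show "\<exists>\<delta>>0. \<forall>c d. c \<le> x \<and> x \<le> d \<and> d - c < \<delta> \<longrightarrow> P c d"
    proof (intro exI[of _ "\<delta> / 2"] conjI allI impI)
      fix c d assume cd: "c \<le> x \<and> x \<le> d \<and> d - c < \<delta> / 2"
      show "P c d" unfolding P_def
      proof (intro impI)
        assume cd': "a \<le> c" "d \<le> b" "c < d"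
        have ev: "\<forall>\<^sub>F \<eta> in at_right 0. 0 < \<eta> \<and> \<eta> < \<delta> / 2"
          using eventually_at_right_less[of 0] \<delta>(1) eventually_at_right[of 0 "\<delta> / 2"] by (auto simp: eventually_at_right_field intro!: exI[of _ "\<delta> / 2"])
        have "\<forall>\<^sub>F \<eta> in at_right 0. F (\<eta>, c) \<notin> Sp0 1" "\<forall>\<^sub>F \<eta> in at_right 0. F (\<eta>, d) \<notin> Sp0 1"
          using cd' by (auto intro!: off)
        with ev show "\<forall>\<^sub>F \<eta> in at_right 0. transversalizable (\<lambda>t. F (\<eta>, t)) c d"
        proof eventually_elim
          case (elim \<eta>)
          show ?case
          proof (rule U(3)[OF cd'(3) _ _ elim(2,3)])
            show "continuous_on {c..d} (\<lambda>t. F (\<eta>, t))"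
              using cd' by (intro continuous_on_compose2[OF contF] continuous_intros) auto
            show "(\<lambda>t. F (\<eta>, t)) ` {c..d} \<subseteq> Sp \<inter> U"
            proof (rule image_subsetI)
              fix t assume t: "t \<in> {c..d}"
              have "dist (\<eta>, t) (0, x) \<le> \<bar>\<eta>\<bar> + \<bar>t - x\<bar>" using norm_Pair_le[of \<eta> "t - x"] by (simp add: dist_norm)
              also have "\<dots> < \<delta>" using elim(1) t cd by auto
              finally have "dist (F (\<eta>, t)) (F (0, x)) < \<epsilon>" using \<delta>(2) t cd' by auto
              then have "F (\<eta>, t) \<in> ball (\<sigma> x) \<epsilon>" by (simp add: F_def dist_commute)
              then show "F (\<eta>, t) \<in> Sp \<inter> U" using FSp[of t] t cd' \<epsilon>(2) by auto
            qed
          qed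
        qed
      qed
    qed (use \<delta> in auto)
  qed
  then have "\<forall>\<^sub>F \<eta> in at_right 0. transversalizable (\<lambda>t. F (\<eta>, t)) a b" using ab by (simp add: P_def)
  then obtain \<eta> where "transversalizable (\<lambda>t. F (\<eta>, t)) a b"
    using eventually_happens trivial_limit_at_right_real by blast
  moreover have Fe: "F (\<eta>, a) = \<sigma> a" "F (\<eta>, b) = \<sigma> b" for \<eta> by (simp_all add: F_def)
  ultimately obtain \<tau> where \<tau>: "homotopic_with_canon (\<lambda>\<rho>. \<rho> a = \<sigma> a \<and> \<rho> b = \<sigma> b) {a..b} Sp (\<lambda>t. F (\<eta>, t)) \<tau>" "transversal_path 1 \<tau> a b"
    unfolding transversalizable_def by auto
  have "homotopic_rel_ends a b \<sigma> (\<lambda>t. F (\<eta>, t))"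
    unfolding homotopic_rel_ends_iff[OF less_imp_le[OF ab]]
  proof (rule exI[of _ "\<lambda>x. F (fst x * \<eta>, snd x)"], intro conjI ballI)
    show "continuous_on ({0..1} \<times> {a..b}) (\<lambda>x. F (fst x * \<eta>, snd x))"
      by (intro continuous_on_compose2[OF contF] continuous_intros) auto
    show "(\<lambda>x. F (fst x * \<eta>, snd x)) ` ({0..1} \<times> {a..b}) \<subseteq> Sp" using FSp by auto
  qed (auto simp: Fe F_def)
  then have "homotopic_rel_ends a b \<sigma> \<tau>"
    using \<tau>(1) homotopic_with_trans by blast
  then show ?thesis unfolding transversalizable_def using \<tau>(2) by blast
qed

text \<open>\<open>maslov_arg\<close> is invariant under the homotopy and equals each crossing
  count, so all representatives agree; with the existence of one, the description denotes.\<close>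

lemma intersection_number_eq_maslov_arg:
  fixes \<sigma> :: "real \<Rightarrow> 'n::finite sqmat"
  assumes ab: "a < b" and cont: "continuous_on {a..b} \<sigma>" and Sp: "\<sigma> ` {a..b} \<subseteq> Sp"
    and ends: "\<sigma> a \<notin> Sp0 1" "\<sigma> b \<notin> Sp0 1"
  shows "real_of_int (intersection_number 1 \<sigma> a b) = maslov_arg \<sigma> a b"
proof -
  let ?R = "\<lambda>\<tau>. homotopic_rel_ends a b \<sigma> \<tau> \<and> transversal_path 1 \<tau> a b"
  have count: "real_of_int (crossing_count 1 \<tau> a b) = maslov_arg \<sigma> a b" if \<tau>: "?R \<tau>" for \<tau>
  proof -
    obtain h where h: "continuous_on ({0..1} \<times> {a..b}) h" "h ` ({0..1} \<times> {a..b}) \<subseteq> Sp"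
      "\<And>t. t \<in> {a..b} \<Longrightarrow> h (0, t) = \<sigma> t" "\<And>t. t \<in> {a..b} \<Longrightarrow> h (1, t) = \<tau> t"
      "\<And>u. u \<in> {0..1::real} \<Longrightarrow> h (u, a) = \<sigma> a" "\<And>u. u \<in> {0..1::real} \<Longrightarrow> h (u, b) = \<sigma> b"
      using \<tau> unfolding homotopic_rel_ends_iff[OF less_imp_le[OF ab]] by metis
    have cong: "maslov_arg f a b = maslov_arg g a b" if "\<And>t. t \<in> {a..b} \<Longrightarrow> f t = g t" for f g :: "real \<Rightarrow> 'n sqmat"
    proof -
      have "darg (\<lambda>t. gdet (- \<i>) (f t)) a b = darg (\<lambda>t. gdet (- \<i>) (g t)) a b"
        using ab that by (intro darg_cong) auto
      then show ?thesis using that ab by (simp add: maslov_arg_def)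
    qed
    have "maslov_arg (\<lambda>t. h (0, t)) a b = maslov_arg (\<lambda>t. h (1, t)) a b"
      using ends h(5,6) by (intro maslov_arg_homotopy[OF less_imp_le[OF ab] h(1,2)]) auto
    moreover have "maslov_arg (\<lambda>t. h (0, t)) a b = maslov_arg \<sigma> a b" by (rule cong[OF h(3)])
    moreover have "maslov_arg (\<lambda>t. h (1, t)) a b = maslov_arg \<tau> a b" by (rule cong[OF h(4)])
    ultimately show ?thesis using maslov_arg_eq_crossing_count[OF less_imp_le[OF ab]] \<tau> by metis
  qed
  obtain \<tau> where \<tau>: "?R \<tau>" using exists_transversal_representative[OF assms] unfolding transversalizable_def by blast
  have "intersection_number 1 \<sigma> a b = crossing_count 1 \<tau> a b"
    unfolding intersection_number_def
  proof (rule the_equality)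
    show "\<exists>\<tau>'. homotopic_rel_ends a b \<sigma> \<tau>' \<and>
                 transversal_path 1 \<tau>' a b \<and> crossing_count 1 \<tau> a b = crossing_count 1 \<tau>' a b"
      using \<tau> by blast
    fix k assume "\<exists>\<tau>'. homotopic_rel_ends a b \<sigma> \<tau>' \<and>
                 transversal_path 1 \<tau>' a b \<and> k = crossing_count 1 \<tau>' a b"
    then obtain \<tau>' where \<tau>': "?R \<tau>'" and k: "k = crossing_count 1 \<tau>' a b" by blast
    show "k = crossing_count 1 \<tau> a b" using count[OF \<tau>'] count[OF \<tau>] k by linarith
  qed
  then show ?thesis using count[OF \<tau>] by simp
qed

subsection \<open>Linear Hamiltonian systems\<close>

lemma antiderivative_from_0:
  fixes f :: "real \<Rightarrow> 'a::euclidean_space"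
  assumes "continuous_on UNIV f"
  shows "\<exists>F. F 0 = 0 \<and> (\<forall>t. (F has_vector_derivative f t) (at t))"
proof -
  have "isCont f x" for x using assms by (simp add: continuous_on_eq_continuous_at)
  then obtain F where F: "\<And>t. (F has_vector_derivative f t) (at t)"
    using einterval_antiderivative[of "-\<infinity>" "\<infinity>" f] by auto
  have "((\<lambda>t. F t - F 0) has_vector_derivative f t) (at t)" for t
    using has_vector_derivative_diff[OF F[of t] has_vector_derivative_const[of "F 0"]] by simp
  then show ?thesis by (intro exI[of _ "\<lambda>t. F t - F 0"]) auto
qed

text \<open>One Picard step. Negative times are reduced to positive ones by reflecting
  \<open>F\<close>.\<close>

lemma norm_le_of_derivative_power:
  fixes F :: "real \<Rightarrow> 'a::real_normed_vector"
  assumes F0: "F 0 = 0" and F: "\<And>t. (F has_vector_derivative f t) (at t)"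
    and f: "\<And>t. norm (f t) \<le> c * (C * ((C * \<bar>t\<bar>) ^ n / fact n))"
  shows "norm (F t) \<le> c * ((C * \<bar>t\<bar>) ^ Suc n / fact (Suc n))"
proof -
  have pos: "norm (G t) \<le> c * ((C * t) ^ Suc n / fact (Suc n))"
    if G0: "G 0 = 0" and G: "\<And>t. (G has_vector_derivative g t) (at t)"
      and g: "\<And>t. norm (g t) \<le> c * (C * ((C * \<bar>t\<bar>) ^ n / fact n))" and t: "t > 0" for G :: "real \<Rightarrow> 'a" and g t
  proof -
    let ?\<phi> = "\<lambda>t. c * ((C * t) ^ Suc n / fact (Suc n))"
    have "norm (G t - G 0) \<le> ?\<phi> t - ?\<phi> 0"
    proof (rule differentiable_bound_general[OF t, where f' = g and \<phi>' = "\<lambda>t. c * (C * ((C * t) ^ n / fact n))"])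
      show "continuous_on {0..t} G"
        using G by (intro continuous_at_imp_continuous_on ballI has_vector_derivative_continuous) auto
      show "(?\<phi> has_vector_derivative c * (C * ((C * x) ^ n / fact n))) (at x)" for x
        unfolding has_real_derivative_iff_has_vector_derivative[symmetric]
        by (rule derivative_eq_intros refl | simp)+
      show "norm (g x) \<le> c * (C * ((C * x) ^ n / fact n))" if "0 < x" for x using g[of x] that by simp
    qed (auto intro!: continuous_intros G)
    then show ?thesis by (simp add: G0)
  qed
  consider "t > 0" | "t = 0" | "t < 0" by linarith
  then show ?thesis
  proof cases
    case 1
    then show ?thesis using pos[OF F0 F f 1] by simp
  next
    case 2
    then show ?thesis by (simp add: F0)
  next
    case 3
    have "((\<lambda>t. F (- t)) has_vector_derivative - f (- t)) (at t)" for t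
      using vector_diff_chain_at[of uminus "-1" t F "f (- t)"] F[of "- t"]
      by (simp add: o_def has_vector_derivative_minus[of "\<lambda>x. x" 1, simplified] has_vector_derivative_id)
    moreover have "norm (- f (- t)) \<le> c * (C * ((C * \<bar>t\<bar>) ^ n / fact n))" for t using f[of "- t"] by simp
    ultimately have "norm (F (- (- t))) \<le> c * ((C * (- t)) ^ Suc n / fact (Suc n))"
      using pos[of "\<lambda>t. F (- t)" "\<lambda>t. - f (- t)" "- t"] 3 F0 by simp
    then show ?thesis using 3 by simp
  qed
qed

text \<open>The Peano-Baker series: the summands \<open>X n\<close> are iterated integrals dominated
  by the exponential series, so the solution is global. Dropping the constant summand gives the last
  bound, which depends on \<open>L\<close> through \<open>C\<close> alone and so holds uniformly for
  all shifts.\<close>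

lemma linear_ode_solution:
  fixes L :: "real \<Rightarrow> 'a::euclidean_space \<Rightarrow> 'a"
  assumes lin: "\<And>t. linear (L t)" and bound: "\<And>t x. norm (L t x) \<le> C * norm x" and C: "C \<ge> 0"
    and cont: "\<And>x. continuous_on UNIV x \<Longrightarrow> continuous_on UNIV (\<lambda>t. L t (x t))"
  obtains x where "x 0 = x0" "\<And>t. (x has_vector_derivative L t (x t)) (at t)"
    "\<And>t. norm (x t - x0) \<le> norm x0 * (exp (C * \<bar>t\<bar>) - 1)"
proof -
  define anti where "anti f = (SOME F. F 0 = 0 \<and> (\<forall>t. (F has_vector_derivative f t) (at t)))" for f :: "real \<Rightarrow> 'a"
  have anti: "anti f 0 = 0" "(anti f has_vector_derivative f t) (at t)" if "continuous_on UNIV f" for f t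
    using someI_ex[OF antiderivative_from_0[OF that]] unfolding anti_def by blast+
  define X where "X = rec_nat (\<lambda>t. x0) (\<lambda>n Xn. anti (\<lambda>t. L t (Xn t)))"
  have X0: "X 0 = (\<lambda>t. x0)" and XS: "X (Suc n) = anti (\<lambda>t. L t (X n t))" for n by (simp_all add: X_def)
  have contX: "continuous_on UNIV (X n)" for n
  proof (induction n)
    case (Suc n)
    have "isCont (X (Suc n)) t" for t
      unfolding XS using anti(2)[OF cont[OF Suc]] by (rule has_vector_derivative_continuous)
    then show ?case by (simp add: continuous_on_eq_continuous_at)
  qed (simp add: X0)
  have XS0: "X (Suc n) 0 = 0" and dX: "(X (Suc n) has_vector_derivative L t (X n t)) (at t)" for n t
    unfolding XS using anti[OF cont[OF contX]] by auto
  have bX: "norm (X n t) \<le> norm x0 * ((C * \<bar>t\<bar>) ^ n / fact n)" for n t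
  proof (induction n arbitrary: t)
    case (Suc n)
    show ?case
    proof (rule norm_le_of_derivative_power[OF XS0 dX])
      fix t
      have "norm (L t (X n t)) \<le> C * norm (X n t)" by (rule bound)
      also have "\<dots> \<le> C * (norm x0 * ((C * \<bar>t\<bar>) ^ n / fact n))" by (intro mult_left_mono Suc C)
      finally show "norm (L t (X n t)) \<le> norm x0 * (C * ((C * \<bar>t\<bar>) ^ n / fact n))" by (simp only: ac_simps)
    qed
  qed (simp add: X0)
  have sumE: "summable (\<lambda>n. norm x0 * ((C * r) ^ n / fact n))" for r :: real
    using summable_mult[OF summable_exp_generic[of "C * r"], of "norm x0"] by (simp add: divide_inverse ac_simps)
  have sumX: "summable (\<lambda>n. X n t)" for t
    by (rule summable_comparison_test'[OF sumE, of 0]) (use bX in auto)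
  define x where "x t = (\<Sum>n. X n t)" for t
  have dx: "(x has_vector_derivative L t (x t)) (at t)" for t
  proof -
    define R where "R = \<bar>t\<bar> + 1"
    let ?S = "{-R<..<R}"
    have tS: "t \<in> ?S" by (auto simp: R_def)
    have ul: "uniform_limit ?S (\<lambda>n x. \<Sum>i<n. X i x) x sequentially"
      unfolding x_def
    proof (rule Weierstrass_m_test[OF _ sumE[of R]])
      fix n s assume "s \<in> ?S"
      then have "(C * \<bar>s\<bar>) ^ n \<le> (C * R) ^ n" using C by (intro power_mono mult_left_mono) auto
      then have "norm x0 * ((C * \<bar>s\<bar>) ^ n / fact n) \<le> norm x0 * ((C * R) ^ n / fact n)"
        by (intro mult_left_mono divide_right_mono) auto
      then show "norm (X n s) \<le> norm x0 * ((C * R) ^ n / fact n)" using bX[of n s] by linarith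
    qed
    \<comment> \<open>The derivative of a summand involves the previous one, so \<open>Suc n\<close>
      derivatives add up to \<open>L\<close> of \<open>n\<close> summands.\<close>
    define X' where "X' n s = (case n of 0 \<Rightarrow> 0 | Suc m \<Rightarrow> L s (X m s))" for n s
    have sumX': "(\<Sum>i<Suc n. X' i s) = L s (\<Sum>i<n. X i s)" for n s
      unfolding sum.lessThan_Suc_shift by (simp add: X'_def linear_sum[OF lin])
    have "\<exists>g. \<forall>s\<in>?S. (\<lambda>n. X n s) sums g s \<and> (g has_derivative (\<lambda>h. h *\<^sub>R L s (x s))) (at s within ?S)"
    proof (rule has_derivative_series[where f' = "\<lambda>n s h. h *\<^sub>R X' n s" and x = t])
      show "(X n has_derivative (\<lambda>h. h *\<^sub>R X' n s)) (at s within ?S)" for n s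
      proof (cases n)
        case 0
        then show ?thesis by (simp add: X0 X'_def)
      next
        case (Suc m)
        then show ?thesis using dX[of m s] by (auto simp: X'_def has_vector_derivative_def intro: has_derivative_at_withinI)
      qed
      show "(\<lambda>n. X n t) sums x t" unfolding x_def using sumX by (rule summable_sums)
      fix e :: real assume "e > 0"
      \<comment> \<open>The shift by \<open>1\<close> covers \<open>C = 0\<close>.\<close>
      then have "e / (C + 1) > 0" using C by simp
      from uniform_limitD[OF ul this] obtain N where N: "\<And>n s. n \<ge> N \<Longrightarrow> s \<in> ?S \<Longrightarrow> dist (\<Sum>i<n. X i s) (x s) < e / (C + 1)"
        unfolding eventually_sequentially by blast
      show "\<forall>\<^sub>F n in sequentially. \<forall>s\<in>?S. \<forall>h. norm ((\<Sum>i<n. h *\<^sub>R X' i s) - h *\<^sub>R L s (x s)) \<le> e * norm h"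
        unfolding eventually_sequentially
      proof (intro exI[of _ "Suc N"] allI impI ballI)
        fix n s h assume n: "Suc N \<le> n" and s: "s \<in> ?S"
        then obtain m where m: "n = Suc m" "m \<ge> N" by (metis Suc_le_D Suc_le_mono)
        have "(\<Sum>i<n. h *\<^sub>R X' i s) - h *\<^sub>R L s (x s) = h *\<^sub>R L s ((\<Sum>i<m. X i s) - x s)"
          unfolding scaleR_sum_right[symmetric] m(1) sumX' by (simp add: linear_diff[OF lin] scaleR_diff_right)
        then have "norm ((\<Sum>i<n. h *\<^sub>R X' i s) - h *\<^sub>R L s (x s)) = \<bar>h\<bar> * norm (L s ((\<Sum>i<m. X i s) - x s))" by simp
        also have "\<dots> \<le> \<bar>h\<bar> * (C * norm ((\<Sum>i<m. X i s) - x s))" by (intro mult_left_mono bound) auto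
        also have "\<dots> \<le> \<bar>h\<bar> * (C * (e / (C + 1)))"
          using N[OF m(2) s] C by (intro mult_left_mono) (auto simp: dist_norm)
        also have "\<dots> \<le> \<bar>h\<bar> * e"
        proof (rule mult_left_mono)
          show "C * (e / (C + 1)) \<le> e" using C \<open>e > 0\<close> by (simp add: field_simps)
        qed simp
        finally show "norm ((\<Sum>i<n. h *\<^sub>R X' i s) - h *\<^sub>R L s (x s)) \<le> e * norm h"
          by (simp add: mult.commute)
      qed
    qed (use tS in auto)
    then obtain g where g: "\<And>s. s \<in> ?S \<Longrightarrow> (\<lambda>n. X n s) sums g s" "\<And>s. s \<in> ?S \<Longrightarrow> (g has_derivative (\<lambda>h. h *\<^sub>R L s (x s))) (at s within ?S)"
      by blast
    have gx: "g s = x s" if "s \<in> ?S" for s using g(1)[OF that] unfolding x_def by (simp add: sums_iff)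
    have "(g has_derivative (\<lambda>h. h *\<^sub>R L t (x t))) (at t)"
      using g(2)[OF tS] at_within_open[OF tS open_greaterThanLessThan] by simp
    then have "(x has_derivative (\<lambda>h. h *\<^sub>R L t (x t))) (at t)"
      by (rule has_derivative_transform_within_open[OF _ open_greaterThanLessThan tS gx])
    then show ?thesis by (simp add: has_vector_derivative_def)
  qed
  have x_eq: "x t = x0 + (\<Sum>n. X (Suc n) t)" for t
    unfolding x_def using suminf_split_head[OF sumX, of t] by (simp add: X0)
  have "norm (x t - x0) \<le> norm x0 * (exp (C * \<bar>t\<bar>) - 1)" for t
  proof -
    have s: "summable (\<lambda>n. norm x0 * ((C * \<bar>t\<bar>) ^ Suc n / fact (Suc n)))"
      using sumE[of "\<bar>t\<bar>"] by (subst summable_Suc_iff)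
    have "norm (\<Sum>n. X (Suc n) t) \<le> (\<Sum>n. norm x0 * ((C * \<bar>t\<bar>) ^ Suc n / fact (Suc n)))"
      by (rule norm_suminf_le[OF bX s])
    also have "\<dots> = norm x0 * (\<Sum>n. (C * \<bar>t\<bar>) ^ Suc n / fact (Suc n))"
    proof (rule suminf_mult)
      show "summable (\<lambda>n. (C * \<bar>t\<bar>) ^ Suc n / fact (Suc n))"
        using summable_exp_generic[of "C * \<bar>t\<bar>"] by (subst summable_Suc_iff) (simp add: divide_inverse ac_simps)
    qed
    also have "(\<Sum>n. (C * \<bar>t\<bar>) ^ Suc n / fact (Suc n)) = exp (C * \<bar>t\<bar>) - 1"
      using exp_first_term[of "C * \<bar>t\<bar>"] by (simp add: divide_inverse ac_simps)
    finally show ?thesis by (simp add: x_eq)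
  qed
  moreover have "x 0 = x0" unfolding x_eq by (simp add: XS0)
  ultimately show thesis using that dx by blast
qed

text \<open>The norm of a matrix is Euclidean in its entries while \<open>E\<close> bounds operator
  norms; column by column the operator bound carries over without a dimension factor.\<close>

lemma norm_matrix_mult_le:
  fixes A :: "real^'n^'m" and X :: "real^'k^'n"
  assumes A: "\<And>v. norm (A *v v) \<le> c * norm v" and c: "c \<ge> 0"
  shows "norm (A ** X) \<le> c * norm X"
proof -
  have cols: "(norm Y)\<^sup>2 = (\<Sum>j\<in>UNIV. (norm (\<chi> i. Y $ i $ j))\<^sup>2)" for Y :: "real^'k^'l"
  proof -
    have "(norm Y)\<^sup>2 = (\<Sum>i\<in>UNIV. \<Sum>j\<in>UNIV. (Y $ i $ j)\<^sup>2)"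
      by (simp add: norm_vec_def L2_set_def sum_nonneg)
    also have "\<dots> = (\<Sum>j\<in>UNIV. \<Sum>i\<in>UNIV. (Y $ i $ j)\<^sup>2)" by (rule sum.swap)
    finally show ?thesis by (simp add: norm_vec_def L2_set_def sum_nonneg)
  qed
  have "(norm (A ** X))\<^sup>2 = (\<Sum>j\<in>UNIV. (norm (A *v (\<chi> i. X $ i $ j)))\<^sup>2)"
    unfolding cols by (simp add: matrix_matrix_mult_def matrix_vector_mult_def)
  also have "\<dots> \<le> (\<Sum>j\<in>UNIV. (c * norm (\<chi> i. X $ i $ j))\<^sup>2)"
    by (intro sum_mono power_mono A) auto
  also have "\<dots> = (c * norm X)\<^sup>2" by (simp add: power_mult_distrib cols[of X] sum_distrib_left)
  finally show ?thesis using c by (meson mult_nonneg_nonneg norm_ge_zero power2_le_imp_le)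
qed

lemma bounded_bilinear_matrix_mult:
  "bounded_bilinear ((**) :: real^'n^'m \<Rightarrow> real^'k^'n \<Rightarrow> real^'k^'m)"
  unfolding bilinear_conv_bounded_bilinear[symmetric] bilinear_def
  by (auto intro!: linearI simp: matrix_mult_linear)

lemma has_vector_derivative_matrix_mult:
  fixes f :: "real \<Rightarrow> real^'n^'m" and g :: "real \<Rightarrow> real^'k^'n"
  assumes "(f has_vector_derivative f') (at t)" "(g has_vector_derivative g') (at t)"
  shows "((\<lambda>t. f t ** g t) has_vector_derivative (f t ** g' + f' ** g t)) (at t)"
  by (rule bounded_bilinear.has_vector_derivative[OF bounded_bilinear_matrix_mult assms])

lemma has_vector_derivative_transpose:
  fixes f :: "real \<Rightarrow> real^'n^'m"
  assumes "(f has_vector_derivative f') (at t)"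
  shows "((\<lambda>t. transpose (f t)) has_vector_derivative transpose f') (at t)"
  by (rule bounded_linear.has_vector_derivative[OF bounded_linear_matrix_map assms]) (simp_all add: transpose_linear)

text \<open>By symmetry of \<open>B\<close> the derivative of the pairing is zero. Equal solutions
  give symplecticity, two different ones give uniqueness of the flow.\<close>

lemma hamiltonian_flow_pairing:
  fixes \<gamma>1 \<gamma>2 B :: "real \<Rightarrow> 'n::finite sqmat"
  assumes B: "\<And>t. transpose (B t) = B t"
    and 1: "\<gamma>1 0 = mat 1" "\<And>t. (\<gamma>1 has_vector_derivative J ** B t ** \<gamma>1 t) (at t)"
    and 2: "\<gamma>2 0 = mat 1" "\<And>t. (\<gamma>2 has_vector_derivative J ** B t ** \<gamma>2 t) (at t)"
  shows "transpose (\<gamma>1 t) ** J ** \<gamma>2 t = J"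
proof -
  have "((\<lambda>t. transpose (\<gamma>1 t) ** (J ** \<gamma>2 t)) has_vector_derivative 0) (at t)" for t
  proof -
    have "((\<lambda>t. transpose (\<gamma>1 t) ** (J ** \<gamma>2 t)) has_vector_derivative
       transpose (\<gamma>1 t) ** (J ** (J ** B t ** \<gamma>2 t) + 0 ** \<gamma>2 t) + transpose (J ** B t ** \<gamma>1 t) ** (J ** \<gamma>2 t)) (at t)"
      by (intro has_vector_derivative_matrix_mult has_vector_derivative_transpose 1 2 has_vector_derivative_const)
    also have "transpose (\<gamma>1 t) ** (J ** (J ** B t ** \<gamma>2 t) + 0 ** \<gamma>2 t) + transpose (J ** B t ** \<gamma>1 t) ** (J ** \<gamma>2 t) = 0"
    proof -
      have "0 ** \<gamma>2 t = (0 :: 'n sqmat)" by (simp add: matrix_matrix_mult_def vec_eq_iff)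
      moreover have "J ** (J ** B t ** \<gamma>2 t) = - (B t ** \<gamma>2 t)" by (simp add: matrix_mul_assoc[symmetric])
      moreover have "transpose (J ** B t ** \<gamma>1 t) ** (J ** \<gamma>2 t) = transpose (\<gamma>1 t) ** (B t ** \<gamma>2 t)"
        by (simp add: matrix_transpose_mul B matrix_mul_assoc[symmetric] matrix_mult_minus_left matrix_mult_minus_right)
      ultimately show ?thesis by (simp add: matrix_mult_minus_right)
    qed
    finally show ?thesis .
  qed
  then obtain c where c: "\<And>t. transpose (\<gamma>1 t) ** (J ** \<gamma>2 t) = c"
    using has_vector_derivative_zero_constant[of UNIV "\<lambda>t. transpose (\<gamma>1 t) ** (J ** \<gamma>2 t)"] by auto
  have "c = J" using c[of 0] by (simp add: 1 2 transpose_mat)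
  then show ?thesis using c[of t] by (simp add: matrix_mul_assoc)
qed

lemma E_D:
  fixes B :: "real \<Rightarrow> 'n::finite sqmat"
  assumes "B \<in> E K"
  shows "continuous_on UNIV B" "transpose (B t) = B t" "norm (B t *v x) \<le> K * norm x" "0 \<le> K"
proof -
  show "continuous_on UNIV B" "transpose (B t) = B t" using assms by (auto simp: E_def)
  have "ereal (onorm ((*v) (B t))) \<le> (SUP t. ereal (onorm ((*v) (B t))))" by (rule SUP_upper) simp
  also have "\<dots> \<le> ereal K" using assms by (simp add: E_def)
  finally have "ereal (onorm ((*v) (B t))) \<le> ereal K" .
  then have K: "onorm ((*v) (B t)) \<le> K" by simp
  have "norm (B t *v x) \<le> onorm ((*v) (B t)) * norm x" by (intro onorm) auto
  also have "\<dots> \<le> K * norm x" using K by (intro mult_right_mono) auto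
  finally show "norm (B t *v x) \<le> K * norm x" .
  have "0 \<le> onorm ((*v) (B t))" by (intro onorm_pos_le) auto
  with K show "0 \<le> K" by linarith
qed

lemma E_shift:
  assumes "B \<in> E K" shows "(\<lambda>t. B (s + t)) \<in> E K"
proof -
  have "continuous_on UNIV (\<lambda>t. B (s + t))"
    by (rule continuous_on_compose2[OF E_D(1)[OF assms]]) (auto intro!: continuous_intros)
  moreover have "(SUP t. ereal (onorm ((*v) (B (s + t))))) \<le> ereal K"
  proof (rule SUP_least)
    fix t
    have "ereal (onorm ((*v) (B (s + t)))) \<le> (SUP t. ereal (onorm ((*v) (B t))))" by (rule SUP_upper) simp
    also have "\<dots> \<le> ereal K" using assms by (simp add: E_def)
    finally show "ereal (onorm ((*v) (B (s + t)))) \<le> ereal K" .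
  qed
  ultimately show ?thesis using E_D(2)[OF assms] by (simp add: E_def)
qed

lemma fundamental_solution:
  fixes B :: "real \<Rightarrow> 'n::finite sqmat"
  assumes B: "B \<in> E K"
  shows "fundamental_solution B 0 = mat 1"
    and "(fundamental_solution B has_vector_derivative J ** B t ** fundamental_solution B t) (at t)"
    and "norm (fundamental_solution B t - mat 1) \<le> norm (mat 1 :: 'n sqmat) * (exp (K * \<bar>t\<bar>) - 1)"
    and "\<gamma> 0 = mat 1 \<Longrightarrow> (\<And>t. (\<gamma> has_vector_derivative J ** B t ** \<gamma> t) (at t)) \<Longrightarrow> fundamental_solution B = \<gamma>"
proof -
  have "norm (J ** B t *v v) \<le> K * norm v" for t v
    using E_D(3)[OF B, of t v] by (simp add: matrix_vector_mul_assoc[symmetric])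
  then have bound: "norm (J ** B t ** X) \<le> K * norm X" for t and X :: "'n sqmat"
    using E_D(4)[OF B] by (rule norm_matrix_mult_le)
  have lin: "linear (\<lambda>X. J ** B t ** X)" for t by (auto intro!: linearI simp: matrix_mult_linear)
  have cont: "continuous_on UNIV (\<lambda>t. J ** B t ** X t)" if "continuous_on UNIV X" for X
    using that E_D(1)[OF B] by (intro continuous_intros)
  obtain x where x: "x 0 = (mat 1 :: 'n sqmat)" "\<And>t. (x has_vector_derivative J ** B t ** x t) (at t)"
    "\<And>t. norm (x t - mat 1) \<le> norm (mat 1 :: 'n sqmat) * (exp (K * \<bar>t\<bar>) - 1)"
    using linear_ode_solution[of "\<lambda>t X. J ** B t ** X" K "mat 1", OF lin bound E_D(4)[OF B] cont] by blast
  have uniq: "\<gamma> = x" if \<gamma>: "\<gamma> 0 = mat 1" "\<And>t. (\<gamma> has_vector_derivative J ** B t ** \<gamma> t) (at t)" for \<gamma>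
  proof
    fix t
    have px: "transpose (x t) ** J ** x t = J" "transpose (x t) ** J ** \<gamma> t = J"
      using hamiltonian_flow_pairing[OF E_D(2)[OF B] x(1,2) x(1,2)]
        hamiltonian_flow_pairing[OF E_D(2)[OF B] x(1,2) \<gamma>] by blast+
    \<comment> \<open>Both flows are right inverses of the same matrix.\<close>
    have inv: "(- J ** transpose (x t) ** J) ** x t = mat 1" "(- J ** transpose (x t) ** J) ** \<gamma> t = mat 1"
      using px by (simp_all add: matrix_mult_minus_left matrix_mul_assoc[symmetric])
    show "\<gamma> t = x t" using matrix_inv_unique(2)[OF inv(1)] matrix_inv_unique(2)[OF inv(2)] by simp
  qed
  have fs: "fundamental_solution B = x"
    unfolding fundamental_solution_def
  proof (rule the_equality)
    show "x 0 = mat 1 \<and> (\<forall>t. (x has_vector_derivative J ** B t ** x t) (at t))" using x(1,2) by blast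
    show "\<gamma> = x" if "\<gamma> 0 = mat 1 \<and> (\<forall>t. (\<gamma> has_vector_derivative J ** B t ** \<gamma> t) (at t))" for \<gamma>
      using that uniq by blast
  qed
  show "fundamental_solution B 0 = mat 1"
    "(fundamental_solution B has_vector_derivative J ** B t ** fundamental_solution B t) (at t)"
    "norm (fundamental_solution B t - mat 1) \<le> norm (mat 1 :: 'n sqmat) * (exp (K * \<bar>t\<bar>) - 1)"
    unfolding fs by (rule x)+
  show "\<gamma> 0 = mat 1 \<Longrightarrow> (\<And>t. (\<gamma> has_vector_derivative J ** B t ** \<gamma> t) (at t)) \<Longrightarrow> fundamental_solution B = \<gamma>"
    unfolding fs using uniq by blast
qed

lemma fundamental_solution_in_Sp:
  assumes B: "B \<in> E K" shows "fundamental_solution B t \<in> Sp"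
  unfolding Sp_iff by (rule hamiltonian_flow_pairing[OF E_D(2)[OF B]]) (rule fundamental_solution[OF B])+

lemma continuous_on_fundamental_solution:
  assumes B: "B \<in> E K" shows "continuous_on T (fundamental_solution B)"
  using fundamental_solution(2)[OF B] by (intro continuous_at_imp_continuous_on ballI has_vector_derivative_continuous)

text \<open>The second factor is the inverse of \<open>fundamental_solution B s\<close> in
  polynomial form, so joint continuity in \<open>s\<close> and \<open>t\<close> follows from
  continuity of a single flow.\<close>

lemma fundamental_solution_shift:
  fixes B :: "real \<Rightarrow> 'n::finite sqmat"
  assumes B: "B \<in> E K"
  shows "fundamental_solution (\<lambda>t. B (s + t)) t
    = fundamental_solution B (s + t) ** (- J ** transpose (fundamental_solution B s) ** J)"
proof -
  let ?\<gamma> = "fundamental_solution B"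
  let ?R = "- J ** transpose (?\<gamma> s) ** J"
  have "fundamental_solution (\<lambda>t. B (s + t)) = (\<lambda>t. ?\<gamma> (s + t) ** ?R)"
  proof (rule fundamental_solution(4)[OF E_shift[OF B]])
    show "?\<gamma> (s + 0) ** ?R = mat 1" using Sp_transpose_J[OF fundamental_solution_in_Sp[OF B]] by simp
    fix t
    have "((\<lambda>t. ?\<gamma> (s + t)) has_vector_derivative 1 *\<^sub>R (J ** B (s + t) ** ?\<gamma> (s + t))) (at t)"
    proof -
      have "((+) s has_vector_derivative 1) (at t)" by (auto intro!: derivative_eq_intros)
      from vector_diff_chain_at[OF this fundamental_solution(2)[OF B]] show ?thesis by (simp add: o_def)
    qed
    then have "((\<lambda>t. ?\<gamma> (s + t) ** ?R) has_vector_derivative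
       ?\<gamma> (s + t) ** 0 + (1 *\<^sub>R (J ** B (s + t) ** ?\<gamma> (s + t))) ** ?R) (at t)"
      by (rule has_vector_derivative_matrix_mult) (rule has_vector_derivative_const)
    moreover have "?\<gamma> (s + t) ** 0 = (0 :: 'n sqmat)" by (simp add: matrix_matrix_mult_def vec_eq_iff)
    ultimately show "((\<lambda>t. ?\<gamma> (s + t) ** ?R) has_vector_derivative J ** B (s + t) ** (?\<gamma> (s + t) ** ?R)) (at t)"
      by (simp add: matrix_mul_assoc)
  qed
  then show ?thesis by (rule fun_cong)
qed

lemma fundamental_solution_cocycle:
  fixes B :: "real \<Rightarrow> 'n::finite sqmat"
  assumes B: "B \<in> E K"
  shows "fundamental_solution (\<lambda>t. B (s + t)) t ** fundamental_solution B s = fundamental_solution B (s + t)"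
proof -
  let ?\<gamma> = "fundamental_solution B"
  have "(- J ** transpose (?\<gamma> s) ** J) ** ?\<gamma> s = mat 1"
    using Sp_transpose_J[OF fundamental_solution_in_Sp[OF B]] matrix_left_right_inverse by blast
  then show ?thesis unfolding fundamental_solution_shift[OF B] by (simp add: matrix_mul_assoc[symmetric])
qed

subsection \<open>Uniform comparison of shifted flows\<close>

lemma norm_matrix_vector_le:
  fixes A :: "real^'n^'m"
  shows "norm (A *v x) \<le> norm A * norm x"
proof -
  have "norm (A *v x) \<le> L2_set (\<lambda>i. norm (A $ i) * norm x) UNIV"
    unfolding norm_vec_def[of "A *v x"]
    by (rule L2_set_mono) (auto simp: matrix_mult_dot Cauchy_Schwarz_ineq2)
  also have "\<dots> = norm A * norm x"
    by (simp add: norm_vec_def[of A] L2_set_left_distrib)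
  finally show ?thesis .
qed

lemma norm_cmat_vector_le:
  fixes A :: "real^'n^'m"
  assumes "\<And>v. norm (A *v v) \<le> c * norm v" "c \<ge> 0"
  shows "norm (cmat A *v x) \<le> c * norm x"
proof -
  have "(norm (cmat A *v x))\<^sup>2 \<le> (c * norm (Rev x))\<^sup>2 + (c * norm (Imv x))\<^sup>2"
    unfolding norm_complex_vec[of "cmat A *v x"] Rev_cmat Imv_cmat
    by (intro add_mono power_mono assms) auto
  also have "\<dots> = (c * norm x)\<^sup>2" by (simp add: power_mult_distrib norm_complex_vec[of x] distrib_left)
  finally show ?thesis using assms(2) by (meson mult_nonneg_nonneg norm_ge_zero power2_le_imp_le)
qed

lemma norm_exp_J [simp]: "norm (exp_J t *v x) = norm x"
proof -
  have "x \<bullet> (J *v x) = 0" using inner_J[of x x] by (simp add: inner_commute)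
  then have "(exp_J t *v x) \<bullet> (exp_J t *v x) = cos t * (cos t * (x \<bullet> x)) + sin t * (sin t * (x \<bullet> x))"
    unfolding exp_J_def matrix_vector_mult_add_rdistrib scaleR_matrix_vector_assoc[symmetric]
    by (simp add: inner_simps inner_J_J inner_commute)
  also have "\<dots> = (cos t * cos t + sin t * sin t) * (x \<bullet> x)" by (simp only: distrib_right mult.assoc)
  also have "\<dots> = x \<bullet> x" by (simp add: sin_cos_squared_add3)
  finally show ?thesis by (simp add: norm_eq_sqrt_inner)
qed

lemma det_near_identity:
  assumes "e > 0"
  obtains \<theta> where "\<theta> > 0" "\<And>X :: complex^'n^'n. (\<And>y. norm (X *v y) \<le> \<theta> * norm y) \<Longrightarrow> cmod (det (mat 1 + X) - 1) < e"
proof -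
  have "continuous_on UNIV (\<lambda>A :: complex^'n^'n. det A)" by (intro continuous_intros)
  then obtain d where d: "d > 0" "\<And>A :: complex^'n^'n. dist A (mat 1) < d \<Longrightarrow> dist (det A) (det (mat 1 :: complex^'n^'n)) < e"
    using assms unfolding continuous_on_iff by (metis UNIV_I)
  let ?n = "real CARD('n)"
  \<comment> \<open>Each entry is bounded by \<theta>, and the sum over all \<open>?n * ?n\<close>
    entries must stay below \<open>d\<close>; the factor 2 makes this strict.\<close>
  define \<theta> where "\<theta> = d / (2 * (?n * ?n))"
  have n: "?n * ?n > 0" by simp
  have \<theta>: "\<theta> > 0" "?n * ?n * \<theta> < d" using d(1) by (simp_all add: \<theta>_def)
  show thesis
  proof (rule that[OF \<theta>(1)])
    fix X :: "complex^'n^'n" assume X: "\<And>y. norm (X *v y) \<le> \<theta> * norm y"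
    have entry: "norm (X $ i $ j) \<le> \<theta>" for i j
    proof -
      have "norm (X $ i $ j) = norm ((X *v axis j 1) $ i)"
        by (simp add: matrix_vector_mult_def axis_def if_distrib cong: if_cong)
      also have "\<dots> \<le> norm (X *v axis j 1)"
        unfolding norm_vec_def[of "X *v axis j 1"] by (rule member_le_L2_set) auto
      also have "\<dots> \<le> \<theta>" using X[of "axis j 1"] by simp
      finally show ?thesis .
    qed
    have row: "norm (X $ i) \<le> ?n * \<theta>" for i
    proof -
      have "norm (X $ i) \<le> (\<Sum>j\<in>UNIV. norm (X $ i $ j))" unfolding norm_vec_def by (rule L2_set_le_sum) auto
      also have "\<dots> \<le> (\<Sum>j\<in>(UNIV :: 'n set). \<theta>)" by (intro sum_mono entry)
      finally show ?thesis by simp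
    qed
    have "norm X \<le> (\<Sum>i\<in>UNIV. norm (X $ i))" unfolding norm_vec_def[of X] by (rule L2_set_le_sum) auto
    also have "\<dots> \<le> (\<Sum>i\<in>(UNIV :: 'n set). ?n * \<theta>)" by (intro sum_mono row)
    also have "\<dots> = ?n * ?n * \<theta>" by simp
    finally have "norm X < d" using \<theta>(2) by linarith
    then have "dist (mat 1 + X) (mat 1) < d" by (simp add: dist_norm)
    from d(2)[OF this] show "cmod (det (mat 1 + X) - 1) < e" by (simp add: dist_norm)
  qed
qed

lemma cay_minus_i:
  "cay (- \<i>) M *v x = (cmat M *v x - x) - \<i> *s (cmat J *v (cmat M *v x + x))"
  by (simp add: cay_def pencil_mult_vec cmat_mult cmat_diff cmat_add matrix_vector_mul_assoc[symmetric]
      matrix_vector_mult_diff_rdistrib matrix_vector_mult_add_rdistrib vec_eq_iff)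

lemma norm_i_scale: "norm (\<i> *s v) = norm v" for v :: "complex^'m"
  by (simp add: norm_vec_def norm_mult)

text \<open>If \<open>M P = L M'\<close> with \<open>L\<close> and \<open>P\<close> close to the identity, then the matrices
  \<open>(I - \<i>J) M - (I + \<i>J)\<close> and \<open>(I - \<i>J) M' - (I + \<i>J)\<close> differ by a factor close to the identity; by
  the bound for \<open>cay (- \<i>)\<close> the closeness does not depend on the size of \<open>M\<close> and \<open>M'\<close>.\<close>

lemma cay_perturb:
  fixes M M' L P :: "'n::finite sqmat"
  assumes M': "M' \<in> Sp" and MP: "M ** P = L ** M'"
    and L: "\<And>v. norm ((L - mat 1) *v v) \<le> a * norm v" and P: "\<And>v. norm ((P - mat 1) *v v) \<le> a * norm v" and a: "a \<ge> 0"
  shows "\<exists>X. cay (- \<i>) M ** cmat P = (mat 1 + X) ** cay (- \<i>) M' \<and> (\<forall>y. norm (X *v y) \<le> (6 * a) * norm y)"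
proof -
  let ?K = "cay (- \<i>) M" and ?K' = "cay (- \<i>) M'"
  have dK': "det ?K' \<noteq> 0" using gdet_nz[OF M', of 1] by (simp add: gdet_def)
  define X where "X = (?K ** cmat P - ?K') ** matrix_inv ?K'"
  have "(mat 1 + X) ** ?K' = ?K' + (?K ** cmat P - ?K') ** (matrix_inv ?K' ** ?K')"
    by (simp add: X_def matrix_mult_add_left matrix_mul_assoc)
  then have 1: "?K ** cmat P = (mat 1 + X) ** ?K'" by (simp add: matrix_inv_left[OF dK'])
  have "norm (X *v y) \<le> (6 * a) * norm y" for y
  proof -
    define x where "x = matrix_inv ?K' *v y"
    have K'x: "?K' *v x = y" by (simp add: x_def matrix_vector_mul_assoc matrix_inv_right[OF dK'])
    have nx: "norm x \<le> 3 / 2 * norm y" "norm (cmat M' *v x) \<le> 3 / 2 * norm y"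
      using cay_norm_bound_1[OF M', of x] by (simp_all add: K'x)
    define p q where "p = cmat (L - mat 1) *v (cmat M' *v x)" and "q = cmat (P - mat 1) *v x"
    have "cmat M *v (cmat P *v x) = cmat L *v (cmat M' *v x)"
      by (simp add: matrix_vector_mul_assoc cmat_mult[symmetric] MP)
    then have MPx: "cmat M *v (cmat P *v x) = cmat M' *v x + p"
      by (simp add: p_def cmat_diff matrix_vector_mult_diff_rdistrib)
    have Px: "cmat P *v x = x + q" by (simp add: q_def cmat_diff matrix_vector_mult_diff_rdistrib)
    have "X *v y = ?K *v (cmat P *v x) - ?K' *v x"
      by (simp add: X_def x_def matrix_vector_mul_assoc matrix_mul_assoc matrix_mult_diff_left matrix_vector_mult_diff_rdistrib)
    also have "\<dots> = (p - q) - \<i> *s (cmat J *v (p + q))"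
      unfolding cay_minus_i[of M "cmat P *v x"] cay_minus_i[of M' x] MPx unfolding Px
      by (simp add: matrix_vector_right_distrib vec_eq_iff algebra_simps)
    finally have "norm (X *v y) \<le> norm (p - q) + norm (p + q)"
      using norm_triangle_ineq4[of "p - q" "\<i> *s (cmat J *v (p + q))"] by (simp add: norm_i_scale norm_cmat_J)
    \<comment> \<open>Each of \<open>p\<close> and \<open>q\<close> has norm at most
      \<open>a * (3 / 2 * norm y)\<close>, which gives the constant 6.\<close>
    also have "\<dots> \<le> 2 * norm p + 2 * norm q"
      using norm_triangle_ineq4[of p q] norm_triangle_ineq[of p q] by simp
    also have "norm p \<le> a * (3 / 2 * norm y)"
      using norm_cmat_vector_le[OF L a, of "cmat M' *v x"] mult_left_mono[OF nx(2) a] unfolding p_def by linarith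
    also have "norm q \<le> a * (3 / 2 * norm y)"
      using norm_cmat_vector_le[OF P a, of x] mult_left_mono[OF nx(1) a] unfolding q_def by linarith
    finally show ?thesis by simp
  qed
  with 1 show ?thesis by blast
qed

text \<open>Flowing from time \<open>r'\<close> to time \<open>r + l\<close> via \<open>r\<close> or
  via \<open>r' + l\<close> gives \<open>\<gamma> r l ** P = \<Lambda> ** \<gamma> r' l\<close>,
  where \<open>P\<close> and \<open>\<Lambda>\<close> are flows over the short time
  \<open>r - r'\<close>. Both are near the identity uniformly, because all shifts of
  \<open>B\<close> lie in the same \<open>E K\<close>.\<close>

lemma shifted_flow_steps:
  fixes B :: "real \<Rightarrow> 'n::finite sqmat"
  assumes B: "B \<in> E K"
  obtains \<delta> where "\<delta> > 0"
    "\<And>\<epsilon> l r r'. \<bar>r - r'\<bar> \<le> \<delta> \<Longrightarrow>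
       cmod (gdet (- \<i>) (exp_J \<epsilon> ** fundamental_solution (\<lambda>t. B (r + t)) l)
          / gdet (- \<i>) (exp_J \<epsilon> ** fundamental_solution (\<lambda>t. B (r' + t)) l) - 1) < 1"
proof -
  \<comment> \<open>With \<open>det (mat 1 + X)\<close> and \<open>det (cmat P)\<close> both within
    \<open>1/3\<close> of \<open>1\<close>, their difference is below \<open>2/3\<close> and the
    denominator above it, so the ratio is within \<open>1\<close> of \<open>1\<close>.\<close>
  obtain \<theta> where \<theta>: "\<theta> > 0" "\<And>X :: complex^('n+'n)^('n+'n). (\<And>y. norm (X *v y) \<le> \<theta> * norm y) \<Longrightarrow> cmod (det (mat 1 + X) - 1) < 1/3"
    using det_near_identity[of "1/3"] by auto
  \<comment> \<open>Compensates the factor 6 of \<open>cay_perturb\<close>.\<close>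
  define a where "a = \<theta> / 6"
  have a: "a > 0" using \<theta> by (simp add: a_def)
  have "isCont (\<lambda>\<tau>. norm (mat 1 :: 'n sqmat) * (exp (K * \<tau>) - 1)) 0" by (intro continuous_intros)
  then have "(\<lambda>\<tau>. norm (mat 1 :: 'n sqmat) * (exp (K * \<tau>) - 1)) \<midarrow>0\<rightarrow> 0" by (simp add: isCont_def)
  from LIM_D[OF this a] obtain d where d: "d > 0" "\<And>\<tau>. \<tau> \<noteq> 0 \<Longrightarrow> \<bar>\<tau>\<bar> < d \<Longrightarrow> \<bar>norm (mat 1 :: 'n sqmat) * (exp (K * \<tau>) - 1)\<bar> < a"
    by auto
  have small: "norm (norm (fundamental_solution C \<tau> - mat 1)) \<le> a" if C: "C \<in> E K" and \<tau>: "\<bar>\<tau>\<bar> < d" for C :: "real \<Rightarrow> 'n sqmat" and \<tau>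
  proof (cases "\<tau> = 0")
    case True
    then show ?thesis using fundamental_solution(1)[OF C] a by simp
  next
    case False
    then show ?thesis using fundamental_solution(3)[OF C, of \<tau>] d(2)[of "\<bar>\<tau>\<bar>"] \<tau> by simp
  qed
  show thesis
  proof (rule that[of "d / 2"])
    show "d / 2 > 0" using d by simp
    fix \<epsilon> l r r' assume rr: "\<bar>r - r'\<bar> \<le> d / 2"
    define \<tau> where "\<tau> = r - r'"
    have \<tau>: "\<bar>\<tau>\<bar> < d" "r = r' + \<tau>" using rr d by (auto simp: \<tau>_def)
    let ?\<gamma> = "\<lambda>r. fundamental_solution (\<lambda>t. B (r + t))"
    define M M' where "M = exp_J \<epsilon> ** ?\<gamma> r l" and "M' = exp_J \<epsilon> ** ?\<gamma> r' l"
    define P where "P = ?\<gamma> r' \<tau>"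
    define \<Lambda> where "\<Lambda> = ?\<gamma> (r' + l) \<tau>"
    \<comment> \<open>Conjugation by the isometry \<open>exp_J \<epsilon>\<close> keeps operator
      bounds, so the estimate is the same for every \<epsilon>.\<close>
    define L where "L = exp_J \<epsilon> ** \<Lambda> ** exp_J (- \<epsilon>)"
    note Er = E_shift[OF B, of r']
    have "?\<gamma> r l ** P = ?\<gamma> r' (\<tau> + l)"
      using fundamental_solution_cocycle[OF Er, of \<tau> l] by (simp add: P_def \<tau>(2) ac_simps)
    also have "\<dots> = \<Lambda> ** ?\<gamma> r' l"
      using fundamental_solution_cocycle[OF Er, of l \<tau>] by (simp add: \<Lambda>_def ac_simps)
    finally have "?\<gamma> r l ** P = \<Lambda> ** ?\<gamma> r' l" .
    moreover have "exp_J (- \<epsilon>) ** exp_J \<epsilon> = (mat 1 :: 'n sqmat)" by (simp add: exp_J_add)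
    then have "exp_J (- \<epsilon>) ** (exp_J \<epsilon> ** Y) = Y" for Y :: "'n sqmat" by (simp add: matrix_mul_assoc)
    ultimately have MP: "M ** P = L ** M'"
      by (simp add: M_def M'_def L_def matrix_mul_assoc[symmetric])
    have M': "M' \<in> Sp" "M \<in> Sp" unfolding M_def M'_def by (intro Sp_mult exp_J_in_Sp fundamental_solution_in_Sp[OF E_shift[OF B]])+
    have Pn: "norm ((P - mat 1) *v v) \<le> a * norm v" for v
    proof -
      have "norm (P - mat 1) \<le> a" using small[OF Er \<tau>(1)] by (simp add: P_def)
      then show ?thesis using norm_matrix_vector_le[of "P - mat 1" v] mult_right_mono[of _ a "norm v"] by fastforce
    qed
    have Ln: "norm ((L - mat 1) *v v) \<le> a * norm v" for v
    proof -
      have "norm (\<Lambda> - mat 1) \<le> a" using small[OF E_shift[OF B] \<tau>(1)] by (simp add: \<Lambda>_def)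
      have "L - mat 1 = exp_J \<epsilon> ** (\<Lambda> - mat 1) ** exp_J (- \<epsilon>)"
        by (simp add: L_def matrix_mult_diff_left matrix_mult_diff_right exp_J_add)
      then have "norm ((L - mat 1) *v v) = norm ((\<Lambda> - mat 1) *v (exp_J (- \<epsilon>) *v v))"
        by (simp add: matrix_vector_mul_assoc[symmetric])
      also have "\<dots> \<le> norm (\<Lambda> - mat 1) * norm (exp_J (- \<epsilon>) *v v)" by (rule norm_matrix_vector_le)
      also have "\<dots> \<le> a * norm v" using \<open>norm (\<Lambda> - mat 1) \<le> a\<close> by (simp add: mult_right_mono)
      finally show ?thesis .
    qed
    obtain X where X: "cay (- \<i>) M ** cmat P = (mat 1 + X) ** cay (- \<i>) M'" "\<And>y. norm (X *v y) \<le> (6 * a) * norm y"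
      using cay_perturb[OF M'(1) MP Ln Pn] a by auto
    define u where "u = det (mat 1 + X)"
    define v where "v = det (cmat P)"
    have u: "cmod (u - 1) < 1/3" unfolding u_def using X(2) by (intro \<theta>) (simp add: a_def)
    have v: "cmod (v - 1) < 1/3"
    proof -
      have "cmod (det (mat 1 + (cmat P - mat 1)) - 1) < 1/3"
      proof (rule \<theta>(2))
        fix y :: "complex^('n+'n)"
        have "norm (cmat (P - mat 1) *v y) \<le> a * norm y" using a by (intro norm_cmat_vector_le Pn) auto
        also have "\<dots> \<le> \<theta> * norm y" using \<theta>(1) by (intro mult_right_mono) (auto simp: a_def)
        finally show "norm ((cmat P - mat 1) *v y) \<le> \<theta> * norm y" by (simp add: cmat_diff)
      qed
      then show ?thesis by (simp add: v_def)
    qed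
    have "gdet (- \<i>) M * v = u * gdet (- \<i>) M'"
      using arg_cong[OF X(1), of det] by (simp add: det_mul gdet_def u_def v_def)
    moreover have g: "gdet (- \<i>) M' \<noteq> 0" using gdet_nz[OF M'(1), of 1] by simp
    moreover have vb: "cmod v > 2/3"
      using norm_triangle_ineq2[of 1 "1 - v"] v by (simp add: norm_minus_commute)
    moreover from this have v0: "v \<noteq> 0" by auto
    ultimately have "gdet (- \<i>) M / gdet (- \<i>) M' = u / v" by (simp add: field_simps)
    then have "gdet (- \<i>) M / gdet (- \<i>) M' - 1 = (u - v) / v" using v0 by (simp add: field_simps)
    moreover have "cmod (u - v) < 2/3"
      using norm_triangle_ineq4[of "u - 1" "v - 1"] u v by simp
    ultimately show "cmod (gdet (- \<i>) (exp_J \<epsilon> ** ?\<gamma> r l) / gdet (- \<i>) (exp_J \<epsilon> ** ?\<gamma> r' l) - 1) < 1"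
      using vb v0 by (simp add: M_def M'_def norm_divide divide_less_eq)
  qed
qed

text \<open>Substituting \<open>- \<i> z\<close> does not raise the degree of the polynomial, so the
  number of its roots bounds the correction independently of \<open>M\<close>.\<close>

lemma darg_gdet_endpoint_bound:
  fixes M :: "'n::finite sqmat"
  assumes "M \<in> Sp" "M \<notin> Sp0 1"
  shows "\<bar>darg (\<lambda>z. gdet (- \<i> * of_real z) M) 0 1\<bar> \<le> 2 * pi * CARD('n + 'n)"
proof -
  obtain p where p: "\<And>z. poly p z = gdet z M" "degree p \<le> CARD('n + 'n)" using gdet_poly by blast
  define q where "q = p \<circ>\<^sub>p [:0, - \<i>:]"
  have q: "poly q (of_real z) = gdet (- \<i> * of_real z) M" for z
    by (simp add: q_def poly_pcompose p(1) mult.commute)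
  have "degree q \<le> CARD('n + 'n)" using p(2) by (simp add: q_def degree_pcompose)
  moreover have "\<bar>darg (\<lambda>z. poly q (complex_of_real z)) 0 1\<bar> \<le> 2 * pi * degree q"
  proof (rule darg_poly)
    fix z :: real assume "z \<in> {0..1}"
    then show "poly q (of_real z) \<noteq> 0" unfolding q using assms by (intro gdet_nz_strip) auto
  qed simp
  ultimately show ?thesis unfolding q
    by (smt (verit) mult_left_mono of_nat_mono pi_gt_zero)
qed

text \<open>\<open>C\<close> is chosen before \<epsilon> and \<open>l\<close>; this uniformity makes
  the difference disappear in the mean. The cost is one \<open>pi\<close> per step in the shift
  parameter plus four endpoint corrections.\<close>

lemma maslov_arg_shift_bound:
  fixes B :: "real \<Rightarrow> 'n::finite sqmat"
  assumes B: "B \<in> E K"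
  obtains C where "\<And>\<epsilon> l. l > 0
     \<Longrightarrow> exp_J \<epsilon> \<notin> (Sp0 1 :: 'n sqmat set)
     \<Longrightarrow> exp_J \<epsilon> ** fundamental_solution B l \<notin> Sp0 1
     \<Longrightarrow> exp_J \<epsilon> ** fundamental_solution (\<lambda>t. B (s + t)) l \<notin> Sp0 1
     \<Longrightarrow> \<bar>maslov_arg (\<lambda>t. exp_J \<epsilon> ** fundamental_solution B t) 0 l
         - maslov_arg (\<lambda>t. exp_J \<epsilon> ** fundamental_solution (\<lambda>t. B (s + t)) t) 0 l\<bar> \<le> C"
proof -
  obtain \<delta> where \<delta>: "\<delta> > 0"
    "\<And>\<epsilon> l r r'. \<bar>r - r'\<bar> \<le> \<delta> \<Longrightarrow>
       cmod (gdet (- \<i>) (exp_J \<epsilon> ** fundamental_solution (\<lambda>t. B (r + t)) l)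
          / gdet (- \<i>) (exp_J \<epsilon> ** fundamental_solution (\<lambda>t. B (r' + t)) l) - 1) < 1"
    using shifted_flow_steps[OF B] by blast
  \<comment> \<open>A change of \<open>u\<close> by \<eta> moves the shift \<open>u * s\<close> by
    at most \<delta>; the added \<open>1\<close> covers \<open>s = 0\<close>.\<close>
  define \<eta> where "\<eta> = \<delta> / (\<bar>s\<bar> + 1)"
  have \<eta>: "\<eta> > 0" "\<eta> * \<bar>s\<bar> \<le> \<delta>" using \<delta>(1) by (auto simp: \<eta>_def field_simps)
  obtain n :: nat where n: "1 / \<eta> < real n" using reals_Archimedean2 by blast
  then have n: "1 - 0 \<le> real n * \<eta>" using \<eta>(1) by (simp add: field_simps)
  let ?N = "2 * pi * CARD('n + 'n)"
  show thesis
  proof (rule that[of "(real (Suc n) * pi + 4 * ?N) / pi"])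
    fix \<epsilon> l :: real
    assume l: "l > 0" and off: "exp_J \<epsilon> \<notin> (Sp0 1 :: 'n sqmat set)" "exp_J \<epsilon> ** fundamental_solution B l \<notin> Sp0 1"
      "exp_J \<epsilon> ** fundamental_solution (\<lambda>t. B (s + t)) l \<notin> Sp0 1"
    define h where "h x = exp_J \<epsilon> ** fundamental_solution (\<lambda>t. B (fst x * s + t)) (snd x)" for x :: "real \<times> real"
    have hSp: "h x \<in> Sp" for x
      unfolding h_def by (intro Sp_mult exp_J_in_Sp fundamental_solution_in_Sp[OF E_shift[OF B]])
    have conth: "continuous_on T h" for T
      unfolding h_def fundamental_solution_shift[OF B] transpose_def
      by (intro continuous_intros continuous_on_compose2[OF continuous_on_fundamental_solution[OF B, of UNIV]]) auto
    have h0: "h (u, 0) = exp_J \<epsilon>" for u by (simp add: h_def fundamental_solution(1)[OF E_shift[OF B]])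
    define G where "G x = gdet (- \<i>) (h x)" for x
    have G0: "G x \<noteq> 0" for x unfolding G_def using gdet_nz[OF hSp, of 1] by simp
    have contG: "continuous_on T (\<lambda>x. G (f x))" if "continuous_on T f" for T :: "'b::topological_space set" and f
      unfolding G_def by (intro continuous_intros continuous_on_compose2[OF conth[of UNIV] that]) auto
    have "darg (\<lambda>u. G (u, 0)) 0 1 + darg (\<lambda>t. G (1, t)) 0 l = darg (\<lambda>t. G (0, t)) 0 l + darg (\<lambda>u. G (u, l)) 0 1"
      using l G0 contG[of _ "\<lambda>x. x"] by (intro darg_rectangle) (auto intro: continuous_intros)
    \<comment> \<open>All shifted flows start at the identity, so \<open>G\<close> is constant on
      this side.\<close>
    moreover have "darg (\<lambda>u. G (u, 0)) 0 1 = 0"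
    proof -
      have "darg (\<lambda>u. G (u, 0)) 0 1 = Im (Ln (G (0, 0))) - Im (Ln (G (0, 0)))"
        using G0[of "(0, 0)"] by (intro darg_eq[where \<phi> = "\<lambda>u. Ln (G (0, 0))"]) (auto simp: G_def h0)
      then show ?thesis by simp
    qed
    moreover have "\<bar>darg (\<lambda>u. G (u, l)) 0 1\<bar> \<le> real (Suc n) * pi"
    proof (rule darg_steps[OF _ _ _ \<eta>(1)])
      show "continuous_on {0..1} (\<lambda>u. G (u, l))" by (intro contG continuous_intros)
      fix u u' assume "\<bar>u - u'\<bar> \<le> \<eta>"
      then have "\<bar>u - u'\<bar> * \<bar>s\<bar> \<le> \<eta> * \<bar>s\<bar>" by (intro mult_right_mono) auto
      then have "\<bar>u * s - u' * s\<bar> \<le> \<delta>" using \<eta>(2) by (simp add: left_diff_distrib[symmetric] abs_mult)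
      then show "cmod (G (u, l) / G (u', l) - 1) < 1" unfolding G_def h_def by (auto intro!: \<delta>(2))
    qed (use n G0 in auto)
    ultimately have D: "\<bar>darg (\<lambda>t. G (1, t)) 0 l - darg (\<lambda>t. G (0, t)) 0 l\<bar> \<le> real (Suc n) * pi" by linarith
    define e where "e M = darg (\<lambda>z. gdet (- \<i> * of_real z) M) 0 1" for M :: "'n sqmat"
    have e: "\<bar>e (h (u, t))\<bar> \<le> ?N" if "h (u, t) \<notin> Sp0 1" for u t
      unfolding e_def by (rule darg_gdet_endpoint_bound[OF hSp that])
    have hl: "h (0, l) \<notin> Sp0 1" "h (1, l) \<notin> Sp0 1" "h (0, 0) \<notin> Sp0 1" "h (1, 0) \<notin> Sp0 1"
      using off h0 by (auto simp: h_def[of "(0, l)"] h_def[of "(1, l)"])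
    have "pi * (maslov_arg (\<lambda>t. h (0, t)) 0 l - maslov_arg (\<lambda>t. h (1, t)) 0 l)
      = (darg (\<lambda>t. G (0, t)) 0 l - e (h (0, l)) + e (h (0, 0))) - (darg (\<lambda>t. G (1, t)) 0 l - e (h (1, l)) + e (h (1, 0)))"
      unfolding maslov_arg_def G_def e_def by (simp add: field_simps)
    then have "\<bar>pi * (maslov_arg (\<lambda>t. h (0, t)) 0 l - maslov_arg (\<lambda>t. h (1, t)) 0 l)\<bar> \<le> real (Suc n) * pi + 4 * ?N"
      using D e[OF hl(1)] e[OF hl(2)] e[OF hl(3)] e[OF hl(4)] by linarith
    then have "\<bar>maslov_arg (\<lambda>t. h (0, t)) 0 l - maslov_arg (\<lambda>t. h (1, t)) 0 l\<bar> \<le> (real (Suc n) * pi + 4 * ?N) / pi"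
      by (simp add: abs_mult pos_le_divide_eq mult.commute)
    then show "\<bar>maslov_arg (\<lambda>t. exp_J \<epsilon> ** fundamental_solution B t) 0 l
         - maslov_arg (\<lambda>t. exp_J \<epsilon> ** fundamental_solution (\<lambda>t. B (s + t)) t) 0 l\<bar> \<le> (real (Suc n) * pi + 4 * ?N) / pi"
      by (simp add: h_def)
  qed
qed

section \<open>Comparison of the Maslov-type indices\<close>

lemma eventually_maslov_iota:
  fixes \<gamma> :: "real \<Rightarrow> 'n::finite sqmat"
  assumes ab: "a < b" and cont: "continuous_on {a..b} \<gamma>" and Sp: "\<gamma> ` {a..b} \<subseteq> Sp"
  shows "\<forall>\<^sub>F \<epsilon> in at_right 0. real_of_int (maslov_iota 1 (mat 1) \<gamma> a b) = maslov_arg (\<lambda>t. exp_J (- \<epsilon>) ** \<gamma> t) a b"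
proof -
  have m1: "matrix_inv (mat 1) = (mat 1 :: 'n sqmat)" by (rule matrix_inv_unique) simp
  have "\<gamma> a \<in> Sp" "\<gamma> b \<in> Sp" using Sp ab by auto
  then have "\<forall>\<^sub>F \<epsilon> in at_right 0. exp_J (- \<epsilon>) ** \<gamma> a \<notin> Sp0 1 \<and> exp_J (- \<epsilon>) ** \<gamma> b \<notin> Sp0 1"
    by (intro eventually_conj eventually_rotated_not_Sp0)
  then obtain \<epsilon>0 :: real where \<epsilon>0: "\<epsilon>0 > 0"
    "\<And>\<epsilon>. 0 < \<epsilon> \<Longrightarrow> \<epsilon> < \<epsilon>0 \<Longrightarrow> exp_J (- \<epsilon>) ** \<gamma> a \<notin> Sp0 1 \<and> exp_J (- \<epsilon>) ** \<gamma> b \<notin> Sp0 1"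
    unfolding eventually_at_right_field by blast
  let ?\<sigma> = "\<lambda>\<epsilon> t. exp_J (- \<epsilon>) ** \<gamma> t"
  \<comment> \<open>Below \<open>\<epsilon>0\<close> neither endpoint meets the hypersurface, so
    turning the angle from \<epsilon> to \<open>\<epsilon>'\<close> is an admissible
    homotopy.\<close>
  have indep: "maslov_arg (?\<sigma> \<epsilon>) a b = maslov_arg (?\<sigma> \<epsilon>') a b" if e: "0 < \<epsilon>" "\<epsilon> < \<epsilon>0" "0 < \<epsilon>'" "\<epsilon>' < \<epsilon>0" for \<epsilon> \<epsilon>'
  proof -
    define h where "h x = ?\<sigma> ((1 - fst x) * \<epsilon> + fst x * \<epsilon>') (snd x)" for x :: "real \<times> real"
    have conv: "(1 - u) * \<epsilon> + u * \<epsilon>' \<in> {0<..<\<epsilon>0}" if "u \<in> {0..1}" for u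
      using that e convexD_alt[of "{0<..<\<epsilon>0}" \<epsilon> \<epsilon>' u] by simp
    have "maslov_arg (\<lambda>t. h (0, t)) a b = maslov_arg (\<lambda>t. h (1, t)) a b"
    proof (rule maslov_arg_homotopy)
      show "continuous_on ({0..1} \<times> {a..b}) h"
        unfolding h_def by (intro continuous_intros continuous_on_compose2[OF cont]) auto
      show "h ` ({0..1} \<times> {a..b}) \<subseteq> Sp" unfolding h_def using Sp by (auto intro!: Sp_mult)
      show "h (u, a) \<notin> Sp0 1" "h (u, b) \<notin> Sp0 1" if "u \<in> {0..1}" for u
        using \<epsilon>0(2)[of "(1 - u) * \<epsilon> + u * \<epsilon>'"] conv[OF that] unfolding h_def fst_conv snd_conv greaterThanLessThan_iff by blast+
    qed (use ab in simp)
    then show ?thesis by (simp add: h_def)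
  qed
  have inum: "real_of_int (intersection_number 1 (\<lambda>t. exp_J (- \<epsilon>) ** \<gamma> t ** matrix_inv (mat 1)) a b) = maslov_arg (?\<sigma> \<epsilon>) a b"
    if "0 < \<epsilon>" "\<epsilon> < \<epsilon>0" for \<epsilon>
    unfolding m1 matrix_mul_rid using \<epsilon>0(2)[OF that] Sp
    by (intro intersection_number_eq_maslov_arg ab continuous_intros cont) (auto intro!: Sp_mult)
  define k where "k = intersection_number 1 (\<lambda>t. exp_J (- (\<epsilon>0 / 2)) ** \<gamma> t ** matrix_inv (mat 1)) a b"
  have k: "real_of_int k = maslov_arg (?\<sigma> \<epsilon>) a b" if "0 < \<epsilon>" "\<epsilon> < \<epsilon>0" for \<epsilon>
    unfolding k_def using inum[of "\<epsilon>0 / 2"] indep[of "\<epsilon>0 / 2" \<epsilon>] that \<epsilon>0(1) by simp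
  have ev: "\<forall>\<^sub>F \<epsilon> in at_right 0. intersection_number 1 (\<lambda>t. exp_J (- \<epsilon>) ** \<gamma> t ** matrix_inv (mat 1)) a b = k"
    unfolding eventually_at_right_field
  proof (intro exI[of _ \<epsilon>0] conjI allI impI)
    fix \<epsilon> assume "0 < \<epsilon>" "\<epsilon> < \<epsilon>0"
    then show "intersection_number 1 (\<lambda>t. exp_J (- \<epsilon>) ** \<gamma> t ** matrix_inv (mat 1)) a b = k"
      using inum k by (metis of_int_eq_iff)
  qed (use \<epsilon>0 in simp)
  have "maslov_iota 1 (mat 1) \<gamma> a b = k"
    unfolding maslov_iota_def
  proof (rule the_equality, rule ev)
    fix k' assume "\<forall>\<^sub>F \<epsilon> in at_right 0. intersection_number 1 (\<lambda>t. exp_J (- \<epsilon>) ** \<gamma> t ** matrix_inv (mat 1)) a b = k'"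
    with ev have "\<forall>\<^sub>F \<epsilon>::real in at_right 0. k' = k" by eventually_elim simp
    then show "k' = k" by (simp add: eventually_const trivial_limit_at_right_real)
  qed
  then show ?thesis
    unfolding eventually_at_right_field using k \<epsilon>0(1) by blast
qed

text \<open>One small angle serves both flows at once; the dimension terms of the two indices are
  equal and cancel.\<close>

lemma maslov_index_shift_bound:
  fixes B :: "real \<Rightarrow> 'n::finite sqmat"
  assumes B: "B \<in> E K"
  obtains C where "\<And>l. l > 0 \<Longrightarrow> \<bar>maslov_index 1 (fundamental_solution B) l
     - maslov_index 1 (fundamental_solution (\<lambda>t. B (s + t))) l\<bar> \<le> C"
proof -
  let ?\<gamma> = "fundamental_solution B" and ?\<gamma>' = "fundamental_solution (\<lambda>t. B (s + t))"
  note B' = E_shift[OF B, of s]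
  obtain C where C: "\<And>\<epsilon> l. l > 0
     \<Longrightarrow> exp_J \<epsilon> \<notin> (Sp0 1 :: 'n sqmat set)
     \<Longrightarrow> exp_J \<epsilon> ** ?\<gamma> l \<notin> Sp0 1 \<Longrightarrow> exp_J \<epsilon> ** ?\<gamma>' l \<notin> Sp0 1
     \<Longrightarrow> \<bar>maslov_arg (\<lambda>t. exp_J \<epsilon> ** ?\<gamma> t) 0 l - maslov_arg (\<lambda>t. exp_J \<epsilon> ** ?\<gamma>' t) 0 l\<bar> \<le> C"
    using maslov_arg_shift_bound[OF B] by blast
  show thesis
  proof (rule that)
    fix l :: real assume l: "l > 0"
    have iota: "\<forall>\<^sub>F \<epsilon> in at_right 0. real_of_int (maslov_iota 1 (mat 1) (fundamental_solution D) 0 l)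
        = maslov_arg (\<lambda>t. exp_J (- \<epsilon>) ** fundamental_solution D t) 0 l" if "D \<in> E K" for D :: "real \<Rightarrow> 'n sqmat"
      by (rule eventually_maslov_iota[OF l continuous_on_fundamental_solution[OF that]])
         (use fundamental_solution_in_Sp[OF that] in auto)
    have "\<forall>\<^sub>F \<epsilon> in at_right 0. exp_J (- \<epsilon>) ** mat 1 \<notin> (Sp0 1 :: 'n sqmat set)"
      "\<forall>\<^sub>F \<epsilon> in at_right 0. exp_J (- \<epsilon>) ** ?\<gamma> l \<notin> Sp0 1"
      "\<forall>\<^sub>F \<epsilon> in at_right 0. exp_J (- \<epsilon>) ** ?\<gamma>' l \<notin> Sp0 1"
      by (intro eventually_rotated_not_Sp0 Sp_mat_1 fundamental_solution_in_Sp[OF B] fundamental_solution_in_Sp[OF B'])+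
    with iota[OF B] iota[OF B'] have
      "\<forall>\<^sub>F \<epsilon>::real in at_right 0. \<bar>real_of_int (maslov_iota 1 (mat 1) ?\<gamma> 0 l) - real_of_int (maslov_iota 1 (mat 1) ?\<gamma>' 0 l)\<bar> \<le> C"
    proof eventually_elim
      case (elim \<epsilon>)
      then show ?case using C[OF l, of "- \<epsilon>"] by simp
    qed
    \<comment> \<open>The statement no longer mentions \<epsilon>, and the filter is
      nontrivial.\<close>
    then have "\<bar>real_of_int (maslov_iota 1 (mat 1) ?\<gamma> 0 l) - real_of_int (maslov_iota 1 (mat 1) ?\<gamma>' 0 l)\<bar> \<le> C"
      by (simp add: eventually_const trivial_limit_at_right_real)
    then show "\<bar>maslov_index 1 ?\<gamma> l - maslov_index 1 ?\<gamma>' l\<bar> \<le> C" by (simp add: maslov_index_def)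
  qed
qed

section \<open>Mean indices\<close>

lemma Limsup_Liminf_mean_mono:
  fixes f g :: "real \<Rightarrow> real"
  assumes fg: "\<And>l. l > 0 \<Longrightarrow> f l \<le> g l + C"
  shows "Limsup at_top (\<lambda>l. ereal (f l / l)) \<le> Limsup at_top (\<lambda>l. ereal (g l / l))"
    and "Liminf at_top (\<lambda>l. ereal (f l / l)) \<le> Liminf at_top (\<lambda>l. ereal (g l / l))"
proof -
  \<comment> \<open>\<open>C / l\<close> falls below \<open>e\<close> once \<open>l\<close> exceeds
    both \<open>0\<close> and \<open>C / e\<close>.\<close>
  have shift: "\<forall>\<^sub>F l in at_top. f l / l < g l / l + e" if "e > 0" for e
    using eventually_gt_at_top[of "max 0 (C / e)"]
  proof eventually_elim
    case (elim l)
    then have l: "l > 0" "C < e * l" using that by (auto simp: pos_divide_less_eq mult.commute)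
    have "f l < g l + e * l" using fg[OF l(1)] l(2) by linarith
    then show ?case using l(1) by (simp add: field_simps)
  qed
  show "Limsup at_top (\<lambda>l. ereal (f l / l)) \<le> Limsup at_top (\<lambda>l. ereal (g l / l))"
    unfolding Limsup_le_iff
  proof (intro allI impI)
    fix y assume y: "Limsup at_top (\<lambda>l. ereal (g l / l)) < y"
    \<comment> \<open>Two real numbers are inserted so that their gap absorbs the error term even
      when the limits are infinite.\<close>
    obtain r2 where r2: "Limsup at_top (\<lambda>l. ereal (g l / l)) < ereal r2" "ereal r2 < y" using ereal_dense2[OF y] by blast
    obtain r1 where r1: "Limsup at_top (\<lambda>l. ereal (g l / l)) < ereal r1" "ereal r1 < ereal r2" using ereal_dense2[OF r2(1)] by blast
    have "\<forall>\<^sub>F l in at_top. ereal (g l / l) < ereal r1" using r1(1) by (rule Limsup_lessD)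
    moreover have "\<forall>\<^sub>F l in at_top. f l / l < g l / l + (r2 - r1)" using r1(2) by (intro shift) simp
    ultimately show "\<forall>\<^sub>F l in at_top. ereal (f l / l) < y"
    proof eventually_elim
      case (elim l)
      then have "ereal (f l / l) < ereal r2" by simp
      then show ?case using r2(2) by (rule less_trans)
    qed
  qed
  show "Liminf at_top (\<lambda>l. ereal (f l / l)) \<le> Liminf at_top (\<lambda>l. ereal (g l / l))"
    unfolding le_Liminf_iff
  proof (intro allI impI)
    fix y assume y: "y < Liminf at_top (\<lambda>l. ereal (f l / l))"
    obtain r2 where r2: "y < ereal r2" "ereal r2 < Liminf at_top (\<lambda>l. ereal (f l / l))" using ereal_dense2[OF y] by blast
    obtain r1 where r1: "ereal r2 < ereal r1" "ereal r1 < Liminf at_top (\<lambda>l. ereal (f l / l))" using ereal_dense2[OF r2(2)] by blast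
    have "\<forall>\<^sub>F l in at_top. ereal r1 < ereal (f l / l)" using r1(2) by (rule less_LiminfD)
    moreover have "\<forall>\<^sub>F l in at_top. f l / l < g l / l + (r1 - r2)" using r1(1) by (intro shift) simp
    ultimately show "\<forall>\<^sub>F l in at_top. y < ereal (g l / l)"
    proof eventually_elim
      case (elim l)
      then have "ereal r2 < ereal (g l / l)" by simp
      then show ?case using r2(1) by (rule less_trans[rotated])
    qed
  qed
qed

theorem corollary2p5:
  fixes B :: "real \<Rightarrow> real ^ ('n::finite + 'n) ^ ('n + 'n)" and K s :: real
  assumes "K > 0" and "B \<in> E K"
  shows "mean_index_U B = mean_index_U (\<lambda>t. B (s + t)) \<and>
         mean_index_L B = mean_index_L (\<lambda>t. B (s + t))"
proof -
  let ?f = "maslov_index 1 (fundamental_solution B)" and ?g = "maslov_index 1 (fundamental_solution (\<lambda>t. B (s + t)))"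
  obtain C where C: "\<And>l. l > 0 \<Longrightarrow> \<bar>?f l - ?g l\<bar> \<le> C"
    using maslov_index_shift_bound[OF assms(2)] by blast
  have "?f l \<le> ?g l + C" "?g l \<le> ?f l + C" if "l > 0" for l using C[OF that] by linarith+
  then show ?thesis
    unfolding mean_index_U_def mean_index_L_def
    by (intro conjI antisym Limsup_Liminf_mean_mono)
qed

end
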